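(* Let $N<p<\infty$ and let $\Omega\subseteq\mathbb{R}^N$ be an open Steiner symmetric set with $\Omega\neq\mathbb{R}^N$. For every $p<q<\infty$, let $u_q\in W^{1,p}_0(\Omega)$ be a Steiner symmetric function such that \[ \|u_q\|_{L^q(\Omega)}=1,\qquad \lambda_{p,q}(\Omega)=\int_\Omega|\nabla u_q|^p\,dx . \] Then there exists a Steiner symmetric function $u_\infty\in W^{1,p}_0(\Omega)$ such that \[ \lim_{q\to\infty}\|u_q-u_\infty\|_{W^{1,p}(\Omega)}=0 . \] Moreover, $u_\infty$ is the unique Steiner symmetric extremal of $\lambda_{p,\infty}(\Omega)$. Finally, \[ \lambda_{p,q}(\Omega)\,(u_q)^{q-1}\ \rightharpoonup\ \lambda_{p,\infty}(\Omega)\,\delta_0\qquad\text{in }\mathscr{D}'(\Omega),\ \text{as } q\to\infty, \] where $\delta_0$ is the Dirac mass at the origin.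
   Context: Steiner symmetric sets. Let $\{\mathbf{e}_1,\dots,\mathbf{e}_N\}$ be the canonical basis of $\mathbb{R}^N$. An open set $\Omega\subseteq\mathbb{R}^N$ is Steiner symmetric if, for every $j\in\{1,\dots,N\}$: (S1) $\Omega$ is invariant under the reflection $x\mapsto x-2\langle x,\mathbf{e}_j\rangle\mathbf{e}_j$; (S2) $\Omega$ is convex in the direction $\mathbf{e}_j$, i.e. the intersection of $\Omega$ with every line parallel to $\mathbf{e}_j$ is convex. Steiner symmetrization. For $\mathbf{e}\in\mathbb{S}^{N-1}$ let $\Pi_{\mathbf e}(x)=x-\langle x,\mathbf e\rangle\mathbf e$. For $E\subseteq\mathbb{R}^N$ measurable and $x\in\Pi_{\mathbf e}(E)$ let $E_{\mathbf e}(x)=\{y\in E:\ y=x+t\mathbf e \text{ for some } t\in\mathbb{R}\}$, and $\mathcal{S}_{\mathbf e}(E)=\{x+t\,\mathbf e:\ x\in\Pi_{\mathbf e}(E),\ |t|<\tfrac12\mathcal{H}^1(E_{\mathbf e}(x))\}$. For a non-negative $u\in L^p(\Omega)$ (extended by $0$ outside $\Omega$), $\mathcal{S}_{\mathbf e}(u)(y)=\int_0^{+\infty}1_{\mathcal{S}_{\mathbf e}(\{u>t\})}(y)\,dt$. If $\Omega$ is Steiner symmetric, a non-negative $u\in L^p(\Omega)$ is called Steiner symmetric if $u=\mathcal{S}_{\mathbf e_j}(u)$ (a.e.) in $\Omega$ for every $j\in\{1,\dots,N\}$. $W^{1,p}_0(\Omega)$ is the closure of $C^\infty_0(\Omega)$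 in $W^{1,p}(\Omega)$. For $p<q\le\infty$, $\lambda_{p,q}(\Omega)=\inf\{\int_\Omega|\nabla\varphi|^p\,dx:\ \varphi\in C^\infty_0(\Omega),\ \|\varphi\|_{L^q(\Omega)}=1\}$; equivalently the infimum can be taken over $W^{1,p}_0(\Omega)$. An extremal of $\lambda_{p,\infty}(\Omega)$ is a function $u\in W^{1,p}_0(\Omega)$ with $\|u\|_{L^\infty(\Omega)}=1$ and $\int_\Omega|\nabla u|^p\,dx=\lambda_{p,\infty}(\Omega)$. *)

theory Defs
  imports "HOL-Analysis.Analysis" "HOL-Probability.Essential_Supremum"
begin

text \<open>
  Everything is set in a Euclidean space; on \<open>real ^ 'n\<close> the set \<open>Basis\<close> is exactly the canonical
  basis.  A function on an open set \<open>\<Omega>\<close> is represented by a total function whose values outside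
  \<open>\<Omega>\<close> are irrelevant, and functions are identified when they agree a.e. in \<open>\<Omega>\<close>.
\<close>

section \<open>Steiner symmetric sets\<close>

definition steiner_symmetric_set :: "'a::euclidean_space set \<Rightarrow> bool" where
  "steiner_symmetric_set \<Omega> \<longleftrightarrow>
     (\<forall>e\<in>Basis. (\<lambda>x. x - (2 * (x \<bullet> e)) *\<^sub>R e) ` \<Omega> = \<Omega>) \<and>
     (\<forall>e\<in>Basis. \<forall>x. convex (\<Omega> \<inter> range (\<lambda>t::real. x + t *\<^sub>R e)))"

section \<open>Lebesgue and Sobolev spaces\<close>

definition Lp_space :: "'a::euclidean_space set \<Rightarrow> ereal \<Rightarrow> ('a \<Rightarrow> 'b::euclidean_space) set" where
  "Lp_space \<Omega> q = {u \<in> borel_measurable (lebesgue_on \<Omega>).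
     if q = \<infinity> then \<exists>C. AE x in lebesgue_on \<Omega>. norm (u x) \<le> C
     else integrable (lebesgue_on \<Omega>) (\<lambda>x. norm (u x) powr real_of_ereal q)}"

text \<open>This is the norm on \<open>Lp_space \<Omega> q\<close>; if \<open>u\<close> is measurable but its norm is infinite, the
  value is \<open>0\<close>.  In particular \<open>Lp_norm \<Omega> q u = 1\<close> entails that the norm is finite.\<close>

definition Lp_norm :: "'a::euclidean_space set \<Rightarrow> ereal \<Rightarrow> ('a \<Rightarrow> 'b::euclidean_space) \<Rightarrow> real" where
  "Lp_norm \<Omega> q u =
     (if q = \<infinity> then enn2real (esssup (lebesgue_on \<Omega>) (\<lambda>x. ennreal (norm (u x))))
      else (LINT x|lebesgue_on \<Omega>. norm (u x) powr real_of_ereal q) powr (1 / real_of_ereal q))"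

abbreviation partial_deriv :: "'a::euclidean_space \<Rightarrow> ('a \<Rightarrow> real) \<Rightarrow> 'a \<Rightarrow> real" where
  "partial_deriv e f x \<equiv> frechet_derivative f (at x) e"

definition gradient :: "('a::euclidean_space \<Rightarrow> real) \<Rightarrow> 'a \<Rightarrow> 'a" where
  "gradient f x = (\<Sum>e\<in>Basis. partial_deriv e f x *\<^sub>R e)"

fun C_k :: "nat \<Rightarrow> ('a::euclidean_space \<Rightarrow> real) \<Rightarrow> bool" where
  "C_k 0 f \<longleftrightarrow> continuous_on UNIV f"
| "C_k (Suc k) f \<longleftrightarrow> (\<forall>x. f differentiable (at x)) \<and> (\<forall>e\<in>Basis. C_k k (partial_deriv e f))"

text \<open>The functions in \<open>C\<^sub>0\<^sup>\<infinity>(\<Omega>)\<close> are smooth on the whole space, with compact support in \<open>\<Omega>\<close>.\<close>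

definition C0_infinity :: "'a::euclidean_space set \<Rightarrow> ('a \<Rightarrow> real) set" where
  "C0_infinity \<Omega> = {\<phi>. (\<forall>k. C_k k \<phi>) \<and>
     compact (closure {x. \<phi> x \<noteq> 0}) \<and> closure {x. \<phi> x \<noteq> 0} \<subseteq> \<Omega>}"

definition locally_integrable :: "'a::euclidean_space set \<Rightarrow> ('a \<Rightarrow> 'b::euclidean_space) \<Rightarrow> bool" where
  "locally_integrable \<Omega> u \<longleftrightarrow> (\<forall>K. compact K \<and> K \<subseteq> \<Omega> \<longrightarrow> set_integrable lebesgue K u)"

definition has_weak_gradient ::
    "'a::euclidean_space set \<Rightarrow> ('a \<Rightarrow> real) \<Rightarrow> ('a \<Rightarrow> 'a) \<Rightarrow> bool" where
  "has_weak_gradient \<Omega> u g \<longleftrightarrow> locally_integrable \<Omega> u \<and> locally_integrable \<Omega> g \<and>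
     (\<forall>\<phi>\<in>C0_infinity \<Omega>. \<forall>e\<in>Basis.
        (LINT x|lebesgue_on \<Omega>. u x * partial_deriv e \<phi> x) =
        - (LINT x|lebesgue_on \<Omega>. (g x \<bullet> e) * \<phi> x))"

text \<open>A weak gradient is unique up to equality a.e. in \<open>\<Omega>\<close>, so the choice of representative
  below is harmless.\<close>

definition weak_gradient :: "'a::euclidean_space set \<Rightarrow> ('a \<Rightarrow> real) \<Rightarrow> 'a \<Rightarrow> 'a" where
  "weak_gradient \<Omega> u = (SOME g. has_weak_gradient \<Omega> u g)"

definition W1p :: "'a::euclidean_space set \<Rightarrow> real \<Rightarrow> ('a \<Rightarrow> real) set" where
  "W1p \<Omega> p = {u \<in> Lp_space \<Omega> (ereal p). \<exists>g\<in>Lp_space \<Omega> (ereal p). has_weak_gradient \<Omega> u g}"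

definition W1p_norm :: "'a::euclidean_space set \<Rightarrow> real \<Rightarrow> ('a \<Rightarrow> real) \<Rightarrow> real" where
  "W1p_norm \<Omega> p u = Lp_norm \<Omega> (ereal p) u + Lp_norm \<Omega> (ereal p) (weak_gradient \<Omega> u)"

definition W1p_0 :: "'a::euclidean_space set \<Rightarrow> real \<Rightarrow> ('a \<Rightarrow> real) set" where
  "W1p_0 \<Omega> p = {u \<in> W1p \<Omega> p. \<forall>\<epsilon>>0. \<exists>\<phi>\<in>C0_infinity \<Omega>. W1p_norm \<Omega> p (\<lambda>x. \<phi> x - u x) < \<epsilon>}"

section \<open>Steiner symmetrization\<close>

text \<open>The one-dimensional Hausdorff (outer) measure.  The customary normalizing factor
  \<open>\<omega>\<^sub>s / 2\<^sup>s\<close> equals \<open>1\<close> for \<open>s = 1\<close>.\<close>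

definition hausdorff1_delta :: "real \<Rightarrow> 'a::metric_space set \<Rightarrow> ennreal" where
  "hausdorff1_delta \<delta> A =
     (INF U \<in> {U :: nat \<Rightarrow> 'a set. A \<subseteq> (\<Union>i. U i) \<and> (\<forall>i. bounded (U i) \<and> diameter (U i) \<le> \<delta>)}.
        \<Sum>i. ennreal (diameter (U i)))"

definition hausdorff1 :: "'a::metric_space set \<Rightarrow> ennreal" where
  "hausdorff1 A = (SUP \<delta>\<in>{0<..}. hausdorff1_delta \<delta> A)"

definition orth_proj :: "'a::euclidean_space \<Rightarrow> 'a \<Rightarrow> 'a" where
  "orth_proj e x = x - (x \<bullet> e) *\<^sub>R e"

definition line_section :: "'a::euclidean_space \<Rightarrow> 'a set \<Rightarrow> 'a \<Rightarrow> 'a set" where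
  "line_section e E x = {y \<in> E. \<exists>t::real. y = x + t *\<^sub>R e}"

definition steiner_set :: "'a::euclidean_space \<Rightarrow> 'a set \<Rightarrow> 'a set" where
  "steiner_set e E = {x + t *\<^sub>R e | x t.
     x \<in> orth_proj e ` E \<and> ennreal \<bar>t\<bar> < hausdorff1 (line_section e E x) / 2}"

definition steiner_fun :: "'a::euclidean_space \<Rightarrow> ('a \<Rightarrow> real) \<Rightarrow> 'a \<Rightarrow> ennreal" where
  "steiner_fun e u y = (\<integral>\<^sup>+t\<in>{0<..}. indicator (steiner_set e {x. u x > t}) y \<partial>lborel)"

definition steiner_symmetric_fun ::
    "'a::euclidean_space set \<Rightarrow> real \<Rightarrow> ('a \<Rightarrow> real) \<Rightarrow> bool" where
  "steiner_symmetric_fun \<Omega> p u \<longleftrightarrow>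
     u \<in> Lp_space \<Omega> (ereal p) \<and> (AE x in lebesgue_on \<Omega>. 0 \<le> u x) \<and>
     (\<forall>e\<in>Basis. AE x in lebesgue_on \<Omega>.
        ennreal (u x) = steiner_fun e (\<lambda>y. if y \<in> \<Omega> then u y else 0) x)"

section \<open>The sharp Poincare-Sobolev constants\<close>

text \<open>The infimum is over a nonempty set of nonnegative reals as soon as \<open>\<Omega>\<close> is open and
  nonempty.\<close>

definition sobolev_const :: "real \<Rightarrow> ereal \<Rightarrow> 'a::euclidean_space set \<Rightarrow> real" where
  "sobolev_const p q \<Omega> =
     (INF \<phi> \<in> {\<phi> \<in> C0_infinity \<Omega>. Lp_norm \<Omega> q \<phi> = 1}.
        LINT x|lebesgue_on \<Omega>. norm (gradient \<phi> x) powr p)"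

definition is_extremal :: "real \<Rightarrow> ereal \<Rightarrow> 'a::euclidean_space set \<Rightarrow> ('a \<Rightarrow> real) \<Rightarrow> bool" where
  "is_extremal p q \<Omega> u \<longleftrightarrow> u \<in> W1p_0 \<Omega> p \<and> Lp_norm \<Omega> q u = 1 \<and>
     (LINT x|lebesgue_on \<Omega>. norm (weak_gradient \<Omega> u x) powr p) = sobolev_const p q \<Omega>"

section \<open>Distributions\<close>

definition distribution_of ::
    "'a::euclidean_space set \<Rightarrow> ('a \<Rightarrow> real) \<Rightarrow> ('a \<Rightarrow> real) \<Rightarrow> real" where
  "distribution_of \<Omega> f \<phi> = (LINT x|lebesgue_on \<Omega>. f x * \<phi> x)"

definition dirac :: "'a \<Rightarrow> ('a \<Rightarrow> real) \<Rightarrow> real" where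
  "dirac a \<phi> = \<phi> a"

definition tendsto_distributions :: "'a::euclidean_space set \<Rightarrow>
    ('i \<Rightarrow> ('a \<Rightarrow> real) \<Rightarrow> real) \<Rightarrow> (('a \<Rightarrow> real) \<Rightarrow> real) \<Rightarrow> 'i filter \<Rightarrow> bool" where
  "tendsto_distributions \<Omega> T S F \<longleftrightarrow> (\<forall>\<phi>\<in>C0_infinity \<Omega>. ((\<lambda>i. T i \<phi>) \<longlongrightarrow> S \<phi>) F)"

end

theory Submission
  imports Defs
begin

text \<open>
  Since \<open>p > N\<close> and the complement of \<open>\<Omega>\<close> contains a translate of every orthant, both the supremum
  and the \<open>L\<^sup>p\<close> norm of a function in \<open>W\<^sub>0\<^sup>1\<^sup>,\<^sup>p(\<Omega>)\<close> are controlled by its energy.  Steiner symmetry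
  places the maximum of \<open>u\<^sub>q\<close> at the origin, hence \<open>\<lambda>\<^sub>p\<^sub>,\<^sub>\<infinity> u\<^sub>q(0)\<^sup>p \<le> \<lambda>\<^sub>p\<^sub>,\<^sub>q\<close>, while \<open>limsup \<lambda>\<^sub>p\<^sub>,\<^sub>q \<le> \<lambda>\<^sub>p\<^sub>,\<^sub>\<infinity>\<close>
  and the normalization forces \<open>liminf u\<^sub>q(0) \<ge> 1\<close>.  So the \<open>u\<^sub>q\<close> are almost minimizers of the energy
  among functions with value \<open>1\<close> at the origin, and uniform convexity makes them converge strongly
  to the unique minimizer; no Polya-Szego inequality is needed.  For the last claim, duality between
  \<open>L\<^sup>q\<close> and \<open>L\<^sup>q\<^sup>/\<^sup>(\<^sup>q\<^sup>-\<^sup>1\<^sup>)\<close> gives \<open>\<lambda>\<^sub>p\<^sub>,\<^sub>q\<^sup>1\<^sup>/\<^sup>p (1 + s \<integral>u\<^sub>q\<^sup>q\<^sup>-\<^sup>1\<phi>) \<le> \<parallel>\<nabla>u\<^sub>q + s \<nabla>\<phi>\<parallel>\<^sub>p\<close> for all real \<open>s\<close>, which is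
  linearized at \<open>s = 0\<close> after letting \<open>q\<close> tend to infinity.
\<close>

section \<open>Powers of the Lebesgue norm\<close>

text \<open>Three obstacles shape the proof. The data are functions up to null sets, yet the
  argument evaluates them at the origin and compares them along lines; so each is replaced by a
  continuous representative, on which Steiner symmetry becomes an everywhere monotonicity. The
  domain may be unbounded and of infinite measure, so strong convergence cannot rest on a compact
  embedding: it comes from a Cauchy estimate along a sequence of exponents, and the limit then
  attracts the whole family because it is itself an almost minimizer. The exterior corners do double
  duty: moving \<open>x\<close> diagonally outward leaves \<open>\<Omega>\<close>, which bounds the
  \<open>p\<close>-norm; averaging over a cube of such exit vectors bounds the value at
  \<open>x\<close>, and there \<open>p > N\<close> makes the integral finite. The bound on the
  \<open>p\<close>-norm is what makes the normalization usable, since the integral of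
  \<open>u_q^q\<close> is at most \<open>u_q(0)^(q-p)\<close> times that of \<open>u_q^p\<close>.
  Throughout, \<open>p\<close>-th powers of norms replace norms: a triangle inequality with a
  constant is enough, and uniform convexity becomes a pointwise inequality that can be
  integrated.\<close>

definition in_Lp :: "'a measure \<Rightarrow> real \<Rightarrow> ('a \<Rightarrow> 'b::euclidean_space) \<Rightarrow> bool" where
  "in_Lp M p f \<longleftrightarrow> f \<in> borel_measurable M \<and> integrable M (\<lambda>x. norm (f x) powr p)"

text \<open>The root is left out: as a plain integral the quantity lets pointwise convexity
  inequalities be integrated, and its smallness is all that convergence requires.\<close>

definition Lp_pow :: "'a measure \<Rightarrow> real \<Rightarrow> ('a \<Rightarrow> 'b::euclidean_space) \<Rightarrow> real" where
  "Lp_pow M p f = (LINT x|M. norm (f x) powr p)"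

lemma in_Lp_measurable: "in_Lp M p f \<Longrightarrow> f \<in> borel_measurable M"
  and in_Lp_integrable: "in_Lp M p f \<Longrightarrow> integrable M (\<lambda>x. norm (f x) powr p)"
  by (simp_all add: in_Lp_def)

lemma Lp_pow_nonneg: "0 \<le> Lp_pow M p f"
  by (simp add: Lp_pow_def)

lemma Lp_pow_minus_commute: "Lp_pow M p (\<lambda>x. f x - g x) = Lp_pow M p (\<lambda>x. g x - f x)"
  by (simp add: Lp_pow_def norm_minus_commute)

lemma norm_add_powr_le:
  fixes a b :: "'a::real_normed_vector"
  assumes "0 \<le> p"
  shows "norm (a + b) powr p \<le> 2 powr p * (norm a powr p + norm b powr p)"
proof -
  have "norm (a + b) \<le> 2 * max (norm a) (norm b)"
    using norm_triangle_ineq[of a b] by simp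
  then have "norm (a + b) powr p \<le> (2 * max (norm a) (norm b)) powr p"
    using assms by (intro powr_mono2) auto
  also have "\<dots> = 2 powr p * max (norm a) (norm b) powr p"
    by (simp add: powr_mult)
  also have "\<dots> \<le> 2 powr p * (norm a powr p + norm b powr p)"
    by (intro mult_left_mono) (auto simp: max_def)
  finally show ?thesis .
qed

text \<open>Young's inequality with exponents \<open>p\<close> and \<open>p / (p - 1)\<close>,
  arranged with equality at \<open>a = b\<close>: the same line yields Hoelder's inequality after
  integration and is the tangent inequality for the power function.\<close>

lemma young_powr:
  fixes a b p :: real
  assumes p: "1 < p" and "0 \<le> a" "0 \<le> b"
  shows "a * b powr (p - 1) \<le> a powr p / p + (1 - 1 / p) * b powr p"
proof -
  have "a * b powr (p - 1) \<le> a powr p / p + (b powr (p - 1)) powr (p / (p - 1)) / (p / (p - 1))"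
    using assms by (intro Youngs_inequality) (auto simp: field_simps)
  also have "(b powr (p - 1)) powr (p / (p - 1)) = b powr p" using p by (simp add: powr_powr)
  also have "b powr p / (p / (p - 1)) = (1 - 1 / p) * b powr p" using p by (simp add: field_simps)
  finally show ?thesis .
qed

lemma in_Lp_add:
  assumes "0 \<le> p" "in_Lp M p f" "in_Lp M p g"
  shows "in_Lp M p (\<lambda>x. f x + g x)"
  unfolding in_Lp_def
proof
  show *: "(\<lambda>x. f x + g x) \<in> borel_measurable M"
    using assms by (auto simp: in_Lp_def)
  show "integrable M (\<lambda>x. norm (f x + g x) powr p)"
  proof (rule Bochner_Integration.integrable_bound)
    show "integrable M (\<lambda>x. 2 powr p * (norm (f x) powr p + norm (g x) powr p))"
      using assms by (auto simp: in_Lp_def)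
    show "(\<lambda>x. norm (f x + g x) powr p) \<in> borel_measurable M"
      using * by measurable
    show "AE x in M. norm (norm (f x + g x) powr p)
        \<le> norm (2 powr p * (norm (f x) powr p + norm (g x) powr p))"
      using norm_add_powr_le[OF assms(1)] by (auto simp: abs_of_nonneg)
  qed
qed

lemma in_Lp_scaleR: "in_Lp M p f \<Longrightarrow> in_Lp M p (\<lambda>x. c *\<^sub>R f x)"
  by (auto simp: in_Lp_def powr_mult)

lemma in_Lp_diff:
  assumes "0 \<le> p" "in_Lp M p f" "in_Lp M p g"
  shows "in_Lp M p (\<lambda>x. f x - g x)"
  using in_Lp_add[OF assms(1,2) in_Lp_scaleR[OF assms(3), of "-1"]] by simp

lemma in_Lp_cong_AE:
  assumes "AE x in M. f x = g x" "in_Lp M p f" "g \<in> borel_measurable M"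
  shows "in_Lp M p g"
  unfolding in_Lp_def
proof
  show "integrable M (\<lambda>x. norm (g x) powr p)"
    by (rule integrable_cong_AE_imp[OF in_Lp_integrable[OF assms(2)]])
       (use assms in \<open>auto\<close>)
qed (use assms in auto)

lemma Lp_pow_cong_AE:
  assumes "AE x in M. f x = g x" "f \<in> borel_measurable M" "g \<in> borel_measurable M"
  shows "Lp_pow M p f = Lp_pow M p g"
  unfolding Lp_pow_def
  by (rule integral_cong_AE) (use assms in auto)

lemma Lp_pow_scaleR: "Lp_pow M p (\<lambda>x. c *\<^sub>R f x) = \<bar>c\<bar> powr p * Lp_pow M p f"
  by (simp add: Lp_pow_def powr_mult)

lemma Lp_pow_add_le:
  assumes "0 \<le> p" "in_Lp M p f" "in_Lp M p g"
  shows "Lp_pow M p (\<lambda>x. f x + g x) \<le> 2 powr p * (Lp_pow M p f + Lp_pow M p g)"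
proof -
  have "Lp_pow M p (\<lambda>x. f x + g x) \<le> (LINT x|M. 2 powr p * (norm (f x) powr p + norm (g x) powr p))"
    unfolding Lp_pow_def
    by (intro integral_mono in_Lp_integrable in_Lp_add assms)
       (use assms in \<open>auto simp: in_Lp_def norm_add_powr_le\<close>)
  also have "\<dots> = 2 powr p * (Lp_pow M p f + Lp_pow M p g)"
    using assms by (simp add: in_Lp_def Lp_pow_def)
  finally show ?thesis .
qed

lemma Lp_pow_diff_triangle:
  assumes "0 \<le> p" "in_Lp M p f" "in_Lp M p g" "in_Lp M p h"
  shows "Lp_pow M p (\<lambda>x. f x - h x)
     \<le> 2 powr p * (Lp_pow M p (\<lambda>x. f x - g x) + Lp_pow M p (\<lambda>x. g x - h x))"
  using Lp_pow_add_le[OF assms(1) in_Lp_diff[OF assms(1,2,3)] in_Lp_diff[OF assms(1,3,4)]] by simp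

section \<open>Convexity and continuity of the power of the norm\<close>

lemma norm_powr_convex:
  assumes "1 \<le> p"
  shows "convex_on UNIV (\<lambda>x::'a::real_normed_vector. norm x powr p)"
proof (rule convex_onI)
  fix t :: real and x y :: 'a
  assume t: "0 < t" "t < 1"
  have "norm ((1 - t) *\<^sub>R x + t *\<^sub>R y) powr p \<le> ((1 - t) * norm x + t * norm y) powr p"
    using t assms norm_triangle_ineq[of "(1 - t) *\<^sub>R x" "t *\<^sub>R y"]
    by (intro powr_mono2) auto
  also have "\<dots> \<le> (1 - t) * norm x powr p + t * norm y powr p"
  proof -
    \<comment> \<open>Covers a zero vector: then a single term is left and
      \<open>s powr p \<le> s\<close>. Convexity on the line is called on when both norms are
      positive.\<close>
    have le: "(s * c) powr p \<le> s * c powr p" if "0 < s" "s < 1" "0 \<le> c" for s c :: real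
      using that assms powr_mono'[of 1 p s] by (simp add: powr_mult mult_right_mono)
    show ?thesis
      using convex_onD[OF powr_convex[OF assms], of t "norm x" "norm y"] t
        le[of "1 - t" "norm x"] le[of t "norm y"] by (cases "x = 0"; cases "y = 0") auto
  qed
  finally show "norm ((1 - t) *\<^sub>R x + t *\<^sub>R y) powr p
      \<le> (1 - t) * norm x powr p + t * norm y powr p" .
qed simp

lemma norm_powr_convexD:
  assumes "1 \<le> p" "0 \<le> t" "t \<le> 1"
  shows "norm ((1 - t) *\<^sub>R x + t *\<^sub>R y) powr p \<le> (1 - t) * norm x powr p + t * norm (y::'a::real_normed_vector) powr p"
  using convex_onD[OF norm_powr_convex[OF assms(1)], of t x y] assms by simp

lemma norm_powr_midpoint_le:
  assumes "1 \<le> p"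
  shows "norm ((1/2) *\<^sub>R (a + b)) powr p \<le> (norm a powr p + norm (b::'a::real_normed_vector) powr p) / 2"
  using norm_powr_convexD[OF assms, of "1/2" a b] by (simp add: scaleR_add_right)

text \<open>Convexity applied to \<open>a / (1 - t)\<close> and \<open>b / t\<close>. As
  \<open>t\<close> tends to \<open>0\<close> the factor of the first term tends to \<open>1\<close>,
  so a perturbation costs only an arbitrarily small part of the main term.\<close>

lemma norm_add_powr_le_weighted:
  fixes a b :: "'a::real_normed_vector"
  assumes "1 \<le> p" "0 < t" "t < 1"
  shows "norm (a + b) powr p \<le> (1 - t) powr (1 - p) * norm a powr p + t powr (1 - p) * norm b powr p"
proof -
  have e: "s * norm ((1 / s) *\<^sub>R c) powr p = s powr (1 - p) * norm c powr p" if "0 < s" for s and c :: 'a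
  proof -
    have "s * norm ((1 / s) *\<^sub>R c) powr p = s * ((1 / s) powr p * norm c powr p)"
      using that by (simp add: powr_divide divide_simps)
    also have "\<dots> = s powr (1 - p) * norm c powr p"
      using that by (simp add: powr_diff powr_divide)
    finally show ?thesis .
  qed
  have "norm (a + b) powr p = norm ((1 - t) *\<^sub>R ((1 / (1 - t)) *\<^sub>R a) + t *\<^sub>R ((1 / t) *\<^sub>R b)) powr p"
    using assms by simp
  also have "\<dots> \<le> (1 - t) * norm ((1 / (1 - t)) *\<^sub>R a) powr p + t * norm ((1 / t) *\<^sub>R b) powr p"
    using assms by (intro norm_powr_convexD) auto
  also have "\<dots> = (1 - t) powr (1 - p) * norm a powr p + t powr (1 - p) * norm b powr p"
    using e[of "1 - t" a] e[of t b] assms by simp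
  finally show ?thesis .
qed

text \<open>Pointwise continuity of the power in a form that survives integration: a small multiple
  of one power plus a large multiple of the power of the difference.\<close>

lemma norm_powr_diff_le:
  assumes "1 \<le> p" "0 < \<epsilon>"
  obtains C where "0 \<le> C"
    "\<And>a b :: 'a::real_normed_vector. \<bar>norm a powr p - norm b powr p\<bar> \<le> \<epsilon> * norm b powr p + C * norm (a - b) powr p"
proof -
  define \<delta> where "\<delta> = min 1 (\<epsilon> / 2)"
  have \<delta>: "0 < \<delta>" "\<delta> \<le> 1" "\<delta> \<le> \<epsilon> / 2" using assms by (auto simp: \<delta>_def)
  have "((\<lambda>t::real. (1 - t) powr (1 - p)) \<longlongrightarrow> (1 - 0) powr (1 - p)) (at_right 0)"
    by (intro tendsto_intros) auto
  then have "eventually (\<lambda>t::real. (1 - t) powr (1 - p) < 1 + \<delta>) (at_right 0)"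
    using \<delta> by (intro order_tendstoD(2)) auto
  moreover have "eventually (\<lambda>t::real. 0 < t \<and> t < 1) (at_right 0)"
    using eventually_at_right_real[of 0 "1::real"] by (auto elim: eventually_mono)
  ultimately have "eventually (\<lambda>t::real. (1 - t) powr (1 - p) < 1 + \<delta> \<and> 0 < t \<and> t < 1) (at_right 0)"
    by eventually_elim auto
  then obtain t :: real where t: "(1 - t) powr (1 - p) < 1 + \<delta>" "0 < t" "t < 1"
    using eventually_happens' trivial_limit_at_right_real by blast
  define T where "T = t powr (1 - p)"
  have T: "0 \<le> T" by (simp add: T_def)
  have b1: "norm a powr p \<le> (1 + \<delta>) * norm b powr p + T * norm (a - b) powr p" for a b :: 'a
  proof -
    have "norm a powr p = norm (b + (a - b)) powr p" by simp
    also have "\<dots> \<le> (1 - t) powr (1 - p) * norm b powr p + T * norm (a - b) powr p"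
      unfolding T_def using t assms by (intro norm_add_powr_le_weighted) auto
    also have "\<dots> \<le> (1 + \<delta>) * norm b powr p + T * norm (a - b) powr p"
      using t by (intro add_mono mult_right_mono) auto
    finally show ?thesis .
  qed
  have "\<bar>norm a powr p - norm b powr p\<bar> \<le> \<epsilon> * norm b powr p + 2 * T * norm (a - b) powr p" for a b :: 'a
  proof -
    let ?A = "norm a powr p" and ?B = "norm b powr p" and ?D = "T * norm (a - b) powr p"
    have 1: "?A \<le> (1 + \<delta>) * ?B + ?D" by (rule b1)
    have 2: "?B \<le> (1 + \<delta>) * ?A + ?D" using b1[of b a] by (simp add: norm_minus_commute)
    have D: "0 \<le> ?D" using T by simp
    have eB: "\<delta> * ?B \<le> \<epsilon> / 2 * ?B" using \<delta> by (intro mult_right_mono) auto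
    show ?thesis
    \<comment> \<open>The bound with exchanged roles has \<open>?A\<close> on the right; it may be
      replaced by \<open>?B\<close> when \<open>?A \<le> ?B\<close>.\<close>
    proof (cases "?A \<le> ?B")
      case True
      have "\<delta> * ?A \<le> \<delta> * ?B" using True \<delta> by (intro mult_left_mono) auto
      then have "?B - ?A \<le> \<delta> * ?B + ?D" using 2 by (simp add: algebra_simps)
      moreover have "\<epsilon> / 2 * ?B \<le> \<epsilon> * ?B" using assms by (intro mult_right_mono) auto
      ultimately show ?thesis using True eB D by linarith
    next
      case False
      have "?A - ?B \<le> \<delta> * ?B + ?D" using 1 by (simp add: algebra_simps)
      moreover have "\<epsilon> / 2 * ?B \<le> \<epsilon> * ?B" using assms by (intro mult_right_mono) auto
      ultimately show ?thesis using False eB D by linarith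
    qed
  qed
  then show ?thesis using that[of "2 * T"] T by auto
qed

lemma Lp_pow_tendsto:
  fixes f :: "'i \<Rightarrow> 'a \<Rightarrow> 'b::euclidean_space"
  assumes p: "1 \<le> p" and f: "eventually (\<lambda>i. in_Lp M p (f i)) F" and g: "in_Lp M p g"
    and lim: "((\<lambda>i. Lp_pow M p (\<lambda>x. f i x - g x)) \<longlongrightarrow> 0) F"
  shows "((\<lambda>i. Lp_pow M p (f i)) \<longlongrightarrow> Lp_pow M p g) F"
proof (rule tendstoI)
  fix \<eta> :: real assume \<eta>: "0 < \<eta>"
  define \<epsilon> where "\<epsilon> = \<eta> / (2 * (Lp_pow M p g + 1))"
  have g0: "0 \<le> Lp_pow M p g" by (rule Lp_pow_nonneg)
  have \<epsilon>: "0 < \<epsilon>" using \<eta> g0 by (auto simp: \<epsilon>_def intro!: divide_pos_pos)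
  have "\<epsilon> * (Lp_pow M p g + 1) = \<eta> / 2" using g0 by (simp add: \<epsilon>_def divide_simps)
  then have \<epsilon>g: "\<epsilon> * Lp_pow M p g < \<eta> / 2" using \<epsilon> by (simp add: algebra_simps)
  obtain C where C: "0 \<le> C" "\<And>a b :: 'b. \<bar>norm a powr p - norm b powr p\<bar> \<le> \<epsilon> * norm b powr p + C * norm (a - b) powr p"
    using norm_powr_diff_le[OF p \<epsilon>] by blast
  have "((\<lambda>i. C * Lp_pow M p (\<lambda>x. f i x - g x)) \<longlongrightarrow> C * 0) F"
    by (intro tendsto_intros lim)
  then have "eventually (\<lambda>i. C * Lp_pow M p (\<lambda>x. f i x - g x) < \<eta> / 2) F"
    using \<eta> by (intro order_tendstoD(2)) auto
  then show "eventually (\<lambda>i. dist (Lp_pow M p (f i)) (Lp_pow M p g) < \<eta>) F"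
    using f
  proof eventually_elim
    case (elim i)
    have d: "in_Lp M p (\<lambda>x. f i x - g x)" using elim(2) g p by (intro in_Lp_diff) auto
    have "dist (Lp_pow M p (f i)) (Lp_pow M p g) = \<bar>LINT x|M. norm (f i x) powr p - norm (g x) powr p\<bar>"
      using elim g by (simp add: dist_real_def Lp_pow_def in_Lp_def)
    also have "\<dots> \<le> (LINT x|M. \<epsilon> * norm (g x) powr p + C * norm (f i x - g x) powr p)"
    proof (rule order_trans[OF integral_abs_bound], rule integral_mono)
      show "integrable M (\<lambda>x. \<bar>norm (f i x) powr p - norm (g x) powr p\<bar>)"
        using elim g by (auto simp: in_Lp_def)
      show "integrable M (\<lambda>x. \<epsilon> * norm (g x) powr p + C * norm (f i x - g x) powr p)"
        using d g by (auto simp: in_Lp_def)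
    qed (use C in auto)
    also have "\<dots> = \<epsilon> * Lp_pow M p g + C * Lp_pow M p (\<lambda>x. f i x - g x)"
      using d g by (simp add: Lp_pow_def in_Lp_def)
    finally show ?case using elim(1) \<epsilon>g by linarith
  qed
qed

section \<open>Strict and uniform convexity\<close>

lemma powr_midpoint_less:
  fixes x y :: real
  assumes p: "1 < p" and "0 \<le> x" "x < y"
  shows "((x + y) / 2) powr p < (x powr p + y powr p) / 2"
proof -
  define m where "m = (x + y) / 2"
  have m: "x < m" "m < y" "y - m = m - x" using assms by (auto simp: m_def field_simps)
  have ex: "\<exists>z>a. z < b \<and> b powr p - a powr p = (b - a) * (p * z powr (p - 1))" if "0 \<le> a" "a < b" for a b :: real
  proof -
    have "\<exists>z>a. z < b \<and> b powr p - a powr p = (\<lambda>h. h * (p * z powr (p - 1))) (b - a)"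
    proof (rule mvt[OF that(2), where f = "\<lambda>t. t powr p" and f' = "\<lambda>z h. h * (p * z powr (p - 1))"])
      show "continuous_on {a..b} (\<lambda>t. t powr p)"
        using that p by (intro continuous_on_powr') (auto intro: continuous_intros)
      fix z assume "a < z" "z < b"
      then show "((\<lambda>t. t powr p) has_derivative (\<lambda>h. h * (p * z powr (p - 1)))) (at z)"
        using that has_real_derivative_powr[of z p]
        by (simp add: has_field_derivative_def mult.commute[of _ "p * z powr (p - 1)"])
    qed (auto)
    then show ?thesis by simp
  qed
  obtain z1 where z1: "x < z1" "z1 < m" "m powr p - x powr p = (m - x) * (p * z1 powr (p - 1))"
    using ex[of x m] assms m by auto
  obtain z2 where z2: "m < z2" "z2 < y" "y powr p - m powr p = (y - m) * (p * z2 powr (p - 1))"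
    using ex[of m y] assms m by auto
  have "z1 powr (p - 1) < z2 powr (p - 1)"
    using z1 z2 assms by (intro powr_less_mono2) auto
  then have "(m - x) * (p * z1 powr (p - 1)) < (m - x) * (p * z2 powr (p - 1))"
    using m p by simp
  then have "m powr p - x powr p < y powr p - m powr p" using z1 z2 m by simp
  then show ?thesis by (simp add: m_def[symmetric])
qed

text \<open>Strictness has two sources: for equal lengths the parallelogram law, for different
  lengths strict convexity of the power on the half line.\<close>

lemma norm_powr_midpoint_less:
  fixes a b :: "'a::real_inner"
  assumes p: "1 < p" and "a \<noteq> b"
  shows "norm ((1/2) *\<^sub>R (a + b)) powr p < (norm a powr p + norm b powr p) / 2"
proof (cases "norm a = norm b")
  case True
  have "(norm (a + b))\<^sup>2 + (norm (a - b))\<^sup>2 = 2 * (norm a)\<^sup>2 + 2 * (norm b)\<^sup>2"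
    by (simp add: power2_norm_eq_inner inner_simps)
  moreover have "0 < (norm (a - b))\<^sup>2" using assms by simp
  moreover have "(2 * norm a)\<^sup>2 = 4 * (norm b)\<^sup>2" using True by (simp add: power_mult_distrib)
  ultimately have "(norm (a + b))\<^sup>2 < (2 * norm a)\<^sup>2"
    unfolding True by linarith
  then have "norm (a + b) < 2 * norm a"
    by (rule power_less_imp_less_base) simp
  then have "norm ((1/2) *\<^sub>R (a + b)) powr p < norm a powr p"
    using p by (intro powr_less_mono2) auto
  then show ?thesis using True by simp
next
  case False
  have "norm ((1/2) *\<^sub>R (a + b)) powr p \<le> ((norm a + norm b) / 2) powr p"
    using p norm_triangle_ineq[of a b] by (intro powr_mono2) auto
  also have "\<dots> < (norm a powr p + norm b powr p) / 2"
  proof (cases "norm a < norm b")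
    case True then show ?thesis using powr_midpoint_less[OF p, of "norm a" "norm b"] by simp
  next
    case False
    then show ?thesis using \<open>norm a \<noteq> norm b\<close> powr_midpoint_less[OF p, of "norm b" "norm a"]
      by (simp add: add.commute)
  qed
  finally show ?thesis .
qed

text \<open>Both sides are homogeneous of degree \<open>p\<close> in the pair, so compactness of the unit sphere
  turns strict convexity into a uniform estimate, for all \<open>p > 1\<close> at once.\<close>

lemma norm_powr_uniformly_convex:
  assumes p: "1 < p" and "0 < \<epsilon>"
  obtains C where "0 \<le> C"
    "\<And>a b :: 'a::euclidean_space. norm (a - b) powr p \<le> \<epsilon> * (norm a powr p + norm b powr p)
       + C * ((norm a powr p + norm b powr p) / 2 - norm ((1/2) *\<^sub>R (a + b)) powr p)"
proof -
  define S where "S = (\<lambda>(a::'a, b::'a). norm a powr p + norm b powr p)"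
  define D where "D = (\<lambda>(a::'a, b::'a). (norm a powr p + norm b powr p) / 2 - norm ((1/2) *\<^sub>R (a + b)) powr p)"
  define E where "E = (\<lambda>(a::'a, b::'a). norm (a - b) powr p)"
  have cont: "continuous_on UNIV S" "continuous_on UNIV D" "continuous_on UNIV E"
    unfolding S_def D_def E_def case_prod_beta
    using p by (intro continuous_intros continuous_on_powr'; auto)+
  have D0: "0 \<le> D z" for z
    using norm_powr_midpoint_le[of p] p by (cases z) (auto simp: D_def)
  have E2: "E z \<le> 2 powr p * S z" for z
    using norm_add_powr_le[of p "fst z" "- snd z"] p by (cases z) (auto simp: E_def S_def)
  \<comment> \<open>The pairs on the sphere whose difference is not yet small. If there are any, the
    midpoint deficit \<open>D\<close> has a positive minimum on them.\<close>
  define K where "K = {z. S z = 1 \<and> \<epsilon> \<le> E z}"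
  have "K = (S -` {1}) \<inter> (E -` {\<epsilon>..})" by (auto simp: K_def)
  then have "closed K"
    using cont by (auto intro!: closed_Int closed_vimage)
  moreover have "bounded K"
  proof (rule bounded_subset)
    show "bounded (cball (0::'a) 1 \<times> cball (0::'a) 1)" by (intro bounded_Times) auto
    have "norm a \<le> 1" if "norm a powr p \<le> 1" for a :: 'a
    proof (rule ccontr)
      assume "\<not> norm a \<le> 1"
      then have "1 powr p < norm a powr p" using p by (intro powr_less_mono2) auto
      then show False using that by simp
    qed
    moreover have "norm a powr p \<le> 1 \<and> norm b powr p \<le> 1" if "norm a powr p + norm b powr p = 1" for a b :: 'a
      using that powr_ge_zero[of "norm a" p] powr_ge_zero[of "norm b" p] by linarith
    ultimately show "K \<subseteq> cball 0 1 \<times> cball 0 1"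
      by (auto simp: K_def S_def)
  qed
  ultimately have K: "compact K" by (simp add: compact_eq_bounded_closed)
  obtain C where C: "0 \<le> C" "\<And>z. S z = 1 \<Longrightarrow> E z \<le> \<epsilon> + C * D z"
  proof (cases "K = {}")
    case True
    then have "E z \<le> \<epsilon>" if "S z = 1" for z
      using that unfolding K_def by (metis (mono_tags, lifting) empty_iff linorder_le_cases mem_Collect_eq)
    then show ?thesis using that[of 0] by auto
  next
    case False
    obtain z0 where z0: "z0 \<in> K" "\<And>z. z \<in> K \<Longrightarrow> D z0 \<le> D z"
      using continuous_attains_inf[OF K False] cont(2) continuous_on_subset by (metis subset_UNIV)
    have "fst z0 \<noteq> snd z0"
      using z0(1) \<open>0 < \<epsilon>\<close> by (auto simp: K_def E_def case_prod_beta)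
    then have d: "0 < D z0"
      using norm_powr_midpoint_less[OF p] by (auto simp: D_def case_prod_beta)
    \<comment> \<open>The factor is tuned so that already the minimum of \<open>D\<close> on
      \<open>K\<close> produces the crude bound \<open>2 powr p\<close> for
      \<open>E\<close>.\<close>
    have "E z \<le> \<epsilon> + 2 powr p / D z0 * D z" if "S z = 1" for z
    proof (cases "z \<in> K")
      case True
      have "E z \<le> 2 powr p / D z0 * D z0" using E2[of z] that d by simp
      also have "\<dots> \<le> 2 powr p / D z0 * D z" using z0(2)[OF True] d by (intro mult_left_mono) auto
      finally show ?thesis using \<open>0 < \<epsilon>\<close> by simp
    next
      case False
      then have "E z \<le> \<epsilon>" using that by (auto simp: K_def)
      then show ?thesis using D0[of z] d by (simp add: add_increasing2)
    qed
    then show ?thesis using that[of "2 powr p / D z0"] d by auto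
  qed
  have "E z \<le> \<epsilon> * S z + C * D z" for z
  proof (cases "S z = 0")
    case True
    then have "E z \<le> 0" using E2[of z] by simp
    moreover have "0 \<le> C * D z" using C D0[of z] by simp
    ultimately show ?thesis using True by (simp add: add_nonneg_nonneg)
  next
    case False
    define s where "s = S z"
    have s: "0 < s" using False unfolding s_def S_def case_prod_beta
      by (metis add_nonneg_nonneg less_eq_real_def powr_ge_zero)
    \<comment> \<open>Rescales the pair to the sphere \<open>S = 1\<close>; all three functionals
      are multiplied by \<open>1 / s\<close>.\<close>
    define r where "r = s powr (- 1 / p)"
    have "r powr p = s powr (- 1 / p * p)" by (simp only: r_def powr_powr)
    then have r: "0 < r" "r powr p = 1 / s"
      using s p by (simp_all add: powr_minus_divide) (simp add: r_def)
    have hom: "norm (r *\<^sub>R c) powr p = norm c powr p / s" for c :: 'a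
      using r by (simp add: powr_mult)
    obtain a b where z: "z = (a, b)" by (cases z)
    have "S (r *\<^sub>R a, r *\<^sub>R b) = S z / s" "E (r *\<^sub>R a, r *\<^sub>R b) = E z / s" "D (r *\<^sub>R a, r *\<^sub>R b) = D z / s"
      using hom[of a] hom[of b] hom[of "a - b"] hom[of "(1/2) *\<^sub>R (a + b)"]
      by (auto simp: S_def E_def D_def z scaleR_diff_right scaleR_add_right add_divide_distrib diff_divide_distrib mult.commute)
    then have "E z / s \<le> \<epsilon> + C * (D z / s)"
      using C(2)[of "(r *\<^sub>R a, r *\<^sub>R b)"] s by (simp add: s_def)
    then have "E z \<le> (\<epsilon> + C * (D z / s)) * s"
      using s by (simp add: pos_divide_le_eq)
    also have "\<dots> = \<epsilon> * S z + C * D z"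
      using s by (simp add: algebra_simps s_def)
    finally show ?thesis .
  qed
  then have "norm (a - b) powr p \<le> \<epsilon> * (norm a powr p + norm b powr p)
       + C * ((norm a powr p + norm b powr p) / 2 - norm ((1/2) *\<^sub>R (a + b)) powr p)" for a b :: 'a
    by (metis (mono_tags, lifting) D_def E_def S_def case_prod_conv)
  then show ?thesis using that[OF C(1)] by blast
qed

text \<open>Both sides of the pointwise inequality are linear in the integrated powers, so it is
  simply integrated. What matters is that \<open>C\<close> is chosen before \<open>f\<close> and
  \<open>g\<close>.\<close>

lemma Lp_pow_uniformly_convex:
  fixes f g :: "'a \<Rightarrow> 'b::euclidean_space"
  assumes p: "1 < p" and "0 < \<epsilon>"
  obtains C where "0 \<le> C"
    "\<And>f g :: 'a \<Rightarrow> 'b. in_Lp M p f \<Longrightarrow> in_Lp M p g \<Longrightarrow>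
       Lp_pow M p (\<lambda>x. f x - g x) \<le> \<epsilon> * (Lp_pow M p f + Lp_pow M p g)
         + C * ((Lp_pow M p f + Lp_pow M p g) / 2 - Lp_pow M p (\<lambda>x. (1/2) *\<^sub>R (f x + g x)))"
proof -
  obtain C where C: "0 \<le> C"
    "\<And>a b :: 'b. norm (a - b) powr p \<le> \<epsilon> * (norm a powr p + norm b powr p)
       + C * ((norm a powr p + norm b powr p) / 2 - norm ((1/2) *\<^sub>R (a + b)) powr p)"
    using norm_powr_uniformly_convex[OF assms] by blast
  have "Lp_pow M p (\<lambda>x. f x - g x) \<le> \<epsilon> * (Lp_pow M p f + Lp_pow M p g)
         + C * ((Lp_pow M p f + Lp_pow M p g) / 2 - Lp_pow M p (\<lambda>x. (1/2) *\<^sub>R (f x + g x)))"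
    if f: "in_Lp M p f" and g: "in_Lp M p g" for f g :: "'a \<Rightarrow> 'b"
  proof -
    have i: "integrable M (\<lambda>x. norm (f x) powr p)" "integrable M (\<lambda>x. norm (g x) powr p)"
      "integrable M (\<lambda>x. norm (f x - g x) powr p)"
      "integrable M (\<lambda>x. norm ((1/2) *\<^sub>R (f x + g x)) powr p)"
      using f g p by (auto intro!: in_Lp_integrable in_Lp_diff in_Lp_add in_Lp_scaleR simp del: norm_scaleR)
    have "Lp_pow M p (\<lambda>x. f x - g x) \<le> (LINT x|M. \<epsilon> * (norm (f x) powr p + norm (g x) powr p)
       + C * ((norm (f x) powr p + norm (g x) powr p) / 2 - norm ((1/2) *\<^sub>R (f x + g x)) powr p))"
      unfolding Lp_pow_def using i C(2) by (intro integral_mono) (auto simp del: norm_scaleR)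
    also have "\<dots> = \<epsilon> * (Lp_pow M p f + Lp_pow M p g)
         + C * ((Lp_pow M p f + Lp_pow M p g) / 2 - Lp_pow M p (\<lambda>x. (1/2) *\<^sub>R (f x + g x)))"
      unfolding Lp_pow_def using i by (simp del: norm_scaleR)
    finally show ?thesis .
  qed
  then show ?thesis using that[OF C(1)] by blast
qed

section \<open>Fatou's lemma, completeness and second differences for \<open>Lp_pow\<close>\<close>

lemma Lp_pow_Fatou:
  fixes f :: "nat \<Rightarrow> 'a \<Rightarrow> 'b::euclidean_space"
  assumes p: "0 < p" and f: "\<And>j. in_Lp M p (f j)" and g: "g \<in> borel_measurable M"
    and lim: "AE x in M. (\<lambda>j. f j x) \<longlonglongrightarrow> g x" and le: "\<And>j. Lp_pow M p (f j) \<le> c"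
  shows "in_Lp M p g" "Lp_pow M p g \<le> c"
proof -
  have c: "0 \<le> c" using le[of 0] Lp_pow_nonneg[of M p "f 0"] by linarith
  have nn: "(\<integral>\<^sup>+x. ennreal (norm (f j x) powr p) \<partial>M) = ennreal (Lp_pow M p (f j))" for j
    unfolding Lp_pow_def using in_Lp_integrable[OF f] by (intro nn_integral_eq_integral) auto
  have "(\<integral>\<^sup>+x. ennreal (norm (g x) powr p) \<partial>M) = (\<integral>\<^sup>+x. liminf (\<lambda>j. ennreal (norm (f j x) powr p)) \<partial>M)"
  proof (rule nn_integral_cong_AE, use lim in eventually_elim)
    case (elim x)
    have "(\<lambda>j. ennreal (norm (f j x) powr p)) \<longlonglongrightarrow> ennreal (norm (g x) powr p)"
      using elim p by (intro tendsto_ennrealI tendsto_powr' tendsto_norm) auto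
    then show ?case by (rule lim_imp_Liminf[symmetric, rotated]) simp
  qed
  also have "\<dots> \<le> liminf (\<lambda>j. \<integral>\<^sup>+x. ennreal (norm (f j x) powr p) \<partial>M)"
    using in_Lp_measurable[OF f] by (intro nn_integral_liminf) measurable
  also have "\<dots> \<le> ennreal c"
    unfolding nn using le c by (intro Liminf_le) (auto intro: ennreal_leI)
  finally have *: "(\<integral>\<^sup>+x. ennreal (norm (g x) powr p) \<partial>M) \<le> ennreal c" .
  have "integrable M (\<lambda>x. norm (g x) powr p)"
    using g * by (intro integrableI_bounded) (auto intro: le_less_trans)
  then show gp: "in_Lp M p g" using g by (simp add: in_Lp_def)
  have "ennreal (Lp_pow M p g) \<le> ennreal c"
    using * in_Lp_integrable[OF gp] unfolding Lp_pow_def by (subst nn_integral_eq_integral[symmetric]) auto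
  then show "Lp_pow M p g \<le> c" using c by simp
qed

lemma in_Lp_complete:
  fixes f :: "nat \<Rightarrow> 'a \<Rightarrow> 'b::euclidean_space"
  assumes p: "0 < p" and f: "\<And>j. in_Lp M p (f j)"
    and cauchy: "\<And>\<epsilon>. 0 < \<epsilon> \<Longrightarrow> \<exists>N. \<forall>m\<ge>N. \<forall>n\<ge>N. Lp_pow M p (\<lambda>x. f m x - f n x) < \<epsilon>"
  obtains g where "in_Lp M p g" "(\<lambda>n. Lp_pow M p (\<lambda>x. f n x - g x)) \<longlonglongrightarrow> 0"
proof -
  have fm[measurable]: "\<And>j. f j \<in> borel_measurable M" using f by (rule in_Lp_measurable)
  \<comment> \<open>The factor \<open>(1/2) ^ k\<close> makes the weighted increments summable after
    integration; the factor \<open>(1/2) powr (real k * p)\<close> makes the increments themselves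
    geometrically small almost everywhere.\<close>
  have "\<forall>k. \<exists>N. \<forall>m\<ge>N. \<forall>n\<ge>N. Lp_pow M p (\<lambda>x. f m x - f n x) < (1/2) ^ k * (1/2) powr (real k * p)"
    using cauchy by auto
  then obtain r0 where r0: "\<And>k m n. r0 k \<le> m \<Longrightarrow> r0 k \<le> n \<Longrightarrow>
      Lp_pow M p (\<lambda>x. f m x - f n x) < (1/2) ^ k * (1/2) powr (real k * p)"
    by metis
  \<comment> \<open>Monotone and at least both \<open>r0 k\<close> and \<open>k\<close>, so the
    increment from \<open>r k\<close> to \<open>r (Suc k)\<close> obeys the chosen
    threshold.\<close>
  define r where "r k = k + (\<Sum>i\<le>k. r0 i)" for k
  have r1: "r0 k \<le> r k" for k using member_le_sum[of k "{..k}" r0] by (auto simp: r_def)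
  have r2: "r k \<le> r (Suc k)" for k by (simp add: r_def)
  have r3: "k \<le> r k" for k by (simp add: r_def)
  define d where "d k x = norm (f (r (Suc k)) x - f (r k) x)" for k x
  have d[measurable]: "d k \<in> borel_measurable M" for k unfolding d_def by measurable
  have nd: "(\<integral>\<^sup>+x. ennreal (2 powr (real k * p) * d k x powr p) \<partial>M) \<le> ennreal ((1/2) ^ k)" for k
  proof -
    have i: "integrable M (\<lambda>x. d k x powr p)"
      unfolding d_def using f p by (intro in_Lp_integrable in_Lp_diff) auto
    have "(\<integral>\<^sup>+x. ennreal (2 powr (real k * p) * d k x powr p) \<partial>M) = ennreal (2 powr (real k * p) * (LINT x|M. d k x powr p))"
      using i by (subst nn_integral_eq_integral) auto
    also have "\<dots> \<le> ennreal (2 powr (real k * p) * ((1/2) ^ k * (1/2) powr (real k * p)))"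
      using r0[of k "r (Suc k)" "r k"] r1[of k] r2[of k]
      by (intro ennreal_leI mult_left_mono) (auto simp: d_def Lp_pow_def intro: less_imp_le)
    also have "2 powr (real k * p) * ((1/2) ^ k * (1/2) powr (real k * p)) = (1/2) ^ k"
      by (simp add: powr_divide)
    finally show ?thesis .
  qed
  have "(\<integral>\<^sup>+x. (\<Sum>k. ennreal (2 powr (real k * p) * d k x powr p)) \<partial>M)
      = (\<Sum>k. \<integral>\<^sup>+x. ennreal (2 powr (real k * p) * d k x powr p) \<partial>M)"
    by (rule nn_integral_suminf) measurable
  also have "\<dots> \<le> (\<Sum>k. ennreal ((1/2) ^ k))"
    using nd by (intro suminf_le) auto
  also have "\<dots> < \<infinity>"
    by (subst suminf_ennreal2) auto
  finally have "AE x in M. (\<Sum>k. ennreal (2 powr (real k * p) * d k x powr p)) \<noteq> \<infinity>"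
    by (intro nn_integral_noteq_infinite) auto
  then have conv: "AE x in M. convergent (\<lambda>k. f (r k) x)"
  proof eventually_elim
    case (elim x)
    define C where "C = enn2real (\<Sum>k. ennreal (2 powr (real k * p) * d k x powr p))"
    have C: "ennreal C = (\<Sum>k. ennreal (2 powr (real k * p) * d k x powr p))" "0 \<le> C"
      using elim by (auto simp: C_def top.not_eq_extremum)
    have dk: "d k x \<le> C powr (1/p) * (1/2) ^ k" for k
    proof -
      have "ennreal (2 powr (real k * p) * d k x powr p) \<le> ennreal C"
      proof -
        define F where "F k = ennreal (2 powr (real k * p) * d k x powr p)" for k
        have "sum F {k} \<le> suminf F" by (intro sum_le_suminf summableI) auto
        then have "F k \<le> suminf F" by simp
        then show ?thesis unfolding C(1) F_def[abs_def] .
      qed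
      then have "2 powr (real k * p) * d k x powr p \<le> C"
        by (subst (asm) ennreal_le_iff[OF C(2)])
      then have "(2 powr real k * d k x) powr p \<le> C"
        by (simp add: powr_mult powr_powr d_def)
      then have "((2 powr real k * d k x) powr p) powr (1/p) \<le> C powr (1/p)"
        using p by (intro powr_mono2) auto
      then have "2 powr real k * d k x \<le> C powr (1/p)"
        using p by (simp add: powr_powr d_def)
      then show ?thesis by (simp add: powr_realpow field_simps power_divide)
    qed
    have "summable (\<lambda>k. C powr (1/p) * (1/2) ^ k)"
      by (intro summable_mult summable_geometric) auto
    then have "summable (\<lambda>k. f (r (Suc k)) x - f (r k) x)"
      by (rule summable_comparison_test'[of _ 0]) (use dk in \<open>simp add: d_def\<close>)
    then have "(\<lambda>n. \<Sum>k<n. f (r (Suc k)) x - f (r k) x) \<longlonglongrightarrow> (\<Sum>k. f (r (Suc k)) x - f (r k) x)"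
      by (rule summable_LIMSEQ)
    then have "(\<lambda>n. (f (r n) x - f (r 0) x) + f (r 0) x) \<longlonglongrightarrow> (\<Sum>k. f (r (Suc k)) x - f (r k) x) + f (r 0) x"
      unfolding sum_lessThan_telescope[of "\<lambda>k. f (r k) x"] by (intro tendsto_intros)
    then show ?case by (auto simp: convergent_def)
  qed
  define g where "g x = lim (\<lambda>k. f (r k) x)" for x
  have g[measurable]: "g \<in> borel_measurable M" unfolding g_def by measurable
  have lim: "AE x in M. (\<lambda>k. f (r k) x) \<longlonglongrightarrow> g x"
    using conv by eventually_elim (simp add: g_def convergent_LIMSEQ_iff)
  have ev: "\<exists>N. \<forall>n\<ge>N. in_Lp M p (\<lambda>x. f n x - g x) \<and> Lp_pow M p (\<lambda>x. f n x - g x) \<le> \<epsilon>" if e: "0 < \<epsilon>" for \<epsilon>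
  proof -
    obtain N where N: "\<And>m n. N \<le> m \<Longrightarrow> N \<le> n \<Longrightarrow> Lp_pow M p (\<lambda>x. f m x - f n x) < \<epsilon>"
      using cauchy[OF e] by blast
    have "in_Lp M p (\<lambda>x. f n x - g x) \<and> Lp_pow M p (\<lambda>x. f n x - g x) \<le> \<epsilon>" if n: "N \<le> n" for n
    proof -
      \<comment> \<open>The index \<open>n\<close> is frozen while the subsequence runs: Fatou turns
        the Cauchy bound into a bound for the distance to \<open>g\<close>.\<close>
      let ?h = "\<lambda>j x. f n x - f (r (j + N)) x"
      have 1: "AE x in M. (\<lambda>j. ?h j x) \<longlonglongrightarrow> f n x - g x"
        using lim by eventually_elim (intro tendsto_intros LIMSEQ_ignore_initial_segment)
      have 2: "in_Lp M p (?h j)" for j using f p by (intro in_Lp_diff) auto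
      have "N \<le> r (j + N)" for j using r3[of "j + N"] by simp
      then have 3: "Lp_pow M p (?h j) \<le> \<epsilon>" for j using N[OF n] less_imp_le by blast
      show ?thesis using Lp_pow_Fatou[OF p 2 _ 1 3] by auto
    qed
    then show ?thesis by blast
  qed
  obtain N where "in_Lp M p (\<lambda>x. f N x - g x)" using ev[of 1] by auto
  then have gp: "in_Lp M p g" using in_Lp_diff[OF _ f[of N], of "\<lambda>x. f N x - g x"] p by simp
  have "(\<lambda>n. Lp_pow M p (\<lambda>x. f n x - g x)) \<longlonglongrightarrow> 0"
  proof (rule LIMSEQ_I)
    fix \<epsilon> :: real assume "0 < \<epsilon>"
    then obtain N where "\<And>n. N \<le> n \<Longrightarrow> Lp_pow M p (\<lambda>x. f n x - g x) \<le> \<epsilon> / 2"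
      using ev[of "\<epsilon> / 2"] by auto
    then show "\<exists>N. \<forall>n\<ge>N. norm (Lp_pow M p (\<lambda>x. f n x - g x) - 0) < \<epsilon>"
      using \<open>0 < \<epsilon>\<close> by (intro exI[of _ N]) (fastforce simp: Lp_pow_nonneg)
  qed
  then show ?thesis using that gp by blast
qed

text \<open>The expression is the difference of the two difference quotients with steps
  \<open>1 / Suc n\<close> and \<open>- 1 / Suc n\<close>, so mere differentiability at
  \<open>0\<close> sends it to \<open>0\<close>. At \<open>a = 0\<close> the derivative exists
  because \<open>p > 1\<close>.\<close>

lemma norm_powr_second_difference:
  fixes a b :: "'a::real_inner"
  assumes p: "1 < p"
  shows "(\<lambda>n. real (Suc n) * (norm (a + (1 / real (Suc n)) *\<^sub>R b) powr p
     + norm (a - (1 / real (Suc n)) *\<^sub>R b) powr p - 2 * norm a powr p)) \<longlonglongrightarrow> 0"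
proof -
  define f where "f s = norm (a + s *\<^sub>R b) powr p" for s :: real
  have "\<exists>D. (f has_real_derivative D) (at 0)"
  proof (cases "a = 0")
    case False
    have "((\<lambda>s. norm (a + s *\<^sub>R b)) has_derivative (\<lambda>s. s * (sgn a \<bullet> b))) (at 0)"
    proof -
      have 1: "((\<lambda>s. a + s *\<^sub>R b) has_derivative (\<lambda>s. s *\<^sub>R b)) (at 0)"
        by (auto intro!: derivative_eq_intros)
      have 2: "(norm has_derivative (\<lambda>h. h \<bullet> sgn a)) (at (a + 0 *\<^sub>R b))"
        using has_derivative_norm[of a] False by simp
      show ?thesis
        using has_derivative_compose[OF 1 2] by (simp add: inner_commute)
    qed
    then have 1: "((\<lambda>s. norm (a + s *\<^sub>R b)) has_real_derivative (sgn a \<bullet> b)) (at 0)"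
      by (simp add: has_field_derivative_def mult.commute[of _ "sgn a \<bullet> b"])
    have "((\<lambda>y. y powr p) has_real_derivative p * norm (a + 0 *\<^sub>R b) powr (p - 1)) (at (norm (a + 0 *\<^sub>R b)))"
      using False by (intro has_real_derivative_powr) simp
    from DERIV_chain2[OF this 1] show ?thesis unfolding f_def by blast
  next
    case True
    have "((\<lambda>s. f s / s) \<longlongrightarrow> 0) (at 0)"
    proof (rule Lim_null_comparison)
      show "eventually (\<lambda>s. norm (f s / s) \<le> \<bar>s\<bar> powr (p - 1) * norm b powr p) (at 0)"
        by (auto simp: f_def True powr_mult powr_diff eventually_at_filter)
      have "((\<lambda>s::real. \<bar>s\<bar> powr (p - 1) * norm b powr p) \<longlongrightarrow> \<bar>0\<bar> powr (p - 1) * norm b powr p) (at 0)"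
        using p by (intro tendsto_intros tendsto_powr') auto
      then show "((\<lambda>s::real. \<bar>s\<bar> powr (p - 1) * norm b powr p) \<longlongrightarrow> 0) (at 0)" by simp
    qed
    moreover have "f 0 = 0" by (simp add: f_def True)
    ultimately show ?thesis by (auto simp: has_field_derivative_iff)
  qed
  then obtain D where D: "((\<lambda>s. (f s - f 0) / s) \<longlongrightarrow> D) (at 0)"
    by (auto simp: has_field_derivative_iff)
  have t: "filterlim (\<lambda>n. c / real (Suc n)) (at 0) sequentially" if "c \<noteq> 0" for c
    using that by (auto simp: filterlim_at intro!: tendsto_divide_0[OF tendsto_const] filterlim_at_top_imp_at_infinity
        filterlim_compose[OF filterlim_real_sequentially filterlim_Suc] simp del: of_nat_Suc)
  have "(\<lambda>n. (f (1 / real (Suc n)) - f 0) / (1 / real (Suc n)) - (f ((-1) / real (Suc n)) - f 0) / ((-1) / real (Suc n))) \<longlonglongrightarrow> D - D"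
    by (intro tendsto_diff filterlim_compose[OF D t]) auto
  also have "(\<lambda>n. (f (1 / real (Suc n)) - f 0) / (1 / real (Suc n)) - (f ((-1) / real (Suc n)) - f 0) / ((-1) / real (Suc n)))
     = (\<lambda>n. real (Suc n) * (f (1 / real (Suc n)) + f ((-1) / real (Suc n)) - 2 * f 0))"
    by (rule ext) (simp add: field_simps)
  finally show ?thesis by (simp add: f_def)
qed

text \<open>Convexity makes the second difference quotients monotone in the step, so the one of step \<open>1\<close>
  dominates all others.\<close>

lemma Lp_pow_second_difference:
  fixes f g :: "'a \<Rightarrow> 'b::euclidean_space"
  assumes p: "1 < p" and f: "in_Lp M p f" and g: "in_Lp M p g"
  shows "(\<lambda>n. real (Suc n) * (Lp_pow M p (\<lambda>x. f x + (1 / real (Suc n)) *\<^sub>R g x)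
     + Lp_pow M p (\<lambda>x. f x - (1 / real (Suc n)) *\<^sub>R g x) - 2 * Lp_pow M p f)) \<longlonglongrightarrow> 0"
proof -
  have [measurable]: "f \<in> borel_measurable M" "g \<in> borel_measurable M"
    using f g by (auto simp: in_Lp_def)
  define h where "h s x = norm (f x + s *\<^sub>R g x) powr p + norm (f x - s *\<^sub>R g x) powr p - 2 * norm (f x) powr p" for s x
  have hi: "integrable M (h s)"
    and hI: "integral\<^sup>L M (h s) = Lp_pow M p (\<lambda>x. f x + s *\<^sub>R g x) + Lp_pow M p (\<lambda>x. f x - s *\<^sub>R g x) - 2 * Lp_pow M p f" for s
  proof -
    have "integrable M (\<lambda>x. norm (f x + s *\<^sub>R g x) powr p)" "integrable M (\<lambda>x. norm (f x - s *\<^sub>R g x) powr p)"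
      "integrable M (\<lambda>x. norm (f x) powr p)"
      using p f g by (auto intro!: in_Lp_integrable in_Lp_add in_Lp_diff in_Lp_scaleR)
    then show "integrable M (h s)"
      "integral\<^sup>L M (h s) = Lp_pow M p (\<lambda>x. f x + s *\<^sub>R g x) + Lp_pow M p (\<lambda>x. f x - s *\<^sub>R g x) - 2 * Lp_pow M p f"
      by (simp_all add: h_def[abs_def] Lp_pow_def)
  qed
  have "(\<lambda>n. LINT x|M. real (Suc n) * h (1 / real (Suc n)) x) \<longlonglongrightarrow> (LINT x|M. 0)"
  proof (rule integral_dominated_convergence[where w = "h 1"])
    show "AE x in M. (\<lambda>n. real (Suc n) * h (1 / real (Suc n)) x) \<longlonglongrightarrow> 0"
      unfolding h_def using norm_powr_second_difference[OF p] by auto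
    fix n
    define s where "s = 1 / real (Suc n)"
    have s: "0 < s" "s \<le> 1" "real (Suc n) * s = 1" by (auto simp: s_def)
    have "norm (real (Suc n) * h s x) \<le> h 1 x" for x
    proof -
      have "h s x \<ge> 0"
        using norm_powr_midpoint_le[of p "f x + s *\<^sub>R g x" "f x - s *\<^sub>R g x"] p
        by (simp add: h_def)
      moreover have "h s x \<le> s * h 1 x"
        using norm_powr_convexD[of p s "f x" "f x + g x"] norm_powr_convexD[of p s "f x" "f x - g x"] p s
        by (simp add: h_def algebra_simps)
      then have "real (Suc n) * h s x \<le> real (Suc n) * (s * h 1 x)"
        by (intro mult_left_mono) auto
      then have "real (Suc n) * h s x \<le> h 1 x" by (simp only: mult.assoc[symmetric] s mult_1)
      ultimately show ?thesis by (simp add: abs_of_nonneg)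
    qed
    then show "AE x in M. norm (real (Suc n) * h (1 / real (Suc n)) x) \<le> h 1 x" by (simp add: s_def)
  qed (use hi in \<open>auto simp: h_def\<close>)
  then show ?thesis using hI by simp
qed

section \<open>Smooth functions with compact support\<close>

lemma partial_deriv_eqI: "(f has_derivative f') (at x) \<Longrightarrow> partial_deriv e f x = f' e"
  by (metis frechet_derivative_at)

lemma C_k_SucD: "C_k (Suc k) f \<Longrightarrow> C_k k f"
proof (induction k arbitrary: f)
  case 0
  then have "f differentiable_on UNIV" by (simp add: differentiable_on_def)
  then show ?case by (simp add: differentiable_imp_continuous_on)
next
  case (Suc k)
  then show ?case by simp
qed

lemma C_k_const: "C_k k (\<lambda>x. c)"
proof (induction k arbitrary: c)
  case (Suc k)
  then show ?case by simp
qed simp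

lemma C_k_add:
  assumes "C_k k f" "C_k k g"
  shows "C_k k (\<lambda>x. f x + g x)"
  using assms
proof (induction k arbitrary: f g)
  case 0
  then show ?case by (auto intro: continuous_intros)
next
  case (Suc k)
  have "partial_deriv e (\<lambda>x. f x + g x) x = partial_deriv e f x + partial_deriv e g x" for e x
  proof -
    have "((\<lambda>x. f x + g x) has_derivative (\<lambda>h. frechet_derivative f (at x) h + frechet_derivative g (at x) h)) (at x)"
      using Suc.prems by (auto intro!: derivative_intros simp: frechet_derivative_works)
    then show ?thesis by (rule partial_deriv_eqI)
  qed
  then show ?case using Suc by simp
qed

lemma C_k_mult:
  assumes "C_k k f" "C_k k g"
  shows "C_k k (\<lambda>x. f x * g x)"
  using assms
proof (induction k arbitrary: f g)
  case 0
  then show ?case by (auto intro: continuous_intros)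
next
  case (Suc k)
  have "partial_deriv e (\<lambda>x. f x * g x) x = f x * partial_deriv e g x + partial_deriv e f x * g x" for e x
  proof -
    have "((\<lambda>x. f x * g x) has_derivative (\<lambda>h. f x * frechet_derivative g (at x) h + frechet_derivative f (at x) h * g x)) (at x)"
      using Suc.prems by (intro has_derivative_mult) (auto simp: frechet_derivative_works)
    then show ?thesis by (rule partial_deriv_eqI)
  qed
  then have "partial_deriv e (\<lambda>x. f x * g x) = (\<lambda>x. f x * partial_deriv e g x + partial_deriv e f x * g x)" for e
    by auto
  moreover have "C_k k (\<lambda>x. f x * partial_deriv e g x + partial_deriv e f x * g x)" if "e \<in> Basis" for e
    using Suc.prems that C_k_SucD[OF Suc.prems(1)] C_k_SucD[OF Suc.prems(2)]
    by (intro C_k_add Suc.IH) auto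
  ultimately show ?case using Suc.prems by (simp add: differentiable_mult)
qed

lemma C_k_prod: "finite A \<Longrightarrow> (\<And>i. i \<in> A \<Longrightarrow> C_k k (f i)) \<Longrightarrow> C_k k (\<lambda>x. \<Prod>i\<in>A. f i x)"
  by (induction rule: finite_induct) (auto intro: C_k_const C_k_mult)

text \<open>Differentiating \<open>exp (- c / t)\<close> produces negative powers of
  \<open>t\<close>; with the exponent \<open>m\<close> as a parameter the family is closed under
  differentiation up to linear combinations. The parameter \<open>c\<close> stays free because it is
  sent to \<open>0\<close> later.\<close>

definition exp_flat :: "real \<Rightarrow> nat \<Rightarrow> real \<Rightarrow> real" where
  "exp_flat c m t = (if 0 < t then exp (- c / t) / t ^ m else 0)"

text \<open>Comes from \<open>(1 + y / n) ^ n \<le> exp y\<close> with \<open>n = m + 1\<close> and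
  \<open>y = c / t\<close>. One power more than is needed to cancel \<open>t ^ m\<close> leaves the
  factor \<open>t\<close>, and this yields the derivative at \<open>0\<close>.\<close>

lemma exp_flat_le:
  assumes "0 < c" "0 < t"
  shows "exp_flat c m t \<le> (real (m + 1) / c) ^ (m + 1) * t"
proof -
  have "(c / (real (m + 1) * t)) ^ (m + 1) \<le> (1 + (c / t) / real (m + 1)) ^ (m + 1)"
    using assms by (intro power_mono) (auto simp: field_simps)
  also have "\<dots> \<le> exp (c / t)"
    using assms by (intro exp_ge_one_plus_x_over_n_power_n) (auto intro: order_trans[of _ 0])
  finally have "exp (- (c / t)) \<le> inverse ((c / (real (m + 1) * t)) ^ (m + 1))"
    unfolding exp_minus using assms by (intro le_imp_inverse_le) auto
  also have "\<dots> = (real (m + 1) / c) ^ (m + 1) * t ^ (m + 1)"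
    by (simp only: power_mult_distrib[symmetric] power_inverse[symmetric]) (simp add: field_simps)
  finally show ?thesis using assms by (simp add: exp_flat_def field_simps)
qed

lemma exp_flat_nonneg: "0 \<le> exp_flat c m t"
  by (simp add: exp_flat_def)

lemma DERIV_exp_flat:
  assumes c: "0 < c"
  shows "(exp_flat c m has_real_derivative (c * exp_flat c (m + 2) t - real m * exp_flat c (m + 1) t)) (at t)"
proof -
  consider "0 < t" | "t < 0" | "t = 0" by linarith
  then show ?thesis
  proof cases
    case 1
    have "((\<lambda>t. exp (- c / t) / t ^ m) has_real_derivative
        (exp (- c / t) * (c / t\<^sup>2) * t ^ m - exp (- c / t) * (real m * t ^ (m - 1))) / (t ^ m * t ^ m)) (at t)"
      using 1 by (auto intro!: derivative_eq_intros simp: power2_eq_square)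
    also have "(exp (- c / t) * (c / t\<^sup>2) * t ^ m - exp (- c / t) * (real m * t ^ (m - 1))) / (t ^ m * t ^ m)
        = c * exp_flat c (m + 2) t - real m * exp_flat c (m + 1) t"
      using 1 by (cases m) (simp_all add: exp_flat_def field_simps power2_eq_square)
    finally show ?thesis
      by (rule has_field_derivative_transform_within_open[of _ _ _ "{0<..}"]) (use 1 in \<open>auto simp: exp_flat_def\<close>)
  next
    case 2
    have "((\<lambda>t. 0) has_real_derivative 0) (at t)" by simp
    then have "(exp_flat c m has_real_derivative 0) (at t)"
      by (rule has_field_derivative_transform_within_open[of _ _ _ "{..<0}"]) (use 2 in \<open>auto simp: exp_flat_def\<close>)
    then show ?thesis using 2 by (simp add: exp_flat_def)
  next
    case 3
    have "((\<lambda>s. exp_flat c m s / s) \<longlongrightarrow> 0) (at 0)"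
    proof (rule Lim_null_comparison)
      have "norm (exp_flat c m s / s) \<le> (real (m + 2) / c) ^ (m + 2) * \<bar>s\<bar>" if "s \<noteq> 0" for s
      proof (cases "0 < s")
        case True
        have "exp_flat c m s / s = exp_flat c (m + 1) s" by (simp add: exp_flat_def)
        then show ?thesis using exp_flat_le[OF c True, of "m + 1"] exp_flat_nonneg[of c "m + 1" s] True by simp
      next
        case False
        have "0 \<le> (real (m + 2) / c) ^ (m + 2) * \<bar>s\<bar>"
          using c by (intro mult_nonneg_nonneg zero_le_power divide_nonneg_pos) auto
        then show ?thesis using False by (simp only: exp_flat_def) simp
      qed
      then show "eventually (\<lambda>s. norm (exp_flat c m s / s) \<le> (real (m + 2) / c) ^ (m + 2) * \<bar>s\<bar>) (at 0)"
        by (auto simp: eventually_at_filter)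
      show "((\<lambda>s. (real (m + 2) / c) ^ (m + 2) * \<bar>s\<bar>) \<longlongrightarrow> 0) (at 0)"
        by (intro tendsto_mult_right_zero tendsto_rabs_zero tendsto_ident_at)
    qed
    then show ?thesis using 3 by (simp add: has_field_derivative_iff exp_flat_def)
  qed
qed

text \<open>The induction on \<open>k\<close> keeps \<open>m\<close> arbitrary, since each
  derivative involves the members \<open>m + 1\<close> and \<open>m + 2\<close>.\<close>

lemma C_k_exp_flat:
  assumes c: "0 < c"
  shows "C_k k (\<lambda>x. exp_flat c m (x \<bullet> a + b))"
proof (induction k arbitrary: m)
  case 0
  have "isCont (exp_flat c m) t" for t
    using DERIV_isCont[OF DERIV_exp_flat[OF c]] .
  then have "continuous_on UNIV (exp_flat c m)" by (simp add: continuous_at_imp_continuous_on)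
  then show ?case by (auto intro!: continuous_intros continuous_on_compose2[of UNIV "exp_flat c m"])
next
  case (Suc k)
  have d: "((\<lambda>x. exp_flat c m (x \<bullet> a + b)) has_derivative
     (\<lambda>h. (c * exp_flat c (m + 2) (x \<bullet> a + b) - real m * exp_flat c (m + 1) (x \<bullet> a + b)) * (h \<bullet> a))) (at x)" for x
    by (rule has_derivative_eq_rhs, rule has_derivative_compose[OF _ DERIV_exp_flat[OF c, unfolded has_field_derivative_def]])
       (auto intro!: derivative_eq_intros)
  have "C_k k (\<lambda>x. (c * exp_flat c (m + 2) (x \<bullet> a + b) + (- real m) * exp_flat c (m + 1) (x \<bullet> a + b)) * (e \<bullet> a))" for e
    by (intro C_k_add C_k_mult C_k_const Suc.IH)
  moreover have "partial_deriv e (\<lambda>x. exp_flat c m (x \<bullet> a + b)) =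
     (\<lambda>x. (c * exp_flat c (m + 2) (x \<bullet> a + b) + (- real m) * exp_flat c (m + 1) (x \<bullet> a + b)) * (e \<bullet> a))" for e
    using partial_deriv_eqI[OF d] by auto
  ultimately show ?case using d by (auto simp: differentiable_def)
qed

text \<open>For \<open>c > 0\<close> a smooth function with values between \<open>0\<close> and
  \<open>1\<close>, positive exactly on the open box and tending to its indicator as
  \<open>c\<close> tends to \<open>0\<close>. The arguments have the shape
  \<open>x \<bullet> v + w\<close> to fit \<open>C_k_exp_flat\<close>.\<close>

definition box_bump :: "real \<Rightarrow> 'a::euclidean_space \<Rightarrow> 'a \<Rightarrow> 'a \<Rightarrow> real" where
  "box_bump c a b x = (\<Prod>e\<in>Basis. exp_flat c 0 (x \<bullet> e + - (a \<bullet> e)) * exp_flat c 0 (x \<bullet> (- e) + b \<bullet> e))"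

lemma box_bump_pos: "x \<in> box a b \<Longrightarrow> 0 < box_bump c a b x"
  unfolding box_bump_def by (intro prod_pos) (auto simp: box_def exp_flat_def)

lemma box_bump_zero: "x \<notin> box a b \<Longrightarrow> box_bump c a b x = 0"
  unfolding box_bump_def by (intro prod_zero) (auto simp: box_def exp_flat_def)

lemma box_bump_nonneg: "0 \<le> box_bump c a b x"
  using box_bump_pos[of x a b c] box_bump_zero[of x a b c] by (cases "x \<in> box a b") auto

lemma box_bump_le_1: "0 < c \<Longrightarrow> box_bump c a b x \<le> 1"
  unfolding box_bump_def by (intro prod_le_1) (auto simp: exp_flat_def intro!: mult_le_one)

lemma box_bump_C0_infinity:
  assumes "0 < c" "cbox a b \<subseteq> \<Omega>"
  shows "box_bump c a b \<in> C0_infinity \<Omega>"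
proof -
  have "C_k k (box_bump c a b)" for k
    unfolding box_bump_def using assms by (intro C_k_prod C_k_mult C_k_exp_flat) auto
  moreover have "{x. box_bump c a b x \<noteq> 0} \<subseteq> box a b"
    using box_bump_zero by blast
  then have "closure {x. box_bump c a b x \<noteq> 0} \<subseteq> cbox a b"
    by (meson box_subset_cbox closed_cbox closure_minimal order_trans)
  moreover have "compact (closure {x. box_bump c a b x \<noteq> 0})"
    using calculation(2) bounded_subset[OF bounded_cbox] by (simp add: compact_eq_bounded_closed)
  ultimately show ?thesis using assms unfolding C0_infinity_def by auto
qed

lemma box_bump_tendsto: "(\<lambda>n. box_bump (1 / real (Suc n)) a b x) \<longlonglongrightarrow> indicator (box a b) x"
proof (cases "x \<in> box a b")
  case True
  have l: "(\<lambda>n. exp_flat (1 / real (Suc n)) 0 t) \<longlonglongrightarrow> 1" if "0 < t" for t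
  proof -
    have "(\<lambda>n. exp (- (1 / real (Suc n)) / t)) \<longlonglongrightarrow> exp (- 0 / t)"
      using that by (intro tendsto_intros LIMSEQ_Suc[OF lim_1_over_n]) auto
    then show ?thesis using that by (simp add: exp_flat_def)
  qed
  have "(\<lambda>n. box_bump (1 / real (Suc n)) a b x) \<longlonglongrightarrow> (\<Prod>e\<in>(Basis::'a set). 1 * 1)"
    unfolding box_bump_def using True
    by (intro tendsto_prod tendsto_mult l) (auto simp: box_def)
  then show ?thesis using True by simp
qed (simp add: box_bump_zero)

section \<open>Test functions, their gradients and supports\<close>

lemma C0_infinity_C_k: "\<phi> \<in> C0_infinity \<Omega> \<Longrightarrow> C_k k \<phi>"
  by (simp add: C0_infinity_def)

lemma C0_infinity_differentiable: "\<phi> \<in> C0_infinity \<Omega> \<Longrightarrow> \<phi> differentiable (at x)"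
  using C0_infinity_C_k[of \<phi> \<Omega> "Suc 0"] by simp

lemma C0_infinity_continuous: "\<phi> \<in> C0_infinity \<Omega> \<Longrightarrow> continuous_on UNIV \<phi>"
  using C0_infinity_C_k[of \<phi> \<Omega> 0] by simp

lemma C0_infinity_partial_continuous:
  "\<phi> \<in> C0_infinity \<Omega> \<Longrightarrow> e \<in> Basis \<Longrightarrow> continuous_on UNIV (partial_deriv e \<phi>)"
  using C0_infinity_C_k[of \<phi> \<Omega> "Suc 0"] by simp

lemma gradient_inner:
  assumes "f differentiable (at x)"
  shows "gradient f x \<bullet> h = frechet_derivative f (at x) h"
proof -
  interpret bounded_linear "frechet_derivative f (at x)"
    using assms by (simp add: frechet_derivative_works has_derivative_bounded_linear)
  have "frechet_derivative f (at x) h = frechet_derivative f (at x) (\<Sum>e\<in>Basis. (h \<bullet> e) *\<^sub>R e)"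
    by (simp add: euclidean_representation)
  also have "\<dots> = (\<Sum>e\<in>Basis. (h \<bullet> e) * frechet_derivative f (at x) e)"
    by (simp add: sum scale)
  finally show ?thesis
    by (simp add: gradient_def inner_sum_left inner_commute[of h] mult.commute)
qed

lemma gradient_eqI:
  assumes "(f has_derivative (\<lambda>h. g \<bullet> h)) (at x)"
  shows "gradient f x = g"
  unfolding gradient_def using partial_deriv_eqI[OF assms]
  by (simp add: euclidean_representation)

lemma has_derivative_gradient:
  assumes "f differentiable (at x)"
  shows "(f has_derivative (\<lambda>h. gradient f x \<bullet> h)) (at x)"
  using assms by (simp add: gradient_inner frechet_derivative_works)

lemma C0_infinity_gradient_continuous:
  assumes "\<phi> \<in> C0_infinity \<Omega>"
  shows "continuous_on UNIV (gradient \<phi>)"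
  unfolding gradient_def[abs_def]
  by (intro continuous_intros C0_infinity_partial_continuous[OF assms])

lemma C0_infinity_support:
  assumes "\<phi> \<in> C0_infinity \<Omega>"
  obtains K where "compact K" "K \<subseteq> \<Omega>" "\<And>x. x \<notin> K \<Longrightarrow> \<phi> x = 0" "\<And>x. x \<notin> K \<Longrightarrow> gradient \<phi> x = 0"
    "\<And>x e. x \<notin> K \<Longrightarrow> partial_deriv e \<phi> x = 0"
proof -
  let ?K = "closure {x. \<phi> x \<noteq> 0}"
  have z: "\<phi> x = 0" if "x \<notin> ?K" for x
    using that closure_subset[of "{x. \<phi> x \<noteq> 0}"] by auto
  have d: "(\<phi> has_derivative (\<lambda>h. 0)) (at x)" if "x \<notin> ?K" for x
  proof -
    have "((\<lambda>x. 0) has_derivative (\<lambda>h. 0)) (at x)" by simp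
    then show ?thesis
    proof (rule has_derivative_transform_within_open[where s = "- ?K"])
      show "open (- ?K)" by (simp only: open_Compl closed_closure)
      show "x \<in> - ?K" using that by simp
      show "0 = \<phi> y" if "y \<in> - ?K" for y using z[of y] that by simp
    qed
  qed
  show ?thesis
  proof (rule that[of ?K])
    show "gradient \<phi> x = 0" if "x \<notin> ?K" for x using gradient_eqI[of \<phi> 0 x] d[OF that] by simp
    show "partial_deriv e \<phi> x = 0" if "x \<notin> ?K" for x e using partial_deriv_eqI[OF d[OF that]] .
    show "\<phi> x = 0" if "x \<notin> ?K" for x using that by (rule z)
    show "compact ?K" "?K \<subseteq> \<Omega>" using assms unfolding C0_infinity_def by blast+
  qed
qed

lemma C0_infinity_outside:
  assumes "\<phi> \<in> C0_infinity \<Omega>" "x \<notin> \<Omega>"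
  shows "\<phi> x = 0" "gradient \<phi> x = 0" "partial_deriv e \<phi> x = 0"
  using C0_infinity_support[OF assms(1)] assms(2) by (metis subsetD)+

lemma C0_infinity_add:
  assumes "\<phi> \<in> C0_infinity \<Omega>" "\<psi> \<in> C0_infinity \<Omega>"
  shows "(\<lambda>x. \<phi> x + \<psi> x) \<in> C0_infinity \<Omega>"
proof -
  have "closure {x. \<phi> x + \<psi> x \<noteq> 0} \<subseteq> closure ({x. \<phi> x \<noteq> 0} \<union> {x. \<psi> x \<noteq> 0})"
    by (intro closure_mono) auto
  then have "closure {x. \<phi> x + \<psi> x \<noteq> 0} \<subseteq> closure {x. \<phi> x \<noteq> 0} \<union> closure {x. \<psi> x \<noteq> 0}"
    by (simp add: closure_Un)
  moreover from this have "compact (closure {x. \<phi> x + \<psi> x \<noteq> 0})"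
    using assms compact_Un[of "closure {x. \<phi> x \<noteq> 0}" "closure {x. \<psi> x \<noteq> 0}"] unfolding C0_infinity_def
    by (metis (mono_tags, lifting) bounded_subset closed_closure compact_eq_bounded_closed mem_Collect_eq)
  ultimately show ?thesis
    using assms unfolding C0_infinity_def by (auto intro: C_k_add)
qed

lemma C0_infinity_cmult:
  assumes "\<phi> \<in> C0_infinity \<Omega>"
  shows "(\<lambda>x. c * \<phi> x) \<in> C0_infinity \<Omega>"
proof -
  have "closure {x. c * \<phi> x \<noteq> 0} \<subseteq> closure {x. \<phi> x \<noteq> 0}"
    by (intro closure_mono) auto
  moreover from this have "compact (closure {x. c * \<phi> x \<noteq> 0})"
    using assms unfolding C0_infinity_def
    by (metis (mono_tags, lifting) bounded_subset closed_closure compact_eq_bounded_closed mem_Collect_eq)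
  ultimately show ?thesis
    using assms unfolding C0_infinity_def by (auto intro: C_k_mult C_k_const)
qed

lemma gradient_add:
  assumes "\<phi> \<in> C0_infinity \<Omega>" "\<psi> \<in> C0_infinity \<Omega>"
  shows "gradient (\<lambda>x. \<phi> x + \<psi> x) x = gradient \<phi> x + gradient \<psi> x"
proof (rule gradient_eqI)
  have "((\<lambda>x. \<phi> x + \<psi> x) has_derivative (\<lambda>h. gradient \<phi> x \<bullet> h + gradient \<psi> x \<bullet> h)) (at x)"
    by (intro has_derivative_add has_derivative_gradient C0_infinity_differentiable[OF assms(1)]
        C0_infinity_differentiable[OF assms(2)])
  then show "((\<lambda>x. \<phi> x + \<psi> x) has_derivative (\<lambda>h. (gradient \<phi> x + gradient \<psi> x) \<bullet> h)) (at x)"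
    by (simp only: inner_add_left)
qed

lemma gradient_cmult:
  assumes "\<phi> \<in> C0_infinity \<Omega>"
  shows "gradient (\<lambda>x. c * \<phi> x) x = c *\<^sub>R gradient \<phi> x"
proof (rule gradient_eqI)
  have "((\<lambda>x. c * \<phi> x) has_derivative (\<lambda>h. c * (gradient \<phi> x \<bullet> h))) (at x)"
    by (intro has_derivative_mult_right has_derivative_gradient C0_infinity_differentiable[OF assms])
  then show "((\<lambda>x. c * \<phi> x) has_derivative (\<lambda>h. (c *\<^sub>R gradient \<phi> x) \<bullet> h)) (at x)"
    by (simp only: inner_scaleR_left)
qed

section \<open>Integrability of compactly supported functions\<close>

lemma integrable_compact_support:
  fixes f :: "'a::euclidean_space \<Rightarrow> 'b::euclidean_space"
  assumes "continuous_on UNIV f" "compact K" "\<And>x. x \<notin> K \<Longrightarrow> f x = 0"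
  shows "integrable lborel f"
proof -
  have "integrable lborel (\<lambda>x. indicator K x *\<^sub>R f x)"
    using assms by (intro borel_integrable_compact) (auto intro: continuous_on_subset)
  also have "(\<lambda>x. indicator K x *\<^sub>R f x) = f"
    using assms(3) by (auto simp: fun_eq_iff indicator_def)
  finally show ?thesis .
qed

lemma bounded_compact_support:
  fixes f :: "'a::euclidean_space \<Rightarrow> 'b::euclidean_space"
  assumes "continuous_on UNIV f" "compact K" "\<And>x. x \<notin> K \<Longrightarrow> f x = 0"
  obtains B where "0 \<le> B" "\<And>x. norm (f x) \<le> B"
proof -
  have "bounded (f ` K)"
    using assms by (intro compact_imp_bounded compact_continuous_image) (auto intro: continuous_on_subset)
  then obtain B where B: "\<And>x. x \<in> K \<Longrightarrow> norm (f x) \<le> B" by (auto simp: bounded_iff)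
  have "norm (f x) \<le> max B 0" for x using B[of x] assms(3)[of x] by (cases "x \<in> K") auto
  then show ?thesis using that[of "max B 0"] by auto
qed

lemma integral_lebesgue_on_eq_lborel:
  fixes f :: "'a::euclidean_space \<Rightarrow> 'b::euclidean_space"
  assumes "\<Omega> \<in> sets lebesgue" "f \<in> borel_measurable borel" "\<And>x. x \<notin> \<Omega> \<Longrightarrow> f x = 0"
  shows "(LINT x|lebesgue_on \<Omega>. f x) = (LINT x|lborel. f x)"
proof -
  have "(LINT x|lebesgue_on \<Omega>. f x) = (LINT x|lebesgue. (if x \<in> \<Omega> then f x else 0))"
    using Lebesgue_Measure.integral_restrict_UNIV[OF assms(1)] by metis
  also have "(\<lambda>x. if x \<in> \<Omega> then f x else 0) = f" using assms(3) by auto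
  finally show ?thesis using assms(2) by (simp add: integral_completion)
qed

lemma integrable_lebesgue_onI:
  fixes f :: "'a::euclidean_space \<Rightarrow> 'b::euclidean_space"
  assumes "\<Omega> \<in> sets lebesgue" "integrable lborel f"
  shows "integrable (lebesgue_on \<Omega>) f"
proof -
  have "integrable lebesgue f" using assms by (simp add: integrable_completion)
  then have "integrable lebesgue (\<lambda>x. indicator \<Omega> x *\<^sub>R f x)" using assms(1) by (intro integrable_mult_indicator)
  then show ?thesis using assms(1) by (simp add: integrable_restrict_space)
qed

lemma borel_measurable_lebesgue_onI:
  assumes "f \<in> borel_measurable borel"
  shows "f \<in> borel_measurable (lebesgue_on \<Omega>)"
  using assms by (intro measurable_restrict_space1 measurable_completion) simp

lemma in_Lp_compact_support:
  fixes f :: "'a::euclidean_space \<Rightarrow> 'b::euclidean_space"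
  assumes "continuous_on UNIV f" "compact K" "\<And>x. x \<notin> K \<Longrightarrow> f x = 0" "0 < p" "\<Omega> \<in> sets lebesgue"
  shows "in_Lp (lebesgue_on \<Omega>) p f"
  unfolding in_Lp_def
proof
  show "f \<in> borel_measurable (lebesgue_on \<Omega>)"
    using assms by (intro borel_measurable_lebesgue_onI) (simp add: borel_measurable_continuous_onI)
  have "continuous_on UNIV (\<lambda>x. norm (f x) powr p)"
    using assms by (intro continuous_on_powr' continuous_intros) auto
  then show "integrable (lebesgue_on \<Omega>) (\<lambda>x. norm (f x) powr p)"
    using assms by (intro integrable_lebesgue_onI integrable_compact_support[of _ K]) auto
qed

lemma C0_infinity_in_Lp:
  assumes "\<phi> \<in> C0_infinity \<Omega>" "0 < p" "T \<in> sets lebesgue"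
  shows "in_Lp (lebesgue_on T) p \<phi>" "in_Lp (lebesgue_on T) p (gradient \<phi>)"
  using C0_infinity_support[OF assms(1)] in_Lp_compact_support[OF _ _ _ assms(2,3)]
    C0_infinity_continuous[OF assms(1)] C0_infinity_gradient_continuous[OF assms(1)] by metis+

section \<open>The fundamental lemma and weak gradients\<close>

text \<open>Open boxes are stable under intersection and generate the Borel sets, so a Dynkin
  argument carries the vanishing of the integrals to all Borel sets.\<close>

lemma AE_zero_of_box_integrals:
  fixes f :: "'a::euclidean_space \<Rightarrow> real"
  assumes f: "integrable lborel f" and box: "\<And>a b. (LINT x:box a b|lborel. f x) = 0"
  shows "AE x in lborel. f x = 0"
proof (rule sigma_finite_measure.density_zero[OF sigma_finite_lborel f])
  have fi: "set_integrable lborel A f" if "A \<in> sets borel" for A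
    unfolding set_integrable_def using f that by (intro integrable_mult_indicator) auto
  \<comment> \<open>The whole space is not a box; its integral is a limit over growing boxes and is
    what the step for complements needs.\<close>
  have univ: "(LINT x|lborel. f x) = 0"
  proof -
    have "(\<lambda>n. LINT x|lborel. indicator (box (- real n *\<^sub>R One) (real n *\<^sub>R One)) x *\<^sub>R f x) \<longlonglongrightarrow> (LINT x|lborel. f x)"
    proof (rule integral_dominated_convergence[where w = "\<lambda>x. norm (f x)"])
      show "AE x in lborel. (\<lambda>n. indicator (box (- real n *\<^sub>R One) (real n *\<^sub>R One)) x *\<^sub>R f x) \<longlonglongrightarrow> f x"
      proof (rule AE_I2, rule tendsto_eventually)
        fix x :: 'a
        obtain N where N: "norm x < real N" using reals_Archimedean2 by blast
        have "x \<in> box (- real n *\<^sub>R One) (real n *\<^sub>R One)" if "N \<le> n" for n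
          using N that Basis_le_norm[of _ x] by (force simp: box_def abs_le_iff)
        then show "eventually (\<lambda>n. indicator (box (- real n *\<^sub>R One) (real n *\<^sub>R One)) x *\<^sub>R f x = f x) sequentially"
          unfolding eventually_sequentially by (intro exI[of _ N]) auto
      qed
    qed (use f in \<open>auto simp: indicator_def\<close>)
    then show ?thesis using box unfolding set_lebesgue_integral_def by (simp add: LIMSEQ_const_iff)
  qed
  fix A :: "'a set" assume "A \<in> sets lborel"
  then have A: "A \<in> sigma_sets UNIV (range (\<lambda>(a, b). box a b))"
    by (simp add: borel_eq_box)
  have "Int_stable (range (\<lambda>(a, b::'a). box a b))"
    by (auto simp: Int_stable_def box_Int_box)
  moreover have "range (\<lambda>(a, b::'a). box a b) \<subseteq> Pow UNIV" by simp
  moreover note A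
  ultimately show "(LINT x:A|lborel. f x) = 0"
  proof (induction rule: sigma_sets_induct_disjoint)
    case (compl A)
    then have A: "A \<in> sets borel" by (simp add: borel_eq_box)
    have "(LINT x:A \<union> (UNIV - A)|lborel. f x) = (LINT x:A|lborel. f x) + (LINT x:UNIV - A|lborel. f x)"
      using A by (intro set_integral_Un fi) auto
    then show ?case using compl univ by (simp add: set_lebesgue_integral_def)
  next
    case (union A)
    then have A: "A i \<in> sets borel" for i by (auto simp: borel_eq_box)
    have "(LINT x:(\<Union>i. A i)|lborel. f x) = (\<Sum>i. LINT x:A i|lborel. f x)"
      using union A by (intro lebesgue_integral_countable_add fi) (auto simp: disjoint_family_on_def)
    then show ?case using union by simp
  qed (use box in \<open>auto simp: set_lebesgue_integral_def\<close>)
qed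

text \<open>The test functions \<open>box_bump\<close> tend to the indicator of the box. The closed
  box lies in the domain, so \<open>g\<close> is integrable on it and supplies the dominating
  function.\<close>

lemma fundamental_lemma_cbox:
  fixes g :: "'a::euclidean_space \<Rightarrow> real"
  assumes open_\<Omega>: "open \<Omega>" and g: "locally_integrable \<Omega> g"
    and zero: "\<And>\<phi>. \<phi> \<in> C0_infinity \<Omega> \<Longrightarrow> (LINT x|lebesgue_on \<Omega>. g x * \<phi> x) = 0"
    and ab: "cbox a b \<subseteq> \<Omega>"
  shows "(LINT x:box a b|lebesgue. g x) = 0"
proof -
  have gi: "integrable lebesgue (\<lambda>x. indicator (cbox a b) x *\<^sub>R g x)"
    using g ab by (simp add: locally_integrable_def set_integrable_def compact_cbox)
  have gm: "(\<lambda>x. indicator (cbox a b) x *\<^sub>R g x) \<in> borel_measurable lebesgue" by (rule borel_measurable_integrable[OF gi])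
  define \<phi> where "\<phi> n = box_bump (1 / real (Suc n)) a b" for n
  have \<phi>: "\<phi> n \<in> C0_infinity \<Omega>" for n
    unfolding \<phi>_def using ab by (intro box_bump_C0_infinity) auto
  have \<phi>m: "\<phi> n \<in> borel_measurable lebesgue" for n
    using C0_infinity_continuous[OF \<phi>] by (intro measurable_completion) (simp add: borel_measurable_continuous_onI)
  have eq: "(LINT x|lebesgue. (indicator (cbox a b) x *\<^sub>R g x) * \<phi> n x) = 0" for n
  proof -
    have "(LINT x|lebesgue_on \<Omega>. g x * \<phi> n x) = (LINT x|lebesgue. (if x \<in> \<Omega> then g x * \<phi> n x else 0))"
      using open_\<Omega> by (subst Lebesgue_Measure.integral_restrict_UNIV) auto
    also have "(\<lambda>x. if x \<in> \<Omega> then g x * \<phi> n x else 0) = (\<lambda>x. (indicator (cbox a b) x *\<^sub>R g x) * \<phi> n x)"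
      using ab box_subset_cbox[of a b] by (auto simp: fun_eq_iff \<phi>_def indicator_def intro!: box_bump_zero)
    finally show ?thesis using zero[OF \<phi>] by simp
  qed
  have "(\<lambda>n. LINT x|lebesgue. (indicator (cbox a b) x *\<^sub>R g x) * \<phi> n x) \<longlonglongrightarrow> (LINT x|lebesgue. (indicator (cbox a b) x *\<^sub>R g x) * indicator (box a b) x)"
  proof (rule integral_dominated_convergence[where w = "\<lambda>x. norm (indicator (cbox a b) x *\<^sub>R g x)"])
    show "AE x in lebesgue. (\<lambda>n. (indicator (cbox a b) x *\<^sub>R g x) * \<phi> n x) \<longlonglongrightarrow> (indicator (cbox a b) x *\<^sub>R g x) * indicator (box a b) x"
      unfolding \<phi>_def by (intro AE_I2 tendsto_intros box_bump_tendsto)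
    have "norm (c * \<phi> n x) \<le> norm c" for c x n
      using box_bump_le_1[of "1 / real (Suc n)" a b x] box_bump_nonneg[of "1 / real (Suc n)" a b x]
      by (simp add: \<phi>_def abs_mult mult_left_le)
    then show "AE x in lebesgue. norm ((indicator (cbox a b) x *\<^sub>R g x) * \<phi> n x) \<le> norm (indicator (cbox a b) x *\<^sub>R g x)" for n
      by (intro AE_I2)
    show "(\<lambda>x. (indicator (cbox a b) x *\<^sub>R g x) * \<phi> n x) \<in> borel_measurable lebesgue" for n
      using gm \<phi>m by (intro borel_measurable_times)
    show "(\<lambda>x. (indicator (cbox a b) x *\<^sub>R g x) * indicator (box a b) x) \<in> borel_measurable lebesgue"
      by (intro borel_measurable_times[OF gm] borel_measurable_indicator) auto
  qed (use integrable_norm[OF gi] in auto)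
  then have "(LINT x|lebesgue. (indicator (cbox a b) x *\<^sub>R g x) * indicator (box a b) x) = 0"
    by (simp only: eq LIMSEQ_const_iff)
  moreover have "(\<lambda>x. (indicator (cbox a b) x *\<^sub>R g x) * indicator (box a b) x) = (\<lambda>x. indicator (box a b) x *\<^sub>R g x)"
    using box_subset_cbox[of a b] by (auto simp: fun_eq_iff indicator_def)
  ultimately show ?thesis by (simp add: set_lebesgue_integral_def)
qed

lemma fundamental_lemma:
  fixes g :: "'a::euclidean_space \<Rightarrow> real"
  assumes open_\<Omega>: "open \<Omega>" and g: "locally_integrable \<Omega> g"
    and zero: "\<And>\<phi>. \<phi> \<in> C0_infinity \<Omega> \<Longrightarrow> (LINT x|lebesgue_on \<Omega>. g x * \<phi> x) = 0"
  shows "AE x in lebesgue_on \<Omega>. g x = 0"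
proof -
  have loc: "AE x in lebesgue. x \<in> box c d \<longrightarrow> g x = 0" if cd: "cbox c d \<subseteq> \<Omega>" for c d
  proof -
    define f where "f x = indicator (box c d) x *\<^sub>R g x" for x
    have "set_integrable lebesgue (cbox c d) g"
      using g cd by (simp add: locally_integrable_def compact_cbox)
    then have "set_integrable lebesgue (box c d) g"
      by (rule set_integrable_subset) (auto simp: box_subset_cbox)
    then have fi: "integrable lebesgue f" by (simp add: f_def[abs_def] set_integrable_def)
    \<comment> \<open>A Borel version is taken because the argument with boxes lives on Borel
      measure, while \<open>g\<close> is only Lebesgue measurable.\<close>
    then obtain f' where f': "f' \<in> borel_measurable lborel" "AE x in lborel. f x = f' x"
      using completion_ex_borel_measurable_real borel_measurable_integrable by blast
    have f'2: "AE x in lebesgue. f x = f' x" using f'(2) by (rule AE_completion)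
    have f'm: "f' \<in> borel_measurable lebesgue" using f'(1) by (rule measurable_completion)
    have "integrable lebesgue f'"
      by (rule integrable_cong_AE_imp[OF fi f'm]) (use f'2 in \<open>auto elim: eventually_mono\<close>)
    then have f'i: "integrable lborel f'" using f'(1) by (simp add: integrable_completion)
    have "AE x in lborel. f' x = 0"
    proof (rule AE_zero_of_box_integrals[OF f'i])
      fix a b :: 'a
      obtain a' b' where ab': "box a b \<inter> box c d = box a' b'" using box_Int_box[of a b c d] by blast
      have "(LINT x:box a b|lborel. f' x) = (LINT x|lebesgue. indicator (box a b) x *\<^sub>R f' x)"
        unfolding set_lebesgue_integral_def using f'(1) by (subst integral_completion) auto
      also have "\<dots> = (LINT x|lebesgue. indicator (box a b) x *\<^sub>R f x)"
        using f'2 f'm borel_measurable_integrable[OF fi] by (intro integral_cong_AE borel_measurable_scaleR borel_measurable_indicator) auto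
      also have "\<dots> = (LINT x:box a' b'|lebesgue. g x)"
        unfolding set_lebesgue_integral_def f_def by (simp add: indicator_inter_arith[symmetric] ab' flip: mult.assoc)
      also have "\<dots> = 0"
      \<comment> \<open>An empty open box may come with a nonempty closed box, possibly outside the
        domain; hence the separate case.\<close>
      proof (cases "box a' b' = {}")
        case False
        have "cbox a' b' = closure (box a' b')" using False by (simp add: closure_box)
        also have "\<dots> \<subseteq> cbox c d" unfolding ab'[symmetric]
          by (meson Int_lower2 box_subset_cbox closed_cbox closure_minimal order_trans)
        finally show ?thesis using cd by (intro fundamental_lemma_cbox[OF open_\<Omega> g zero]) auto
      qed (simp add: set_lebesgue_integral_def)
      finally show "(LINT x:box a b|lborel. f' x) = 0" .
    qed
    then have "AE x in lebesgue. f' x = 0" by (rule AE_completion)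
    then show ?thesis using f'2 by eventually_elim (auto simp: f_def)
  qed
  \<comment> \<open>By Lindelof countably many such boxes cover the domain, so the exceptional null
    sets can be united.\<close>
  obtain \<D> where \<D>: "countable \<D>" "\<And>X. X \<in> \<D> \<Longrightarrow> \<exists>a b. cbox a b \<subseteq> \<Omega> \<and> X = box a b" "\<Union>\<D> = \<Omega>"
  proof -
    have "\<exists>a b. cbox a b \<subseteq> \<Omega> \<and> x \<in> box a b" if "x \<in> \<Omega>" for x
      using open_contains_cbox[OF open_\<Omega> that] by metis
    then obtain A B where AB: "\<And>x. x \<in> \<Omega> \<Longrightarrow> cbox (A x) (B x) \<subseteq> \<Omega> \<and> x \<in> box (A x) (B x)" by metis
    let ?F = "(\<lambda>x. box (A x) (B x)) ` \<Omega>"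
    obtain F' where F': "F' \<subseteq> ?F" "countable F'" "\<Union>F' = \<Union>?F"
      using Lindelof[of ?F] by (metis (no_types, lifting) imageE open_box)
    have un: "\<Union>?F = \<Omega>" using AB box_subset_cbox by fastforce
    show ?thesis
    proof (rule that[OF F'(2)])
      show "\<exists>a b. cbox a b \<subseteq> \<Omega> \<and> X = box a b" if "X \<in> F'" for X
        using that F'(1) AB by blast
      show "\<Union>F' = \<Omega>" using F'(3) un by (rule trans)
    qed
  qed
  have "AE x in lebesgue. \<forall>X\<in>\<D>. x \<in> X \<longrightarrow> g x = 0"
  proof (subst AE_ball_countable[OF \<D>(1)], rule ballI)
    fix X assume "X \<in> \<D>"
    then obtain a b where "cbox a b \<subseteq> \<Omega>" "X = box a b" using \<D>(2) by blast
    then show "AE x in lebesgue. x \<in> X \<longrightarrow> g x = 0" using loc by simp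
  qed
  then have "AE x in lebesgue. x \<in> \<Omega> \<longrightarrow> g x = 0"
    by eventually_elim (use \<D>(3) in auto)
  then show ?thesis using open_\<Omega> by (simp add: AE_restrict_space_iff)
qed

lemma locally_integrable_times_continuous:
  fixes g :: "'a::euclidean_space \<Rightarrow> 'b::euclidean_space"
  assumes \<Omega>: "\<Omega> \<in> sets lebesgue" and g: "locally_integrable \<Omega> g" and K: "compact K" "K \<subseteq> \<Omega>"
    and \<phi>: "continuous_on UNIV \<phi>" "\<And>x. x \<notin> K \<Longrightarrow> \<phi> x = (0::real)"
  shows "integrable (lebesgue_on \<Omega>) (\<lambda>x. \<phi> x *\<^sub>R g x)"
proof -
  obtain B where B: "0 \<le> B" "\<And>x. norm (\<phi> x) \<le> B" using bounded_compact_support[OF \<phi>(1) K(1) \<phi>(2)] by blast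
  have gi: "integrable lebesgue (\<lambda>x. indicator K x *\<^sub>R g x)"
    using g K by (simp add: locally_integrable_def set_integrable_def)
  have "integrable lebesgue (\<lambda>x. \<phi> x *\<^sub>R (indicator K x *\<^sub>R g x))"
  proof (rule Bochner_Integration.integrable_bound[of lebesgue "\<lambda>x. B *\<^sub>R (indicator K x *\<^sub>R g x)"])
    show "integrable lebesgue (\<lambda>x. B *\<^sub>R (indicator K x *\<^sub>R g x))" using gi by (intro integrable_scaleR_right)
    have "\<phi> \<in> borel_measurable lebesgue"
      using \<phi>(1) by (intro measurable_completion) (simp add: borel_measurable_continuous_onI)
    then show "(\<lambda>x. \<phi> x *\<^sub>R (indicator K x *\<^sub>R g x)) \<in> borel_measurable lebesgue"
      by (rule borel_measurable_scaleR[OF _ borel_measurable_integrable[OF gi]])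
    show "AE x in lebesgue. norm (\<phi> x *\<^sub>R (indicator K x *\<^sub>R g x)) \<le> norm (B *\<^sub>R (indicator K x *\<^sub>R g x))"
      using B by (auto intro!: AE_I2 mult_right_mono simp: indicator_def)
  qed
  also have "(\<lambda>x. \<phi> x *\<^sub>R (indicator K x *\<^sub>R g x)) = (\<lambda>x. indicator \<Omega> x *\<^sub>R (\<phi> x *\<^sub>R g x))"
    using K \<phi>(2) by (auto simp: fun_eq_iff indicator_def)
  finally show ?thesis using \<Omega> by (simp add: integrable_restrict_space)
qed

lemma has_weak_gradient_unique:
  assumes \<Omega>: "open \<Omega>" and g: "has_weak_gradient \<Omega> u g" "has_weak_gradient \<Omega> u h"
  shows "AE x in lebesgue_on \<Omega>. g x = h x"
proof -
  have gl: "locally_integrable \<Omega> g" "locally_integrable \<Omega> h" using g by (auto simp: has_weak_gradient_def)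
  have "AE x in lebesgue_on \<Omega>. (g x - h x) \<bullet> e = 0" if e: "e \<in> Basis" for e
  proof (rule fundamental_lemma[OF \<Omega>])
    show "locally_integrable \<Omega> (\<lambda>x. (g x - h x) \<bullet> e)"
      unfolding locally_integrable_def
    proof (intro allI impI)
      fix K assume K: "compact K \<and> K \<subseteq> \<Omega>"
      then have "set_integrable lebesgue K (\<lambda>x. g x - h x)"
        using gl by (intro set_integral_diff) (auto simp: locally_integrable_def)
      then have "integrable lebesgue (\<lambda>x. (indicator K x *\<^sub>R (g x - h x)) \<bullet> e)"
        unfolding set_integrable_def by (rule integrable_inner_left[rotated])
      then show "set_integrable lebesgue K (\<lambda>x. (g x - h x) \<bullet> e)"
        by (simp add: set_integrable_def)
    qed
    fix \<phi> assume \<phi>: "\<phi> \<in> C0_infinity \<Omega>"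
    obtain K where K: "compact K" "K \<subseteq> \<Omega>" "\<And>x. x \<notin> K \<Longrightarrow> \<phi> x = 0" using C0_infinity_support[OF \<phi>] by metis
    have i: "integrable (lebesgue_on \<Omega>) (\<lambda>x. (k x \<bullet> e) * \<phi> x)" if "locally_integrable \<Omega> k" for k
    proof -
      have "integrable (lebesgue_on \<Omega>) (\<lambda>x. (\<phi> x *\<^sub>R k x) \<bullet> e)"
        using locally_integrable_times_continuous[OF _ that K(1,2) C0_infinity_continuous[OF \<phi>] K(3)] \<Omega>
        by (intro integrable_inner_left) auto
      then show ?thesis by (simp add: mult.commute)
    qed
    have "(LINT x|lebesgue_on \<Omega>. (g x \<bullet> e) * \<phi> x) = (LINT x|lebesgue_on \<Omega>. (h x \<bullet> e) * \<phi> x)"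
    proof -
      have "(LINT x|lebesgue_on \<Omega>. u x * partial_deriv e \<phi> x) = - (LINT x|lebesgue_on \<Omega>. (g x \<bullet> e) * \<phi> x)"
        "(LINT x|lebesgue_on \<Omega>. u x * partial_deriv e \<phi> x) = - (LINT x|lebesgue_on \<Omega>. (h x \<bullet> e) * \<phi> x)"
        using g \<phi> e unfolding has_weak_gradient_def by blast+
      then show ?thesis by linarith
    qed
    then show "(LINT x|lebesgue_on \<Omega>. (g x - h x) \<bullet> e * \<phi> x) = 0"
      using i[OF gl(1)] i[OF gl(2)] by (simp add: inner_diff_left left_diff_distrib)
  qed
  then have "AE x in lebesgue_on \<Omega>. \<forall>e\<in>Basis. (g x - h x) \<bullet> e = 0"
    by (simp add: AE_finite_all)
  then show ?thesis
    by eventually_elim (metis euclidean_all_zero_iff eq_iff_diff_eq_0)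
qed

lemma weak_gradient_AE:
  assumes "open \<Omega>" "has_weak_gradient \<Omega> u g"
  shows "AE x in lebesgue_on \<Omega>. weak_gradient \<Omega> u x = g x"
  by (rule has_weak_gradient_unique[OF assms(1) _ assms(2)])
     (unfold weak_gradient_def, rule someI[of "has_weak_gradient \<Omega> u", OF assms(2)])

text \<open>The integral of a difference quotient vanishes by translation invariance; let the step
  tend to zero.\<close>

lemma integral_partial_deriv_eq_0:
  fixes f :: "'a::euclidean_space \<Rightarrow> real"
  assumes diff: "\<And>x. f differentiable (at x)" and cont: "continuous_on UNIV (partial_deriv e f)"
    and K: "compact K" "\<And>x. x \<notin> K \<Longrightarrow> f x = 0" and e: "norm e = 1"
  shows "(LINT x|lborel. partial_deriv e f x) = 0"
proof -
  have fc: "continuous_on UNIV f"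
    using diff by (auto intro!: differentiable_imp_continuous_on simp: differentiable_on_def)
  have fi: "integrable lborel f" by (rule integrable_compact_support[OF fc K])
  \<comment> \<open>This closed neighbourhood of \<open>K\<close> of radius \<open>1\<close>
    contains the supports of all difference quotients with step at most \<open>1\<close>, so a
    multiple of its indicator dominates them.\<close>
  define K' where "K' = {x + y | x y. x \<in> K \<and> y \<in> cball (0::'a) 1}"
  have K': "compact K'" unfolding K'_def using K(1) by (intro compact_sums) auto
  have K'K: "x + h *\<^sub>R e \<notin> K" if "x \<notin> K'" "\<bar>h\<bar> \<le> 1" for x h
  proof
    assume "x + h *\<^sub>R e \<in> K"
    then have "(x + h *\<^sub>R e) + (- h *\<^sub>R e) \<in> K'" unfolding K'_def using that e
      by (intro CollectI exI[of _ "x + h *\<^sub>R e"] exI[of _ "- h *\<^sub>R e"]) auto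
    then show False using that by simp
  qed
  have pz: "partial_deriv e f x = 0" if "x \<notin> K'" for x
  proof -
    have "x \<notin> K" using K'K[OF that, of 0] by simp
    have "((\<lambda>x. 0) has_derivative (\<lambda>h. 0)) (at x)" by simp
    then have "(f has_derivative (\<lambda>h. 0)) (at x)"
    proof (rule has_derivative_transform_within_open[where s = "- K"])
      show "open (- K)" using K(1) compact_imp_closed by blast
    qed (use \<open>x \<notin> K\<close> K(2) in auto)
    then show ?thesis by (rule partial_deriv_eqI)
  qed
  obtain B where B: "0 \<le> B" "\<And>x. norm (partial_deriv e f x) \<le> B"
    using bounded_compact_support[OF cont K' pz] by blast
  have d: "((\<lambda>t. f (x + t *\<^sub>R e)) has_real_derivative partial_deriv e f (x + t *\<^sub>R e)) (at t)" for x t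
  proof -
    have 1: "((\<lambda>t. x + t *\<^sub>R e) has_derivative (\<lambda>h. h *\<^sub>R e)) (at t)"
      by (auto intro!: derivative_eq_intros)
    have 2: "(f has_derivative frechet_derivative f (at (x + t *\<^sub>R e))) (at (x + t *\<^sub>R e))"
      using diff by (simp add: frechet_derivative_works)
    have "((\<lambda>t. f (x + t *\<^sub>R e)) has_derivative (\<lambda>h. frechet_derivative f (at (x + t *\<^sub>R e)) (h *\<^sub>R e))) (at t)"
      by (rule has_derivative_compose[OF 1 2])
    moreover have "frechet_derivative f (at (x + t *\<^sub>R e)) (h *\<^sub>R e) = partial_deriv e f (x + t *\<^sub>R e) * h" for h
      using bounded_linear.linear[OF has_derivative_bounded_linear[OF 2]] by (simp add: linear_cmul)
    ultimately show ?thesis by (simp add: has_field_derivative_def)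
  qed
  define q where "q n x = real (Suc n) * (f (x + (1 / real (Suc n)) *\<^sub>R e) - f x)" for n x
  have shift: "integrable lborel (\<lambda>x. f (x + y))" "(LINT x|lborel. f (x + y)) = (LINT x|lborel. f x)" for y
  proof -
    have fm: "f \<in> borel_measurable borel" using fc by (simp add: borel_measurable_continuous_onI)
    have "integrable (distr lborel borel ((+) y)) f" using fi by (simp add: lborel_distr_plus)
    then show "integrable lborel (\<lambda>x. f (x + y))"
      using fm by (subst (asm) integrable_distr_eq) (auto simp: add.commute)
    have "(LINT x|lborel. f x) = (LINT x|distr lborel borel ((+) y). f x)" by (simp add: lborel_distr_plus)
    also have "\<dots> = (LINT x|lborel. f (x + y))"
      using fm by (subst integral_distr) (auto simp: add.commute)
    finally show "(LINT x|lborel. f (x + y)) = (LINT x|lborel. f x)" by simp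
  qed
  have "(\<lambda>n. LINT x|lborel. q n x) \<longlonglongrightarrow> (LINT x|lborel. partial_deriv e f x)"
  proof (rule integral_dominated_convergence[where w = "\<lambda>x. indicator K' x * B"])
    show "partial_deriv e f \<in> borel_measurable lborel" using cont by (simp add: borel_measurable_continuous_onI)
    show "q n \<in> borel_measurable lborel" for n
      using fi shift unfolding q_def by (intro borel_measurable_integrable) auto
    show "integrable lborel (\<lambda>x. indicator K' x * B)"
      using K' emeasure_compact_finite[OF K'] by (intro integrable_mult_left) (auto simp: compact_imp_closed less_top[symmetric])
    show "AE x in lborel. (\<lambda>n. q n x) \<longlonglongrightarrow> partial_deriv e f x"
    proof (rule AE_I2)
      fix x
      have "((\<lambda>t. (f (x + t *\<^sub>R e) - f x) / t) \<longlongrightarrow> partial_deriv e f x) (at 0)"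
        using d[of x 0] by (simp add: has_field_derivative_iff)
      moreover have "filterlim (\<lambda>n. 1 / real (Suc n)) (at 0) sequentially"
        by (auto simp: filterlim_at intro!: LIMSEQ_Suc[OF lim_1_over_n] simp del: of_nat_Suc)
      ultimately have "(\<lambda>n. (f (x + (1 / real (Suc n)) *\<^sub>R e) - f x) / (1 / real (Suc n))) \<longlonglongrightarrow> partial_deriv e f x"
        by (rule filterlim_compose)
      then show "(\<lambda>n. q n x) \<longlonglongrightarrow> partial_deriv e f x" by (simp add: q_def mult.commute)
    qed
    show "AE x in lborel. norm (q n x) \<le> indicator K' x * B" for n
    proof (rule AE_I2)
      fix x
      define h where "h = 1 / real (Suc n)"
      have h: "0 < h" "h \<le> 1" "real (Suc n) = 1 / h" by (auto simp: h_def)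
      show "norm (q n x) \<le> indicator K' x * B"
      proof (cases "x \<in> K'")
        case True
        obtain z where "f (x + h *\<^sub>R e) - f (x + 0 *\<^sub>R e) = (h - 0) * partial_deriv e f (x + z *\<^sub>R e)"
          using MVT2[OF h(1), of "\<lambda>t. f (x + t *\<^sub>R e)" "\<lambda>t. partial_deriv e f (x + t *\<^sub>R e)"] d by blast
        then have "q n x = partial_deriv e f (x + z *\<^sub>R e)"
          unfolding q_def h_def[symmetric] using h by simp
        then show ?thesis using B True by simp
      next
        case False
        then have "f (x + h *\<^sub>R e) = 0" "f x = 0" using K'K[OF False, of h] K'K[OF False, of 0] h K(2) by auto
        then show ?thesis using False by (simp add: q_def h_def)
      qed
    qed
  qed
  moreover have "(LINT x|lborel. q n x) = 0" for n
    unfolding q_def using fi shift by simp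
  ultimately show ?thesis by (simp add: LIMSEQ_const_iff)
qed

lemma C0_infinity_integration_by_parts:
  assumes "\<phi> \<in> C0_infinity \<Omega>" "\<psi> \<in> C0_infinity \<Omega>" "e \<in> Basis"
  shows "(LINT x|lborel. \<phi> x * partial_deriv e \<psi> x) = - (LINT x|lborel. partial_deriv e \<phi> x * \<psi> x)"
proof -
  obtain K where K: "compact K" "\<And>x. x \<notin> K \<Longrightarrow> \<phi> x = 0" using C0_infinity_support[OF assms(1)] by metis
  obtain K2 where K2: "compact K2" "\<And>x. x \<notin> K2 \<Longrightarrow> \<psi> x = 0" using C0_infinity_support[OF assms(2)] by metis
  have d: "((\<lambda>x. \<phi> x * \<psi> x) has_derivative (\<lambda>h. \<phi> x * frechet_derivative \<psi> (at x) h + frechet_derivative \<phi> (at x) h * \<psi> x)) (at x)" for x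
    using C0_infinity_differentiable[OF assms(1)] C0_infinity_differentiable[OF assms(2)]
    by (intro has_derivative_mult) (auto simp: frechet_derivative_works)
  have p: "partial_deriv e (\<lambda>x. \<phi> x * \<psi> x) = (\<lambda>x. \<phi> x * partial_deriv e \<psi> x + partial_deriv e \<phi> x * \<psi> x)"
    using partial_deriv_eqI[OF d] by auto
  have c: "continuous_on UNIV (\<lambda>x. \<phi> x * partial_deriv e \<psi> x)" "continuous_on UNIV (\<lambda>x. partial_deriv e \<phi> x * \<psi> x)"
    by (intro continuous_on_mult C0_infinity_continuous[OF assms(1)] C0_infinity_continuous[OF assms(2)]
        C0_infinity_partial_continuous[OF assms(1,3)] C0_infinity_partial_continuous[OF assms(2,3)])+
  have i: "integrable lborel (\<lambda>x. \<phi> x * partial_deriv e \<psi> x)" "integrable lborel (\<lambda>x. partial_deriv e \<phi> x * \<psi> x)"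
    using c K K2 by (auto intro: integrable_compact_support[of _ K] integrable_compact_support[of _ K2])
  have "(LINT x|lborel. partial_deriv e (\<lambda>x. \<phi> x * \<psi> x) x) = 0"
  proof (rule integral_partial_deriv_eq_0[OF _ _ K(1)])
    show "(\<lambda>x. \<phi> x * \<psi> x) differentiable (at x)" for x using d by (auto simp: differentiable_def)
    show "continuous_on UNIV (partial_deriv e (\<lambda>x. \<phi> x * \<psi> x))"
      unfolding p by (intro continuous_on_add c)
  qed (use K(2) assms(3) in auto)
  then show ?thesis unfolding p using i by simp
qed

section \<open>A priori bounds by the energy\<close>

lemma nn_integral_lborel_affine:
  fixes h :: "'a::euclidean_space \<Rightarrow> ennreal"
  assumes [measurable]: "h \<in> borel_measurable borel" and "c \<noteq> 0"
  shows "(\<integral>\<^sup>+y. h y \<partial>lborel) = ennreal (\<bar>c\<bar> ^ DIM('a)) * (\<integral>\<^sup>+y. h (x + c *\<^sub>R y) \<partial>lborel)"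
  by (subst lborel_affine[OF assms(2), of x])
     (simp add: nn_integral_density nn_integral_distr nn_integral_cmult)

lemma C0_infinity_line_bound:
  assumes \<phi>: "\<phi> \<in> C0_infinity \<Omega>" and zero: "\<phi> (x + y) = 0"
  shows "ennreal \<bar>\<phi> x\<bar> \<le> (\<integral>\<^sup>+t. ennreal (norm (gradient \<phi> (x + t *\<^sub>R y)) * norm y) * indicator {0..1} t \<partial>lborel)"
proof -
  let ?f = "\<lambda>t::real. gradient \<phi> (x + t *\<^sub>R y) \<bullet> y"
  have c: "continuous_on {0..1} ?f"
    by (intro continuous_intros continuous_on_compose2[OF C0_infinity_gradient_continuous[OF \<phi>]]) auto
  have "((\<lambda>t. \<phi> (x + t *\<^sub>R y)) has_vector_derivative ?f t) (at t within {0..1})" for t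
  proof -
    have "((\<lambda>t. x + t *\<^sub>R y) has_derivative (\<lambda>h. h *\<^sub>R y)) (at t within {0..1})"
      by (auto intro!: derivative_eq_intros)
    from has_derivative_compose[OF this has_derivative_gradient[OF C0_infinity_differentiable[OF \<phi>]]]
    show ?thesis by (simp add: has_vector_derivative_def)
  qed
  then have "(LINT t|lborel. indicator {0..1} t *\<^sub>R ?f t) = \<phi> (x + 1 *\<^sub>R y) - \<phi> (x + 0 *\<^sub>R y)"
    using c by (intro integral_FTC_atLeastAtMost) auto
  then have "\<bar>\<phi> x\<bar> = norm (LINT t|lborel. indicator {0..1} t *\<^sub>R ?f t)"
    using zero by simp
  also have "ennreal \<dots> \<le> (\<integral>\<^sup>+t. ennreal (norm (indicator {0..1} t *\<^sub>R ?f t)) \<partial>lborel)"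
    using c by (intro integral_norm_bound_ennreal borel_integrable_compact) auto
  also have "\<dots> \<le> (\<integral>\<^sup>+t. ennreal (norm (gradient \<phi> (x + t *\<^sub>R y)) * norm y) * indicator {0..1} t \<partial>lborel)"
    by (intro nn_integral_mono) (auto simp: indicator_def intro!: ennreal_leI Cauchy_Schwarz_ineq2)
  finally show ?thesis .
qed

text \<open>Jensen's inequality on the unit interval, with infinite integrals allowed. Young's
  inequality linearizes at the fixed number \<open>a\<close>, after which only a sum is
  integrated.\<close>

lemma powr_le_nn_integral_powr:
  fixes f :: "real \<Rightarrow> real"
  assumes p: "1 < p" and a: "0 \<le> a" and [measurable]: "f \<in> borel_measurable borel" and f: "\<And>t. 0 \<le> f t"
    and le: "ennreal a \<le> (\<integral>\<^sup>+t. ennreal (f t) * indicator {0..1} t \<partial>lborel)"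
  shows "ennreal (a powr p) \<le> (\<integral>\<^sup>+t. ennreal (f t powr p) * indicator {0..1} t \<partial>lborel)"
proof (cases "a = 0 \<or> (\<integral>\<^sup>+t. ennreal (f t powr p) * indicator {0..1} t \<partial>lborel) = \<infinity>")
  case False
  then have a: "0 < a" using a by auto
  define J where "J = enn2real (\<integral>\<^sup>+t. ennreal (f t powr p) * indicator {0..1} t \<partial>lborel)"
  have J: "(\<integral>\<^sup>+t. ennreal (f t powr p) * indicator {0..1} t \<partial>lborel) = ennreal J" "0 \<le> J"
    using False by (auto simp: J_def less_top)
  \<comment> \<open>Young's inequality divided by \<open>a powr (p - 1)\<close>; the term
    \<open>(1 - 1 / p) * a\<close> is absorbed by the left side at the end.\<close>
  have young: "b \<le> a powr (1 - p) / p * b powr p + (1 - 1 / p) * a" if "0 \<le> b" for b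
  proof -
    have "b * a powr (p - 1) * a powr (1 - p) \<le> (b powr p / p + (1 - 1 / p) * a powr p) * a powr (1 - p)"
      using p a that by (intro mult_right_mono young_powr) auto
    moreover have "b * a powr (p - 1) * a powr (1 - p) = b" using a by (simp add: mult.assoc flip: powr_add)
    moreover have "a powr p * a powr (1 - p) = a" using a by (simp flip: powr_add)
    moreover have "(b powr p / p + (1 - 1 / p) * a powr p) * a powr (1 - p)
        = a powr (1 - p) / p * b powr p + (1 - 1 / p) * (a powr p * a powr (1 - p))"
      using p by (simp add: field_simps)
    ultimately show ?thesis by simp
  qed
  have "ennreal a \<le> (\<integral>\<^sup>+t. ennreal (f t) * indicator {0..1} t \<partial>lborel)" by (rule le)
  also have "\<dots> \<le> (\<integral>\<^sup>+t. ennreal (a powr (1 - p) / p) * (ennreal (f t powr p) * indicator {0..1} t)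
      + ennreal ((1 - 1 / p) * a) * indicator {0..1::real} t \<partial>lborel)"
    using young[OF f] p a
    by (intro nn_integral_mono) (auto simp: indicator_def simp flip: ennreal_mult ennreal_plus intro!: ennreal_leI)
  also have "\<dots> = ennreal (a powr (1 - p) / p) * ennreal J + ennreal ((1 - 1 / p) * a)"
    by (subst nn_integral_add) (auto simp: nn_integral_cmult J(1)[symmetric])
  also have "\<dots> = ennreal (a powr (1 - p) / p * J + (1 - 1 / p) * a)"
    using J p a by (simp flip: ennreal_mult ennreal_plus)
  finally have "a \<le> a powr (1 - p) / p * J + (1 - 1 / p) * a"
    using J p a by (subst (asm) ennreal_le_iff) auto
  then have "a \<le> a powr (1 - p) * J" using p by (simp add: field_simps)
  then have "a powr (p - 1) * a \<le> a powr (p - 1) * (a powr (1 - p) * J)" by (intro mult_left_mono) auto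
  moreover have "a powr (p - 1) * a = a powr p" using a by (simp add: powr_mult_base mult.commute)
  moreover have "a powr (p - 1) * (a powr (1 - p) * J) = J" using a by (simp flip: powr_add mult.assoc)
  ultimately show ?thesis using J by simp
qed (use p in auto)

text \<open>The geometry enters the analytic estimates only through \<open>far_corner\<close>:
  beyond a cube, all corners of the space are exterior. Such a domain may be unbounded.\<close>

locale sobolev_domain =
  fixes \<Omega> :: "'a::euclidean_space set" and p L :: real
  assumes open_dom: "open \<Omega>" and dim_less: "real DIM('a) < p" and L_pos: "0 < L"
    and far_corner: "\<And>x. (\<And>e. e \<in> Basis \<Longrightarrow> L \<le> \<bar>x \<bullet> e\<bar>) \<Longrightarrow> x \<notin> \<Omega>"
begin

abbreviation "M \<equiv> lebesgue_on \<Omega>"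

lemma p_gt_1: "1 < p"
  using dim_less DIM_positive[where 'a='a] by (simp add: Suc_le_eq order_le_less_trans[of 1 "real DIM('a)"])

lemma dom_sets: "\<Omega> \<in> sets lebesgue"
  using open_dom by simp

lemma nn_integral_powr_C0:
  assumes "continuous_on UNIV f" "compact K" "\<And>x. x \<notin> K \<Longrightarrow> f x = 0" "K \<subseteq> \<Omega>"
  shows "(\<integral>\<^sup>+x. ennreal (norm (f x) powr p) \<partial>lborel) = ennreal (Lp_pow M p f)"
proof -
  have c: "continuous_on UNIV (\<lambda>x. norm (f x) powr p)"
    using assms p_gt_1 by (intro continuous_on_powr' continuous_intros) auto
  have "(\<integral>\<^sup>+x. ennreal (norm (f x) powr p) \<partial>lborel) = ennreal (LINT x|lborel. norm (f x) powr p)"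
    using c assms by (intro nn_integral_eq_integral integrable_compact_support[of _ K]) auto
  also have "(LINT x|lborel. norm (f x) powr p) = Lp_pow M p f"
    unfolding Lp_pow_def using c assms
    by (intro integral_lebesgue_on_eq_lborel[symmetric] dom_sets) (auto simp: borel_measurable_continuous_onI)
  finally show ?thesis .
qed

lemma nn_integral_gradient_powr:
  assumes "\<phi> \<in> C0_infinity \<Omega>"
  shows "(\<integral>\<^sup>+x. ennreal (norm (gradient \<phi> x) powr p) \<partial>lborel) = ennreal (Lp_pow M p (gradient \<phi>))"
proof -
  obtain K where K: "compact K" "K \<subseteq> \<Omega>" "\<And>x. x \<notin> K \<Longrightarrow> gradient \<phi> x = 0"
    using C0_infinity_support[OF assms] by metis
  show ?thesis using nn_integral_powr_C0[OF C0_infinity_gradient_continuous[OF assms] K(1,3,2)] .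
qed

text \<open>A step of length \<open>L\<close> along every axis, with the signs recorded by
  \<open>B\<close>. With the signs of \<open>x\<close> each coordinate moves away from
  \<open>0\<close> and reaches modulus at least \<open>L\<close>.\<close>

definition diag_vector :: "'a set \<Rightarrow> 'a" where
  "diag_vector B = (\<Sum>e\<in>Basis. (if e \<in> B then L else - L) *\<^sub>R e)"

lemma diag_vector_exits: "x + diag_vector {e. 0 \<le> x \<bullet> e} \<notin> \<Omega>"
  by (rule far_corner) (use L_pos in \<open>auto simp: diag_vector_def inner_add_left inner_sum_left_Basis\<close>)

lemma norm_diag_vector: "norm (diag_vector B) \<le> DIM('a) * L"
proof -
  have "norm (diag_vector B) \<le> (\<Sum>e\<in>(Basis::'a set). norm ((if e \<in> B then L else - L) *\<^sub>R e))"
    unfolding diag_vector_def by (rule norm_sum)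
  also have "\<dots> = (\<Sum>e\<in>(Basis::'a set). L)" using L_pos by (intro sum.cong) auto
  finally show ?thesis by simp
qed

text \<open>The factor \<open>2 ^ DIM('a)\<close> counts sign patterns, and
  \<open>DIM('a) * L\<close> bounds the length of a diagonal step.\<close>

definition poincare_const :: real where
  "poincare_const = 2 ^ DIM('a) * (DIM('a) * L) powr p"

text \<open>The direction of exit depends on the signs of \<open>x\<close>; summing over all sign
  patterns removes this dependence. For a fixed direction Fubini and translation invariance give the
  energy.\<close>

lemma poincare_C0:
  assumes \<phi>: "\<phi> \<in> C0_infinity \<Omega>"
  shows "Lp_pow M p \<phi> \<le> poincare_const * Lp_pow M p (gradient \<phi>)"
proof -
  define R where "R = DIM('a) * L"
  define I where "I = Lp_pow M p (gradient \<phi>)"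
  have I: "0 \<le> I" by (simp add: I_def Lp_pow_nonneg)
  have R: "0 \<le> R" using L_pos by (simp add: R_def)
  have [measurable]: "gradient \<phi> \<in> borel_measurable borel"
    using C0_infinity_gradient_continuous[OF \<phi>] by (simp add: borel_measurable_continuous_onI)
  have [measurable]: "\<phi> \<in> borel_measurable borel"
    using C0_infinity_continuous[OF \<phi>] by (simp add: borel_measurable_continuous_onI)
  let ?g = "\<lambda>B x t. ennreal ((norm (gradient \<phi> (x + t *\<^sub>R diag_vector B)) * norm (diag_vector B)) powr p) * indicator {0..1} t"
  have pw: "ennreal (norm (\<phi> x) powr p) \<le> (\<Sum>B\<in>Pow Basis. \<integral>\<^sup>+t. ?g B x t \<partial>lborel)" for x
  proof -
    let ?B = "{e. 0 \<le> x \<bullet> e} \<inter> Basis"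
    have dB: "diag_vector ?B = diag_vector {e. 0 \<le> x \<bullet> e}"
      unfolding diag_vector_def by (intro sum.cong) auto
    have "\<phi> (x + diag_vector ?B) = 0"
      unfolding dB using C0_infinity_outside(1)[OF \<phi> diag_vector_exits] .
    from C0_infinity_line_bound[OF \<phi> this]
    have "ennreal (norm (\<phi> x) powr p) \<le> (\<integral>\<^sup>+t. ?g ?B x t \<partial>lborel)"
      using p_gt_1 by (intro powr_le_nn_integral_powr) auto
    also have "\<dots> \<le> (\<Sum>B\<in>Pow Basis. \<integral>\<^sup>+t. ?g B x t \<partial>lborel)"
      by (rule member_le_sum) auto
    finally show ?thesis .
  qed
  have gB: "(\<integral>\<^sup>+x. \<integral>\<^sup>+t. ?g B x t \<partial>lborel \<partial>lborel) \<le> ennreal (R powr p * I)" for B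
  proof -
    have "(\<integral>\<^sup>+x. \<integral>\<^sup>+t. ?g B x t \<partial>lborel \<partial>lborel) = (\<integral>\<^sup>+t. \<integral>\<^sup>+x. ?g B x t \<partial>lborel \<partial>lborel)"
      by (rule lborel_pair.Fubini') measurable
    also have "\<dots> \<le> (\<integral>\<^sup>+t. ennreal (R powr p * I) * indicator {0..1::real} t \<partial>lborel)"
    proof (rule nn_integral_mono)
      fix t :: real
      have "(\<integral>\<^sup>+x. ?g B x t \<partial>lborel) \<le> (\<integral>\<^sup>+x. ennreal (R powr p) * indicator {0..1} t * ennreal (norm (gradient \<phi> (t *\<^sub>R diag_vector B + 1 *\<^sub>R x)) powr p) \<partial>lborel)"
      proof (rule nn_integral_mono)
        fix x
        have "(norm (gradient \<phi> (x + t *\<^sub>R diag_vector B)) * norm (diag_vector B)) powr p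
            \<le> R powr p * norm (gradient \<phi> (x + t *\<^sub>R diag_vector B)) powr p"
        proof -
          have "norm (diag_vector B) powr p \<le> R powr p"
            using norm_diag_vector[of B] p_gt_1 by (intro powr_mono2) (auto simp: R_def)
          then show ?thesis by (simp add: powr_mult mult.commute mult_right_mono)
        qed
        then show "?g B x t \<le> ennreal (R powr p) * indicator {0..1} t * ennreal (norm (gradient \<phi> (t *\<^sub>R diag_vector B + 1 *\<^sub>R x)) powr p)"
          by (auto simp: indicator_def add.commute simp flip: ennreal_mult intro!: ennreal_leI)
      qed
      also have "\<dots> = ennreal (R powr p) * indicator {0..1} t * (\<integral>\<^sup>+x. ennreal (norm (gradient \<phi> (t *\<^sub>R diag_vector B + 1 *\<^sub>R x)) powr p) \<partial>lborel)"
        by (rule nn_integral_cmult) measurable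
      also have "(\<integral>\<^sup>+x. ennreal (norm (gradient \<phi> (t *\<^sub>R diag_vector B + 1 *\<^sub>R x)) powr p) \<partial>lborel) = ennreal I"
        using nn_integral_lborel_affine[of "\<lambda>x. ennreal (norm (gradient \<phi> x) powr p)" 1 "t *\<^sub>R diag_vector B"]
        by (simp add: nn_integral_gradient_powr[OF \<phi>] I_def)
      finally show "(\<integral>\<^sup>+x. ?g B x t \<partial>lborel) \<le> ennreal (R powr p * I) * indicator {0..1::real} t"
        using I by (simp add: ennreal_mult ac_simps)
    qed
    also have "\<dots> = ennreal (R powr p * I)" by (simp add: nn_integral_cmult_indicator)
    finally show ?thesis .
  qed
  obtain K where K: "compact K" "K \<subseteq> \<Omega>" "\<And>x. x \<notin> K \<Longrightarrow> \<phi> x = 0"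
    using C0_infinity_support[OF \<phi>] by metis
  have "ennreal (Lp_pow M p \<phi>) = (\<integral>\<^sup>+x. ennreal (norm (\<phi> x) powr p) \<partial>lborel)"
    using nn_integral_powr_C0[OF C0_infinity_continuous[OF \<phi>] K(1,3,2)] by simp
  also have "\<dots> \<le> (\<integral>\<^sup>+x. (\<Sum>B\<in>Pow Basis. \<integral>\<^sup>+t. ?g B x t \<partial>lborel) \<partial>lborel)"
    by (intro nn_integral_mono pw)
  also have "\<dots> = (\<Sum>B\<in>Pow Basis. \<integral>\<^sup>+x. \<integral>\<^sup>+t. ?g B x t \<partial>lborel \<partial>lborel)"
    by (rule nn_integral_sum) measurable
  also have "\<dots> \<le> (\<Sum>B\<in>Pow (Basis::'a set). ennreal (R powr p * I))"
    by (intro sum_mono gB)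
  also have "\<dots> = ennreal (2 ^ DIM('a) * (R powr p * I))"
    using I by (simp add: card_Pow ennreal_mult ennreal_power flip: ennreal_numeral)
  finally show ?thesis
    using I by (simp add: poincare_const_def R_def I_def mult.assoc)
qed

text \<open>A Morrey type estimate. The value at \<open>x\<close> is averaged over a cube of vectors
  \<open>y\<close> with \<open>x + y\<close> exterior; after Fubini the substitution by
  \<open>x + t y\<close> costs \<open>t powr (- N)\<close>, and a weight in \<open>t\<close> is
  balanced so that both resulting powers are integrable at \<open>0\<close>, which
  \<open>N < p\<close> permits.\<close>

lemma sup_bound_unit_energy:
  obtains K where "0 < K" "\<And>\<phi> x. \<phi> \<in> C0_infinity \<Omega> \<Longrightarrow> Lp_pow M p (gradient \<phi>) \<le> 1 \<Longrightarrow> \<bar>\<phi> x\<bar> \<le> K"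
proof -
  define N where "N = real DIM('a)"
  \<comment> \<open>The midpoint of \<open>N - 1\<close> and \<open>p - 1\<close>: above the first,
    \<open>t powr (r - N)\<close> is integrable near \<open>0\<close>; below the second, so is
    \<open>t powr (- r / (p - 1))\<close>.\<close>
  define r where "r = (N + p) / 2 - 1"
  have N1: "1 \<le> N" using DIM_positive[where 'a='a] unfolding N_def by linarith
  have r: "-1 < r - N" "- 1 < - r / (p - 1)"
    using dim_less p_gt_1 N1 by (auto simp: r_def N_def[symmetric] field_simps)
  define C1 where "C1 = 1 / (r - N + 1)"
  define C2 where "C2 = 1 / (- r / (p - 1) + 1)"
  have C: "0 \<le> C1" "0 \<le> C2" using r by (auto simp: C1_def C2_def)
  define R where "R = DIM('a) * (2 * L)"
  define V where "V = L ^ DIM('a)"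
  have RV: "0 \<le> R" "0 < V" using L_pos by (auto simp: R_def V_def)
  \<comment> \<open>Either \<open>g\<close> lies below the threshold
    \<open>t powr (- r / (p - 1))\<close>, or its weighted \<open>p\<close>-th power dominates it.
    This separates the energy density from an integrable power of \<open>t\<close>.\<close>
  have pw: "g \<le> t powr r * g powr p + t powr (- r / (p - 1))" if "0 < t" "0 \<le> g" for t g :: real
  proof (cases "g \<le> t powr (- r / (p - 1))")
    case False
    then have "(t powr (- r / (p - 1))) powr (p - 1) \<le> g powr (p - 1)"
      using p_gt_1 by (intro powr_mono2) auto
    then have "t powr (- r) \<le> g powr (p - 1)" using p_gt_1 by (simp add: powr_powr)
    then have "t powr r * t powr (- r) * g \<le> t powr r * g powr (p - 1) * g"
      using that by (intro mult_right_mono mult_left_mono) auto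
    moreover have "g powr (p - 1) * g = g powr p"
      using that powr_mult_base[of g "p - 1"] by (simp add: mult.commute)
    ultimately have "g \<le> t powr r * g powr p"
      using that by (simp add: mult.assoc flip: powr_add)
    then show ?thesis by (simp add: add_increasing2)
  qed (simp add: add_increasing)
  have main: "\<bar>\<phi> x\<bar> * V \<le> R * (C1 + V * C2)" if \<phi>: "\<phi> \<in> C0_infinity \<Omega>" and le1: "Lp_pow M p (gradient \<phi>) \<le> 1" for \<phi> x
  proof -
    have [measurable]: "gradient \<phi> \<in> borel_measurable borel"
      using C0_infinity_gradient_continuous[OF \<phi>] by (simp add: borel_measurable_continuous_onI)
    \<comment> \<open>The corners of a cube of side \<open>L\<close>: coordinates of modulus between
      \<open>L\<close> and \<open>2 * L\<close>, with the signs of those of \<open>x\<close>, where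
      \<open>0\<close> counts as positive.\<close>
    define a b where "a = (\<Sum>e\<in>Basis. (if 0 \<le> x \<bullet> e then L else - 2 * L) *\<^sub>R e)"
      and "b = (\<Sum>e\<in>Basis. (if 0 \<le> x \<bullet> e then 2 * L else - L) *\<^sub>R e)"
    have ab: "a \<bullet> e = (if 0 \<le> x \<bullet> e then L else - 2 * L)" "b \<bullet> e = (if 0 \<le> x \<bullet> e then 2 * L else - L)"
      if "e \<in> Basis" for e
      using that by (auto simp: a_def b_def inner_sum_left_Basis)
    define D where "D = cbox a b"
    have [measurable]: "D \<in> sets borel" by (simp add: D_def)
    have "emeasure lborel D = ennreal (\<Prod>e\<in>Basis. (b - a) \<bullet> e)"
      unfolding D_def using ab L_pos by (intro emeasure_lborel_cbox) auto
    also have "(\<Prod>e\<in>Basis. (b - a) \<bullet> e) = (\<Prod>e\<in>(Basis::'a set). L)"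
      by (intro prod.cong) (auto simp: ab inner_diff_left)
    finally have V: "emeasure lborel D = ennreal V" by (simp add: V_def)
    have bnd: "ennreal \<bar>\<phi> x\<bar> \<le> (\<integral>\<^sup>+t. ennreal R * (ennreal (norm (gradient \<phi> (x + t *\<^sub>R y))) * indicator {0..1} t) \<partial>lborel)"
      if y: "y \<in> D" for y
    proof -
      have ye: "a \<bullet> e \<le> y \<bullet> e" "y \<bullet> e \<le> b \<bullet> e" if "e \<in> Basis" for e
        using y that by (auto simp: D_def mem_box)
      have "x + y \<notin> \<Omega>"
      proof (rule far_corner)
        fix e :: 'a assume e: "e \<in> Basis"
        show "L \<le> \<bar>(x + y) \<bullet> e\<bar>"
          using ye[OF e] ab[OF e] by (auto simp: inner_add_left split: if_splits)
      qed
      then have z: "\<phi> (x + y) = 0" using C0_infinity_outside(1)[OF \<phi>] by blast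
      have "norm y \<le> (\<Sum>e\<in>Basis. \<bar>y \<bullet> e\<bar>)" by (rule norm_le_l1)
      also have "\<dots> \<le> (\<Sum>e\<in>(Basis::'a set). 2 * L)"
      proof (rule sum_mono)
        fix e :: 'a assume e: "e \<in> Basis"
        show "\<bar>y \<bullet> e\<bar> \<le> 2 * L" using ye[OF e] ab[OF e] L_pos by (auto split: if_splits)
      qed
      finally have yR: "norm y \<le> R" by (simp add: R_def)
      show ?thesis
        by (rule order_trans[OF C0_infinity_line_bound[OF \<phi> z]], rule nn_integral_mono)
           (use yR RV in \<open>auto simp: indicator_def simp flip: ennreal_mult intro!: ennreal_leI\<close>,
            simp add: mult.commute mult_right_mono)
    qed
    let ?h = "\<lambda>y t. ennreal (norm (gradient \<phi> (x + t *\<^sub>R y)))"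
    have "ennreal (\<bar>\<phi> x\<bar> * V) = (\<integral>\<^sup>+y. ennreal \<bar>\<phi> x\<bar> * indicator D y \<partial>lborel)"
      using RV by (simp add: nn_integral_cmult_indicator V ennreal_mult)
    also have "\<dots> \<le> (\<integral>\<^sup>+y. \<integral>\<^sup>+t. ennreal R * (?h y t * indicator {0..1} t) * indicator D y \<partial>lborel \<partial>lborel)"
      using bnd by (intro nn_integral_mono) (auto simp: indicator_def)
    also have "\<dots> = (\<integral>\<^sup>+t. \<integral>\<^sup>+y. ennreal R * (?h y t * indicator {0..1} t) * indicator D y \<partial>lborel \<partial>lborel)"
      by (rule lborel_pair.Fubini') measurable
    also have "\<dots> \<le> (\<integral>\<^sup>+t. ennreal R * (ennreal (t powr (r - N)) * indicator {0..1} t + ennreal V * (ennreal (t powr (- r / (p - 1))) * indicator {0..1} t)) \<partial>lborel)"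
    proof (rule nn_integral_mono_AE)
      \<comment> \<open>At \<open>t = 0\<close> the point \<open>x + t y\<close> does not depend on
        \<open>y\<close> and the substitution breaks down.\<close>
      have "AE t::real in lborel. t \<noteq> 0" by (rule AE_lborel_singleton)
      then show "AE t in lborel. (\<integral>\<^sup>+y. ennreal R * (?h y t * indicator {0..1} t) * indicator D y \<partial>lborel)
          \<le> ennreal R * (ennreal (t powr (r - N)) * indicator {0..1} t + ennreal V * (ennreal (t powr (- r / (p - 1))) * indicator {0..1} t))"
      proof eventually_elim
        case (elim t)
        show ?case
        proof (cases "t \<in> {0..1}")
          case True
          then have t: "0 < t" "t \<le> 1" using elim by auto
          have "(\<integral>\<^sup>+y. ennreal R * (?h y t * indicator {0..1} t) * indicator D y \<partial>lborel)
             \<le> (\<integral>\<^sup>+y. ennreal R * (ennreal (t powr r) * ennreal (norm (gradient \<phi> (x + t *\<^sub>R y)) powr p) + ennreal (t powr (- r / (p - 1))) * indicator D y) \<partial>lborel)"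
            using True pw[OF t(1), of "norm (gradient \<phi> (x + t *\<^sub>R y))" for y]
            by (intro nn_integral_mono) (auto simp: indicator_def simp flip: ennreal_mult ennreal_plus intro!: mult_left_mono ennreal_leI)
          also have "\<dots> = ennreal R * (ennreal (t powr r) * (\<integral>\<^sup>+y. ennreal (norm (gradient \<phi> (x + t *\<^sub>R y)) powr p) \<partial>lborel) + ennreal (t powr (- r / (p - 1))) * ennreal V)"
            by (subst nn_integral_cmult, measurable, subst nn_integral_add, measurable)
               (simp add: nn_integral_cmult nn_integral_cmult_indicator V)
          also have "(\<integral>\<^sup>+y. ennreal (norm (gradient \<phi> (x + t *\<^sub>R y)) powr p) \<partial>lborel) \<le> ennreal (t powr (- N))"
          proof -
            define J where "J = (\<integral>\<^sup>+y. ennreal (norm (gradient \<phi> (x + t *\<^sub>R y)) powr p) \<partial>lborel)"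
            have "ennreal (t ^ DIM('a)) * J = ennreal (Lp_pow M p (gradient \<phi>))"
              using nn_integral_lborel_affine[of "\<lambda>x. ennreal (norm (gradient \<phi> x) powr p)" t x] t
              by (simp add: nn_integral_gradient_powr[OF \<phi>] J_def)
            also have "\<dots> \<le> 1" using le1 by simp
            finally have "ennreal (t powr (- N)) * (ennreal (t ^ DIM('a)) * J) \<le> ennreal (t powr (- N)) * 1"
              by (rule mult_left_mono) simp
            moreover have "t powr (- N) * t ^ DIM('a) = 1"
              using t by (simp add: N_def powr_minus powr_realpow)
            then have "ennreal (t powr (- N)) * ennreal (t ^ DIM('a)) = 1"
              using t by (simp flip: ennreal_mult)
            then have "ennreal (t powr (- N)) * (ennreal (t ^ DIM('a)) * J) = J"
              by (simp flip: mult.assoc)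
            ultimately show ?thesis by (simp add: J_def)
          qed
          also have "ennreal (t powr r) * ennreal (t powr (- N)) = ennreal (t powr (r - N))"
            using t by (simp flip: ennreal_mult powr_add)
          finally show ?thesis using True
            by (simp add: mult_left_mono mult_right_mono add_right_mono mult.commute)
        qed simp
      qed
    qed
    also have "\<dots> = ennreal R * (ennreal C1 + ennreal V * ennreal C2)"
    proof -
      have 1: "(\<integral>\<^sup>+t. ennreal (t powr (r - N)) * indicator {0..1::real} t \<partial>lborel) = ennreal C1"
        using has_integral_powr_from_0[OF r(1), of 1] by (intro nn_integral_has_integral_lebesgue') (auto simp: C1_def)
      have 2: "(\<integral>\<^sup>+t. ennreal (t powr (- r / (p - 1))) * indicator {0..1::real} t \<partial>lborel) = ennreal C2"
        using has_integral_powr_from_0[OF r(2), of 1] by (intro nn_integral_has_integral_lebesgue') (auto simp: C2_def)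
      show ?thesis
        by (subst nn_integral_cmult, measurable, subst nn_integral_add, measurable, subst nn_integral_cmult, measurable)
           (simp only: 1 2)
    qed
    also have "\<dots> = ennreal (R * (C1 + V * C2))"
      using C RV by (simp flip: ennreal_mult ennreal_plus)
    finally show ?thesis
      using C RV by (subst (asm) ennreal_le_iff) auto
  qed
  show ?thesis
  proof (rule that[of "R * (C1 + V * C2) / V + 1"])
    show "0 < R * (C1 + V * C2) / V + 1" using C RV by (intro add_nonneg_pos divide_nonneg_pos) auto
    fix \<phi> x assume "\<phi> \<in> C0_infinity \<Omega>" "Lp_pow M p (gradient \<phi>) \<le> 1"
    from main[OF this, of x] show "\<bar>\<phi> x\<bar> \<le> R * (C1 + V * C2) / V + 1"
      using RV by (simp add: pos_le_divide_eq add_increasing2)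
  qed
qed

text \<open>Both sides are homogeneous of degree \<open>p\<close>, so the case of energy at most
  \<open>1\<close> is rescaled.\<close>

lemma sup_bound:
  obtains K where "0 < K" "\<And>\<phi> x. \<phi> \<in> C0_infinity \<Omega> \<Longrightarrow> \<bar>\<phi> x\<bar> powr p \<le> K * Lp_pow M p (gradient \<phi>)"
proof -
  obtain K where K: "0 < K" "\<And>\<phi> x. \<phi> \<in> C0_infinity \<Omega> \<Longrightarrow> Lp_pow M p (gradient \<phi>) \<le> 1 \<Longrightarrow> \<bar>\<phi> x\<bar> \<le> K"
    using sup_bound_unit_energy by blast
  have "\<bar>\<phi> x\<bar> powr p \<le> K powr p * Lp_pow M p (gradient \<phi>)" if \<phi>: "\<phi> \<in> C0_infinity \<Omega>" for \<phi> x
  proof -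
    define P where "P = Lp_pow M p (gradient \<phi>)"
    have sc: "Lp_pow M p (gradient (\<lambda>x. c * \<phi> x)) = \<bar>c\<bar> powr p * P" for c
      unfolding P_def gradient_cmult[OF \<phi>] by (rule Lp_pow_scaleR)
    have b: "\<bar>c * \<phi> x\<bar> \<le> K" if "\<bar>c\<bar> powr p * P \<le> 1" for c
      using K(2)[OF C0_infinity_cmult[OF \<phi>], of c x] sc[of c] that by simp
    show ?thesis
    proof (cases "P = 0")
      case True
      have "\<phi> x = 0"
      proof (rule ccontr)
        assume "\<phi> x \<noteq> 0"
        \<comment> \<open>With zero energy every multiple is admissible; this one takes the value
          \<open>K + 1\<close> at \<open>x\<close>.\<close>
        then show False using b[of "(K + 1) / \<phi> x"] True K(1) by simp
      qed
      then show ?thesis using True by (simp add: P_def[symmetric])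
    next
      case False
      then have P: "0 < P" using Lp_pow_nonneg[of M p "gradient \<phi>"] by (simp add: P_def)
      define c where "c = P powr (- 1 / p)"
      have "c powr p = P powr (- 1 / p * p)" by (simp only: c_def powr_powr)
      then have c: "0 < c" "c powr p = 1 / P" using P p_gt_1 by (simp_all add: powr_minus_divide) (simp add: c_def)
      have "\<bar>c * \<phi> x\<bar> \<le> K" using c P by (intro b) simp
      then have "\<bar>c * \<phi> x\<bar> powr p \<le> K powr p" using p_gt_1 by (intro powr_mono2) auto
      then show ?thesis using c P by (simp add: abs_mult powr_mult P_def[symmetric] field_simps)
    qed
  qed
  then show ?thesis using that[of "K powr p"] K(1) by auto
qed

end

section \<open>Continuous representatives\<close>

text \<open>Rests on the completeness of Lebesgue measure. It serves for functions known only up to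
  null sets, such as the chosen \<open>weak_gradient\<close>.\<close>

lemma borel_measurable_lebesgue_on_AE:
  fixes f g :: "'a::euclidean_space \<Rightarrow> 'b::euclidean_space"
  assumes S: "S \<in> sets lebesgue" and f: "f \<in> borel_measurable (lebesgue_on S)" and ae: "AE x in lebesgue_on S. f x = g x"
  shows "g \<in> borel_measurable (lebesgue_on S)"
proof -
  have "(\<lambda>x. if x \<in> S then f x else 0) \<in> borel_measurable lebesgue"
    using f S by (simp add: borel_measurable_if)
  moreover have "AE x in lebesgue. (if x \<in> S then f x else 0) = (if x \<in> S then g x else 0)"
    using ae S by (auto simp: AE_restrict_space_iff elim!: eventually_mono)
  ultimately have "(\<lambda>x. if x \<in> S then g x else 0) \<in> borel_measurable lebesgue"
    by (rule borel_measurable_AE)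
  then show ?thesis using S by (simp add: borel_measurable_if)
qed

lemma AE_eq_0_if_Lp_pow_eq_0:
  assumes "in_Lp M p f" "Lp_pow M p f = 0"
  shows "AE x in M. f x = 0"
proof -
  have "AE x in M. norm (f x) powr p = 0"
    using assms integral_nonneg_eq_0_iff_AE[of M "\<lambda>x. norm (f x) powr p"]
    by (auto simp: in_Lp_def Lp_pow_def)
  then show ?thesis by eventually_elim simp
qed

text \<open>Splits at the threshold \<open>\<epsilon>\<close>: on a set of finite measure a first
  order integral is bounded by a small term plus a multiple of the integral of the
  \<open>p\<close>-th power.\<close>

lemma le_add_powr:
  fixes a \<epsilon> :: real
  assumes "1 \<le> p" "0 < \<epsilon>" "0 \<le> a"
  shows "a \<le> \<epsilon> + \<epsilon> powr (1 - p) * a powr p"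
proof (cases "a \<le> \<epsilon>")
  case False
  then have "a powr (1 - p) \<le> \<epsilon> powr (1 - p)" using assms by (intro powr_mono2') auto
  then have "a powr (1 - p) * a powr p \<le> \<epsilon> powr (1 - p) * a powr p" by (rule mult_right_mono) simp
  moreover have "a powr (1 - p) * a powr p = a" using False assms by (simp flip: powr_add)
  ultimately show ?thesis using assms by simp
qed (simp add: add_increasing2)

lemma Lp_space_iff: "u \<in> Lp_space \<Omega> (ereal p) \<longleftrightarrow> in_Lp (lebesgue_on \<Omega>) p u"
  by (simp add: Lp_space_def in_Lp_def)

lemma Lp_norm_eq: "Lp_norm \<Omega> (ereal p) u = Lp_pow (lebesgue_on \<Omega>) p u powr (1 / p)"
  by (simp add: Lp_norm_def Lp_pow_def)

lemma in_Lp_locally_integrable: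
  assumes p: "1 \<le> p" and \<Omega>: "\<Omega> \<in> sets lebesgue" and f: "in_Lp (lebesgue_on \<Omega>) p f"
  shows "locally_integrable \<Omega> f"
  unfolding locally_integrable_def
proof (intro allI impI)
  fix K assume K: "compact K \<and> K \<subseteq> \<Omega>"
  then have Ki: "integrable lborel (indicat_real K)"
    using emeasure_compact_finite[of K] by (auto simp: compact_imp_closed)
  have "integrable (lebesgue_on \<Omega>) (\<lambda>x. indicator K x *\<^sub>R f x)"
  proof (rule Bochner_Integration.integrable_bound)
    show "integrable (lebesgue_on \<Omega>) (\<lambda>x. indicat_real K x + norm (f x) powr p)"
      using integrable_lebesgue_onI[OF \<Omega> Ki] f by (intro Bochner_Integration.integrable_add) (auto simp: in_Lp_def)
    have "indicat_real K \<in> borel_measurable (lebesgue_on \<Omega>)"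
      using K by (intro borel_measurable_lebesgue_onI) (auto simp: compact_imp_closed)
    then show "(\<lambda>x. indicator K x *\<^sub>R f x) \<in> borel_measurable (lebesgue_on \<Omega>)"
      using f by (intro borel_measurable_scaleR) (auto simp: in_Lp_def)
    have "norm (f x) \<le> 1 + norm (f x) powr p" for x
      using le_add_powr[of p 1 "norm (f x)"] p by simp
    then show "AE x in lebesgue_on \<Omega>. norm (indicator K x *\<^sub>R f x) \<le> norm (indicat_real K x + norm (f x) powr p)"
      by (intro AE_I2) (auto simp: indicator_def)
  qed
  then have "integrable lebesgue (\<lambda>x. indicator \<Omega> x *\<^sub>R (indicator K x *\<^sub>R f x))"
    using \<Omega> by (subst (asm) integrable_restrict_space) auto
  also have "(\<lambda>x. indicator \<Omega> x *\<^sub>R (indicator K x *\<^sub>R f x)) = (\<lambda>x. indicator K x *\<^sub>R f x)"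
    using K by (auto simp: fun_eq_iff indicator_def)
  finally show "set_integrable lebesgue K f" by (simp add: set_integrable_def)
qed

text \<open>The weight \<open>h\<close> is merely continuous, so that test functions and their
  partial derivatives are both covered. The vector \<open>e\<close> selects a component; for scalar
  functions it is the number \<open>1\<close>.\<close>

lemma integral_times_test_tendsto:
  fixes f :: "nat \<Rightarrow> 'a::euclidean_space \<Rightarrow> 'b::euclidean_space"
  assumes p: "1 \<le> p" and \<Omega>: "\<Omega> \<in> sets lebesgue"
    and f: "\<And>k. in_Lp (lebesgue_on \<Omega>) p (f k)" and g: "in_Lp (lebesgue_on \<Omega>) p g"
    and lim: "(\<lambda>k. Lp_pow (lebesgue_on \<Omega>) p (\<lambda>x. f k x - g x)) \<longlonglongrightarrow> 0"
    and h: "continuous_on UNIV h" "compact K" "K \<subseteq> \<Omega>" "\<And>x. x \<notin> K \<Longrightarrow> h x = 0" and e: "norm e \<le> 1"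
  shows "(\<lambda>k. LINT x|lebesgue_on \<Omega>. (f k x \<bullet> e) * h x) \<longlonglongrightarrow> (LINT x|lebesgue_on \<Omega>. (g x \<bullet> e) * h x)"
proof (rule LIMSEQ_I)
  fix \<eta> :: real assume \<eta>: "0 < \<eta>"
  let ?M = "lebesgue_on \<Omega>"
  obtain B where B: "0 \<le> B" "\<And>x. norm (h x) \<le> B" using bounded_compact_support[OF h(1,2,4)] by blast
  have Ki: "integrable ?M (indicat_real K)"
    using h emeasure_compact_finite[of K] by (intro integrable_lebesgue_onI[OF \<Omega>]) (auto simp: compact_imp_closed)
  define m where "m = (LINT x|?M. indicat_real K x)"
  have m: "0 \<le> m" by (simp add: m_def)
  \<comment> \<open>Chosen so that \<open>B * (\<epsilon> * m)\<close> stays below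
    \<open>\<eta> / 2\<close>; the summand \<open>1\<close> keeps the denominator positive.\<close>
  define \<epsilon> where "\<epsilon> = \<eta> / (2 * (B * m + 1))"
  have \<epsilon>: "0 < \<epsilon>" "B * (\<epsilon> * m) < \<eta>/2 + \<epsilon> * 0"
  proof -
    show "0 < \<epsilon>" using \<eta> B m by (auto simp: \<epsilon>_def intro!: divide_pos_pos add_nonneg_pos)
    have "0 < B * m + 1" using B m by (simp add: add_nonneg_pos)
    then have "\<epsilon> * (B * m + 1) = \<eta> / 2" by (simp add: \<epsilon>_def nonzero_eq_divide_eq del: distrib_left_numeral)
    then show "B * (\<epsilon> * m) < \<eta>/2 + \<epsilon> * 0" using \<open>0 < \<epsilon>\<close> by (simp add: algebra_simps)
  qed
  have "(\<lambda>k. B * (\<epsilon> powr (1 - p) * Lp_pow ?M p (\<lambda>x. f k x - g x))) \<longlonglongrightarrow> B * (\<epsilon> powr (1 - p) * 0)"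
    by (intro tendsto_intros lim)
  then have "eventually (\<lambda>k. B * (\<epsilon> powr (1 - p) * Lp_pow ?M p (\<lambda>x. f k x - g x)) < \<eta> / 2) sequentially"
    using \<eta> by (intro order_tendstoD(2)) auto
  then obtain N where N: "\<And>k. N \<le> k \<Longrightarrow> B * (\<epsilon> powr (1 - p) * Lp_pow ?M p (\<lambda>x. f k x - g x)) < \<eta> / 2"
    unfolding eventually_sequentially by blast
  have int: "integrable ?M (\<lambda>x. (k x \<bullet> e) * h x)" if "in_Lp ?M p k" for k :: "'a \<Rightarrow> 'b"
  proof -
    have "integrable ?M (\<lambda>x. (h x *\<^sub>R k x) \<bullet> e)"
      using locally_integrable_times_continuous[OF \<Omega> in_Lp_locally_integrable[OF p \<Omega> that] h(2,3,1,4)]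
      by (intro integrable_inner_left) auto
    then show ?thesis by (simp add: mult.commute)
  qed
  have "norm ((LINT x|?M. (f k x \<bullet> e) * h x) - (LINT x|?M. (g x \<bullet> e) * h x)) < \<eta>" if k: "N \<le> k" for k
  proof -
    have d: "in_Lp ?M p (\<lambda>x. f k x - g x)" using f g p by (intro in_Lp_diff) auto
    have "norm ((LINT x|?M. (f k x \<bullet> e) * h x) - (LINT x|?M. (g x \<bullet> e) * h x))
        = norm (LINT x|?M. ((f k x - g x) \<bullet> e) * h x)"
      using int[OF f] int[OF g] by (simp add: inner_diff_left left_diff_distrib)
    also have "\<dots> \<le> (LINT x|?M. B * (\<epsilon> * indicat_real K x + \<epsilon> powr (1 - p) * norm (f k x - g x) powr p))"
    proof (rule order_trans[OF integral_norm_bound], rule integral_mono)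
      show "integrable ?M (\<lambda>x. norm (((f k x - g x) \<bullet> e) * h x))" using int[OF d] by (rule integrable_norm)
      show "integrable ?M (\<lambda>x. B * (\<epsilon> * indicat_real K x + \<epsilon> powr (1 - p) * norm (f k x - g x) powr p))"
        using Ki in_Lp_integrable[OF d] by auto
      fix x
      have 1: "\<bar>(f k x - g x) \<bullet> e\<bar> \<le> norm (f k x - g x)"
        using Cauchy_Schwarz_ineq2[of "f k x - g x" e] e mult_left_le[of "norm e" "norm (f k x - g x)"] by auto
      have 2: "norm (f k x - g x) \<le> \<epsilon> + \<epsilon> powr (1 - p) * norm (f k x - g x) powr p"
        using p \<epsilon> by (intro le_add_powr) auto
      show "norm (((f k x - g x) \<bullet> e) * h x) \<le> B * (\<epsilon> * indicat_real K x + \<epsilon> powr (1 - p) * norm (f k x - g x) powr p)"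
      proof (cases "x \<in> K")
        case True
        have "norm (((f k x - g x) \<bullet> e) * h x) \<le> (\<epsilon> + \<epsilon> powr (1 - p) * norm (f k x - g x) powr p) * B"
          unfolding norm_mult using 1 2 B(2)[of x] B(1) \<epsilon>(1) by (intro mult_mono) auto
        then show ?thesis using True by (simp add: mult.commute)
      next
        case False
        then show ?thesis using h(4) B by simp
      qed
    qed
    also have "\<dots> = B * (\<epsilon> * m) + B * (\<epsilon> powr (1 - p) * Lp_pow ?M p (\<lambda>x. f k x - g x))"
      using Ki in_Lp_integrable[OF d] by (simp add: m_def Lp_pow_def distrib_left)
    also have "\<dots> < \<eta>" using N[OF k] \<epsilon> by simp
    finally show ?thesis .
  qed
  then show "\<exists>N. \<forall>k\<ge>N. norm ((LINT x|?M. (f k x \<bullet> e) * h x) - (LINT x|?M. (g x \<bullet> e) * h x)) < \<eta>" by blast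
qed

lemma locally_integrable_diff:
  assumes "locally_integrable \<Omega> f" "locally_integrable \<Omega> g"
  shows "locally_integrable \<Omega> (\<lambda>x. f x - g x)"
  using assms unfolding locally_integrable_def by (intro allI impI set_integral_diff) auto

lemma has_weak_gradient_diff:
  assumes \<Omega>: "open \<Omega>" and u: "has_weak_gradient \<Omega> u g" and v: "has_weak_gradient \<Omega> v h"
  shows "has_weak_gradient \<Omega> (\<lambda>x. u x - v x) (\<lambda>x. g x - h x)"
proof -
  have l: "locally_integrable \<Omega> u" "locally_integrable \<Omega> v" "locally_integrable \<Omega> g" "locally_integrable \<Omega> h"
    using u v by (auto simp: has_weak_gradient_def)
  have "(LINT x|lebesgue_on \<Omega>. (u x - v x) * partial_deriv e \<phi> x) = - (LINT x|lebesgue_on \<Omega>. ((g x - h x) \<bullet> e) * \<phi> x)"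
    if \<phi>: "\<phi> \<in> C0_infinity \<Omega>" and e: "e \<in> Basis" for \<phi> e
  proof -
    obtain K where K: "compact K" "K \<subseteq> \<Omega>" "\<And>x. x \<notin> K \<Longrightarrow> \<phi> x = 0" "\<And>x. x \<notin> K \<Longrightarrow> partial_deriv e \<phi> x = 0"
      using C0_infinity_support[OF \<phi>] by metis
    have 1: "integrable (lebesgue_on \<Omega>) (\<lambda>x. k x * partial_deriv e \<phi> x)" if "locally_integrable \<Omega> k" for k :: "'a \<Rightarrow> real"
      using locally_integrable_times_continuous[OF _ that K(1,2) C0_infinity_partial_continuous[OF \<phi> e] K(4)] \<Omega>
      by (simp add: mult.commute)
    have 2: "integrable (lebesgue_on \<Omega>) (\<lambda>x. (k x \<bullet> e) * \<phi> x)" if "locally_integrable \<Omega> k" for k :: "'a \<Rightarrow> 'a"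
    proof -
      have "integrable (lebesgue_on \<Omega>) (\<lambda>x. (\<phi> x *\<^sub>R k x) \<bullet> e)"
        using locally_integrable_times_continuous[OF _ that K(1,2) C0_infinity_continuous[OF \<phi>] K(3)] \<Omega>
        by (intro integrable_inner_left) auto
      then show ?thesis by (simp add: mult.commute)
    qed
    have "(LINT x|lebesgue_on \<Omega>. u x * partial_deriv e \<phi> x) = - (LINT x|lebesgue_on \<Omega>. (g x \<bullet> e) * \<phi> x)"
      "(LINT x|lebesgue_on \<Omega>. v x * partial_deriv e \<phi> x) = - (LINT x|lebesgue_on \<Omega>. (h x \<bullet> e) * \<phi> x)"
      using u v \<phi> e unfolding has_weak_gradient_def by blast+
    then show ?thesis
      using 1[OF l(1)] 1[OF l(2)] 2[OF l(3)] 2[OF l(4)] by (simp add: left_diff_distrib inner_diff_left)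
  qed
  then show ?thesis using l unfolding has_weak_gradient_def by (auto intro: locally_integrable_diff)
qed

context sobolev_domain
begin

text \<open>A function in \<open>W\<^sub>0\<^sup>1\<^sup>,\<^sup>p\<close> is handled through its continuous representative \<open>U\<close>, which vanishes
  outside the domain, together with its gradient \<open>G\<close>.\<close>

definition sobolev_pair :: "('a \<Rightarrow> real) \<Rightarrow> ('a \<Rightarrow> 'a) \<Rightarrow> bool" where
  "sobolev_pair U G \<longleftrightarrow> in_Lp M p G \<and> (\<exists>\<phi>. (\<forall>k. \<phi> k \<in> C0_infinity \<Omega>) \<and>
     uniform_limit UNIV \<phi> U sequentially \<and> (\<lambda>k. Lp_pow M p (\<lambda>x. gradient (\<phi> k) x - G x)) \<longlonglongrightarrow> 0)"

lemma p_simps: "0 < p" "0 \<le> p" "1 \<le> p" "p \<noteq> 0"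
  using p_gt_1 by auto

lemma sobolev_pair_in_Lp: "sobolev_pair U G \<Longrightarrow> in_Lp M p G"
  by (simp add: sobolev_pair_def)

lemma C0_in_Lp: "\<phi> \<in> C0_infinity \<Omega> \<Longrightarrow> in_Lp M p \<phi>" "\<phi> \<in> C0_infinity \<Omega> \<Longrightarrow> in_Lp M p (gradient \<phi>)"
  using C0_infinity_in_Lp[OF _ p_simps(1) dom_sets] by auto

lemma sobolev_pair_continuous: "sobolev_pair U G \<Longrightarrow> continuous_on UNIV U"
  unfolding sobolev_pair_def
  by (elim conjE exE, rule uniform_limit_theorem[OF always_eventually])
     (auto intro: C0_infinity_continuous)

lemma sobolev_pair_measurable: "sobolev_pair U G \<Longrightarrow> U \<in> borel_measurable M"
  by (intro borel_measurable_lebesgue_onI borel_measurable_continuous_onI sobolev_pair_continuous)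

lemma sobolev_pair_outside:
  assumes "sobolev_pair U G" "x \<notin> \<Omega>"
  shows "U x = 0"
proof -
  obtain \<phi> where \<phi>: "\<And>k. \<phi> k \<in> C0_infinity \<Omega>" "uniform_limit UNIV \<phi> U sequentially"
    using assms by (auto simp: sobolev_pair_def)
  have "(\<lambda>k. \<phi> k x) \<longlonglongrightarrow> U x" using \<phi>(2) by (rule tendsto_uniform_limitI) simp
  moreover have "(\<lambda>k. \<phi> k x) = (\<lambda>k. 0)" using C0_infinity_outside(1)[OF \<phi>(1) assms(2)] by auto
  ultimately show ?thesis by (simp add: LIMSEQ_const_iff)
qed

lemma sobolev_pair_C0: "\<phi> \<in> C0_infinity \<Omega> \<Longrightarrow> sobolev_pair \<phi> (gradient \<phi>)"
  unfolding sobolev_pair_def using C0_in_Lp p_simps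
  by (auto intro!: exI[of _ "\<lambda>k. \<phi>"] uniform_limit_const simp: Lp_pow_def)

lemma sobolev_pair_lincomb:
  assumes U: "sobolev_pair U G" and V: "sobolev_pair V H"
  shows "sobolev_pair (\<lambda>x. a * U x + b * V x) (\<lambda>x. a *\<^sub>R G x + b *\<^sub>R H x)"
proof -
  obtain \<phi> where \<phi>: "\<And>k. \<phi> k \<in> C0_infinity \<Omega>" "uniform_limit UNIV \<phi> U sequentially"
      "(\<lambda>k. Lp_pow M p (\<lambda>x. gradient (\<phi> k) x - G x)) \<longlonglongrightarrow> 0"
    using U by (auto simp: sobolev_pair_def)
  obtain \<psi> where \<psi>: "\<And>k. \<psi> k \<in> C0_infinity \<Omega>" "uniform_limit UNIV \<psi> V sequentially"
      "(\<lambda>k. Lp_pow M p (\<lambda>x. gradient (\<psi> k) x - H x)) \<longlonglongrightarrow> 0"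
    using V by (auto simp: sobolev_pair_def)
  have G: "in_Lp M p G" "in_Lp M p H" using U V by (auto simp: sobolev_pair_def)
  let ?\<chi> = "\<lambda>k x. a * \<phi> k x + b * \<psi> k x"
  have g: "gradient (?\<chi> k) x = a *\<^sub>R gradient (\<phi> k) x + b *\<^sub>R gradient (\<psi> k) x" for k x
    using gradient_add[OF C0_infinity_cmult[OF \<phi>(1)] C0_infinity_cmult[OF \<psi>(1)]]
      gradient_cmult[OF \<phi>(1)] gradient_cmult[OF \<psi>(1)] by simp
  have "(\<lambda>k. Lp_pow M p (\<lambda>x. gradient (?\<chi> k) x - (a *\<^sub>R G x + b *\<^sub>R H x))) \<longlonglongrightarrow> 0"
  proof (rule tendsto_sandwich[OF _ _ tendsto_const])
    have "Lp_pow M p (\<lambda>x. gradient (?\<chi> k) x - (a *\<^sub>R G x + b *\<^sub>R H x))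
        \<le> 2 powr p * (\<bar>a\<bar> powr p * Lp_pow M p (\<lambda>x. gradient (\<phi> k) x - G x) + \<bar>b\<bar> powr p * Lp_pow M p (\<lambda>x. gradient (\<psi> k) x - H x))" for k
    proof -
      have i: "in_Lp M p (\<lambda>x. a *\<^sub>R (gradient (\<phi> k) x - G x))" "in_Lp M p (\<lambda>x. b *\<^sub>R (gradient (\<psi> k) x - H x))"
        using C0_in_Lp(2)[OF \<phi>(1)] C0_in_Lp(2)[OF \<psi>(1)] G p_simps by (auto intro!: in_Lp_scaleR in_Lp_diff)
      have "gradient (?\<chi> k) x - (a *\<^sub>R G x + b *\<^sub>R H x) = a *\<^sub>R (gradient (\<phi> k) x - G x) + b *\<^sub>R (gradient (\<psi> k) x - H x)" for x
        unfolding g by (simp add: algebra_simps)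
      then show ?thesis using Lp_pow_add_le[OF p_simps(2) i] by (simp add: Lp_pow_scaleR)
    qed
    then show "eventually (\<lambda>k. Lp_pow M p (\<lambda>x. gradient (?\<chi> k) x - (a *\<^sub>R G x + b *\<^sub>R H x))
        \<le> 2 powr p * (\<bar>a\<bar> powr p * Lp_pow M p (\<lambda>x. gradient (\<phi> k) x - G x) + \<bar>b\<bar> powr p * Lp_pow M p (\<lambda>x. gradient (\<psi> k) x - H x))) sequentially"
      by (intro always_eventually allI)
    show "(\<lambda>k. 2 powr p * (\<bar>a\<bar> powr p * Lp_pow M p (\<lambda>x. gradient (\<phi> k) x - G x) + \<bar>b\<bar> powr p * Lp_pow M p (\<lambda>x. gradient (\<psi> k) x - H x))) \<longlonglongrightarrow> 0"
      using \<phi>(3) \<psi>(3) by (auto intro!: tendsto_eq_intros)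
  qed (simp add: Lp_pow_nonneg)
  moreover have "uniform_limit UNIV ?\<chi> (\<lambda>x. a * U x + b * V x) sequentially"
    using \<phi>(2) \<psi>(2) by (intro uniform_limit_add bounded_linear.uniform_limit[OF bounded_linear_mult_right]) auto
  moreover have "?\<chi> k \<in> C0_infinity \<Omega>" for k
    using \<phi>(1) \<psi>(1) by (intro C0_infinity_add C0_infinity_cmult)
  moreover have "in_Lp M p (\<lambda>x. a *\<^sub>R G x + b *\<^sub>R H x)"
    using G p_simps by (intro in_Lp_add in_Lp_scaleR)
  ultimately show ?thesis unfolding sobolev_pair_def by (intro conjI exI[of _ ?\<chi>] allI)
qed

lemma sobolev_pair_diff:
  "sobolev_pair U G \<Longrightarrow> sobolev_pair V H \<Longrightarrow> sobolev_pair (\<lambda>x. U x - V x) (\<lambda>x. G x - H x)"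
  using sobolev_pair_lincomb[of U G V H 1 "-1"] by simp

definition sup_const :: real where
  "sup_const = (SOME K. 0 < K \<and> (\<forall>\<phi>\<in>C0_infinity \<Omega>. \<forall>x. \<bar>\<phi> x\<bar> powr p \<le> K * Lp_pow M p (gradient \<phi>)))"

lemma sup_const: "0 < sup_const" "\<phi> \<in> C0_infinity \<Omega> \<Longrightarrow> \<bar>\<phi> x\<bar> powr p \<le> sup_const * Lp_pow M p (gradient \<phi>)"
proof -
  have "\<exists>K. 0 < K \<and> (\<forall>\<phi>\<in>C0_infinity \<Omega>. \<forall>x. \<bar>\<phi> x\<bar> powr p \<le> K * Lp_pow M p (gradient \<phi>))"
    using sup_bound by metis
  from someI_ex[OF this] show "0 < sup_const"
    "\<phi> \<in> C0_infinity \<Omega> \<Longrightarrow> \<bar>\<phi> x\<bar> powr p \<le> sup_const * Lp_pow M p (gradient \<phi>)"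
    unfolding sup_const_def by blast+
qed

lemma sobolev_pair_approx:
  assumes "sobolev_pair U G"
  obtains \<phi> where "\<And>k. \<phi> k \<in> C0_infinity \<Omega>" "uniform_limit UNIV \<phi> U sequentially"
    "(\<lambda>k. Lp_pow M p (\<lambda>x. gradient (\<phi> k) x - G x)) \<longlonglongrightarrow> 0"
    "(\<lambda>k. Lp_pow M p (gradient (\<phi> k))) \<longlonglongrightarrow> Lp_pow M p G"
proof -
  obtain \<phi> where \<phi>: "\<And>k. \<phi> k \<in> C0_infinity \<Omega>" "uniform_limit UNIV \<phi> U sequentially"
      "(\<lambda>k. Lp_pow M p (\<lambda>x. gradient (\<phi> k) x - G x)) \<longlonglongrightarrow> 0"
    using assms by (auto simp: sobolev_pair_def)
  moreover have "(\<lambda>k. Lp_pow M p (gradient (\<phi> k))) \<longlonglongrightarrow> Lp_pow M p G"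
    using \<phi> C0_in_Lp p_simps sobolev_pair_in_Lp[OF assms] by (intro Lp_pow_tendsto) auto
  ultimately show ?thesis using that by blast
qed

text \<open>Both constants are kept free: with \<open>C = 1\<close> the sup bound is carried over,
  with \<open>K = 1\<close> the bound by the sharp constant.\<close>

lemma sobolev_pair_pointwise_bound:
  assumes C: "\<And>\<phi>. \<phi> \<in> C0_infinity \<Omega> \<Longrightarrow> C * \<bar>\<phi> x\<bar> powr p \<le> K * Lp_pow M p (gradient \<phi>)"
    and U: "sobolev_pair U G"
  shows "C * \<bar>U x\<bar> powr p \<le> K * Lp_pow M p G"
proof -
  obtain \<phi> where \<phi>: "\<And>k. \<phi> k \<in> C0_infinity \<Omega>" "uniform_limit UNIV \<phi> U sequentially"
      "(\<lambda>k. Lp_pow M p (gradient (\<phi> k))) \<longlonglongrightarrow> Lp_pow M p G"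
    using sobolev_pair_approx[OF U] by metis
  have "(\<lambda>k. \<phi> k x) \<longlonglongrightarrow> U x" using \<phi>(2) by (rule tendsto_uniform_limitI) simp
  then have "(\<lambda>k. C * \<bar>\<phi> k x\<bar> powr p) \<longlonglongrightarrow> C * \<bar>U x\<bar> powr p"
    using p_simps by (intro tendsto_mult tendsto_const tendsto_powr' tendsto_rabs) auto
  moreover have "(\<lambda>k. K * Lp_pow M p (gradient (\<phi> k))) \<longlonglongrightarrow> K * Lp_pow M p G"
    by (intro tendsto_intros \<phi>(3))
  ultimately show ?thesis using C[OF \<phi>(1)] by (intro LIMSEQ_le) auto
qed

lemma sobolev_pair_sup: "sobolev_pair U G \<Longrightarrow> \<bar>U x\<bar> powr p \<le> sup_const * Lp_pow M p G"
  using sobolev_pair_pointwise_bound[of 1 x sup_const U G] sup_const(2) by simp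

text \<open>Fatou's lemma transfers the bound from test functions. Their energies only converge, so
  it is applied to a tail of the sequence and with a slack \<open>\<epsilon>\<close>.\<close>

lemma sobolev_pair_poincare:
  assumes U: "sobolev_pair U G"
  shows "in_Lp M p U" "Lp_pow M p U \<le> poincare_const * Lp_pow M p G"
proof -
  obtain \<phi> where \<phi>: "\<And>k. \<phi> k \<in> C0_infinity \<Omega>" "uniform_limit UNIV \<phi> U sequentially"
      "(\<lambda>k. Lp_pow M p (gradient (\<phi> k))) \<longlonglongrightarrow> Lp_pow M p G"
    using sobolev_pair_approx[OF U] by metis
  have *: "in_Lp M p U \<and> Lp_pow M p U \<le> poincare_const * Lp_pow M p G + \<epsilon>" if "0 < \<epsilon>" for \<epsilon>
  proof -
    have "(\<lambda>k. poincare_const * Lp_pow M p (gradient (\<phi> k))) \<longlonglongrightarrow> poincare_const * Lp_pow M p G"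
      by (intro tendsto_intros \<phi>(3))
    then have "eventually (\<lambda>k. poincare_const * Lp_pow M p (gradient (\<phi> k)) < poincare_const * Lp_pow M p G + \<epsilon>) sequentially"
      using that by (intro order_tendstoD(2)) auto
    then obtain N where N: "\<And>k. N \<le> k \<Longrightarrow> poincare_const * Lp_pow M p (gradient (\<phi> k)) < poincare_const * Lp_pow M p G + \<epsilon>"
      unfolding eventually_sequentially by blast
    have le: "Lp_pow M p (\<phi> (k + N)) \<le> poincare_const * Lp_pow M p G + \<epsilon>" for k
      using poincare_C0[OF \<phi>(1), of "k + N"] N[of "k + N"] by linarith
    have "(\<lambda>k. \<phi> k x) \<longlonglongrightarrow> U x" for x using \<phi>(2) by (rule tendsto_uniform_limitI) simp
    then have "AE x in M. (\<lambda>k. \<phi> (k + N) x) \<longlonglongrightarrow> U x"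
      by (intro AE_I2 LIMSEQ_ignore_initial_segment)
    then show ?thesis
      using Lp_pow_Fatou[where f = "\<lambda>k. \<phi> (k + N)", OF p_simps(1) C0_in_Lp(1)[OF \<phi>(1)] sobolev_pair_measurable[OF U] _ le]
      by blast
  qed
  show "in_Lp M p U" using *[of 1] by simp
  show "Lp_pow M p U \<le> poincare_const * Lp_pow M p G"
    by (rule field_le_epsilon) (use * in blast)
qed

lemma poincare_const_pos: "0 < poincare_const"
  using L_pos by (simp add: poincare_const_def)

text \<open>The sup bound is applied to the difference. The filter is arbitrary because sequences
  and \<open>q\<close> tending to infinity both occur.\<close>

lemma sobolev_pair_uniform_limit:
  assumes "eventually (\<lambda>i. sobolev_pair (U i) (G i)) F" "sobolev_pair V H"
    and lim: "((\<lambda>i. Lp_pow M p (\<lambda>x. G i x - H x)) \<longlongrightarrow> 0) F"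
  shows "uniform_limit UNIV U V F"
proof (rule uniform_limitI)
  fix e :: real assume e: "0 < e"
  have "((\<lambda>i. sup_const * Lp_pow M p (\<lambda>x. G i x - H x)) \<longlongrightarrow> sup_const * 0) F" by (intro tendsto_intros lim)
  then have "eventually (\<lambda>i. sup_const * Lp_pow M p (\<lambda>x. G i x - H x) < e powr p) F"
    using e by (intro order_tendstoD(2)) auto
  then show "eventually (\<lambda>i. \<forall>x\<in>UNIV. dist (U i x) (V x) < e) F" using assms(1)
  proof eventually_elim
    case (elim i)
    show ?case
    proof
      fix x
      have "\<bar>U i x - V x\<bar> powr p < e powr p"
        using sobolev_pair_sup[OF sobolev_pair_diff[OF elim(2) assms(2)], of x] elim(1) by simp
      then have "\<bar>U i x - V x\<bar> < e"
        using e p_simps by (metis abs_ge_zero less_le_not_le linorder_not_less powr_mono2)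
      then show "dist (U i x) (V x) < e" by (simp add: dist_real_def)
    qed
  qed
qed

lemma sobolev_pair_complete:
  fixes U :: "nat \<Rightarrow> 'a \<Rightarrow> real"
  assumes U: "\<And>n. sobolev_pair (U n) (G n)"
    and cauchy: "\<And>\<epsilon>. 0 < \<epsilon> \<Longrightarrow> \<exists>N. \<forall>m\<ge>N. \<forall>n\<ge>N. Lp_pow M p (\<lambda>x. G m x - G n x) < \<epsilon>"
  obtains V H where "sobolev_pair V H" "(\<lambda>n. Lp_pow M p (\<lambda>x. G n x - H x)) \<longlonglongrightarrow> 0"
proof -
  have G: "in_Lp M p (G n)" for n by (rule sobolev_pair_in_Lp[OF U])
  obtain H where H: "in_Lp M p H" "(\<lambda>n. Lp_pow M p (\<lambda>x. G n x - H x)) \<longlonglongrightarrow> 0"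
    using in_Lp_complete[OF p_simps(1) G cauchy] by blast
  \<comment> \<open>Diagonal choice: one test function for each \<open>n\<close>, close to
    \<open>U n\<close> both uniformly and in energy.\<close>
  have "\<exists>\<psi>\<in>C0_infinity \<Omega>. (\<forall>x. \<bar>\<psi> x - U n x\<bar> < 1 / real (Suc n)) \<and> Lp_pow M p (\<lambda>x. gradient \<psi> x - G n x) < 1 / real (Suc n)" for n
  proof -
    obtain \<phi> where \<phi>: "\<And>k. \<phi> k \<in> C0_infinity \<Omega>" "uniform_limit UNIV \<phi> (U n) sequentially"
      "(\<lambda>k. Lp_pow M p (\<lambda>x. gradient (\<phi> k) x - G n x)) \<longlonglongrightarrow> 0"
      using U[of n] by (auto simp: sobolev_pair_def)
    have "eventually (\<lambda>k. \<forall>x\<in>UNIV. dist (\<phi> k x) (U n x) < 1 / real (Suc n)) sequentially"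
      using \<phi>(2) by (rule uniform_limitD) simp
    moreover have "eventually (\<lambda>k. Lp_pow M p (\<lambda>x. gradient (\<phi> k) x - G n x) < 1 / real (Suc n)) sequentially"
      using \<phi>(3) by (rule order_tendstoD(2)) simp
    ultimately have "eventually (\<lambda>k. (\<forall>x. \<bar>\<phi> k x - U n x\<bar> < 1 / real (Suc n)) \<and> Lp_pow M p (\<lambda>x. gradient (\<phi> k) x - G n x) < 1 / real (Suc n)) sequentially"
      by eventually_elim (simp add: dist_real_def)
    then obtain k where "(\<forall>x. \<bar>\<phi> k x - U n x\<bar> < 1 / real (Suc n)) \<and> Lp_pow M p (\<lambda>x. gradient (\<phi> k) x - G n x) < 1 / real (Suc n)"
      using eventually_happens by fastforce
    then show ?thesis using \<phi>(1) by blast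
  qed
  then obtain \<psi> where \<psi>: "\<And>n. \<psi> n \<in> C0_infinity \<Omega>" "\<And>n x. \<bar>\<psi> n x - U n x\<bar> < 1 / real (Suc n)"
      "\<And>n. Lp_pow M p (\<lambda>x. gradient (\<psi> n) x - G n x) < 1 / real (Suc n)"
    by metis
  have "uniformly_Cauchy_on UNIV U"
  proof (rule uniformly_Cauchy_onI)
    fix e :: real assume e: "0 < e"
    then have "0 < e powr p / sup_const" using sup_const(1) by simp
    then obtain N where N: "\<And>m n. N \<le> m \<Longrightarrow> N \<le> n \<Longrightarrow> Lp_pow M p (\<lambda>x. G m x - G n x) < e powr p / sup_const"
      using cauchy by blast
    have "dist (U m x) (U n x) < e" if "N \<le> m" "N \<le> n" for m n x
    proof -
      have "\<bar>U m x - U n x\<bar> powr p < e powr p"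
        using sobolev_pair_sup[OF sobolev_pair_diff[OF U[of m] U[of n]], of x] N[OF that] sup_const(1)
        by (simp add: pos_less_divide_eq mult.commute)
      then have "\<bar>U m x - U n x\<bar> < e"
        using e p_simps by (metis abs_ge_zero less_le_not_le linorder_not_less powr_mono2)
      then show ?thesis by (simp add: dist_real_def)
    qed
    then show "\<exists>M. \<forall>x\<in>UNIV. \<forall>m\<ge>M. \<forall>n\<ge>M. dist (U m x) (U n x) < e" by blast
  qed
  then obtain V where V: "uniform_limit UNIV U V sequentially"
    using Cauchy_uniformly_convergent uniformly_convergent_on_def by blast
  have "uniform_limit UNIV \<psi> V sequentially"
  proof -
    have "uniform_limit UNIV (\<lambda>n x. \<psi> n x - U n x) (\<lambda>x. 0) sequentially"
    proof (rule uniform_limitI)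
      fix e :: real assume "0 < e"
      then have "eventually (\<lambda>n. 1 / real (Suc n) < e) sequentially"
        by (rule order_tendstoD(2)[OF LIMSEQ_Suc[OF lim_1_over_n]])
      then show "eventually (\<lambda>n. \<forall>x\<in>UNIV. dist (\<psi> n x - U n x) 0 < e) sequentially"
        by eventually_elim (use \<psi>(2) in \<open>force simp: dist_real_def intro: less_trans\<close>)
    qed
    from uniform_limit_add[OF this V] show ?thesis by simp
  qed
  moreover have "(\<lambda>n. Lp_pow M p (\<lambda>x. gradient (\<psi> n) x - H x)) \<longlonglongrightarrow> 0"
  proof (rule tendsto_sandwich[OF _ _ tendsto_const])
    have "Lp_pow M p (\<lambda>x. gradient (\<psi> n) x - H x) \<le> 2 powr p * (1 / real (Suc n) + Lp_pow M p (\<lambda>x. G n x - H x))" for n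
      by (rule order_trans[OF Lp_pow_diff_triangle[OF p_simps(2) C0_in_Lp(2)[OF \<psi>(1)] G[of n] H(1)]])
         (use \<psi>(3)[of n] in \<open>intro mult_left_mono add_right_mono, auto\<close>)
    then show "eventually (\<lambda>n. Lp_pow M p (\<lambda>x. gradient (\<psi> n) x - H x) \<le> 2 powr p * (1 / real (Suc n) + Lp_pow M p (\<lambda>x. G n x - H x))) sequentially"
      by (intro always_eventually allI)
    have "(\<lambda>n. 2 powr p * (1 / real (Suc n) + Lp_pow M p (\<lambda>x. G n x - H x))) \<longlonglongrightarrow> 2 powr p * (0 + 0)"
      by (intro tendsto_mult tendsto_add tendsto_const LIMSEQ_Suc[OF lim_1_over_n] H(2))
    then show "(\<lambda>n. 2 powr p * (1 / real (Suc n) + Lp_pow M p (\<lambda>x. G n x - H x))) \<longlonglongrightarrow> 0" by simp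
  qed (simp add: Lp_pow_nonneg)
  ultimately have "sobolev_pair V H" unfolding sobolev_pair_def using H(1) \<psi>(1) by blast
  then show ?thesis using that H(2) by blast
qed

lemma C0_has_weak_gradient:
  assumes \<phi>: "\<phi> \<in> C0_infinity \<Omega>"
  shows "has_weak_gradient \<Omega> \<phi> (gradient \<phi>)"
proof -
  have "(LINT x|M. \<phi> x * partial_deriv e \<psi> x) = - (LINT x|M. (gradient \<phi> x \<bullet> e) * \<psi> x)"
    if \<psi>: "\<psi> \<in> C0_infinity \<Omega>" and e: "e \<in> Basis" for \<psi> e
  proof -
    have m: "\<phi> \<in> borel_measurable borel" "\<psi> \<in> borel_measurable borel"
      "partial_deriv e \<phi> \<in> borel_measurable borel" "partial_deriv e \<psi> \<in> borel_measurable borel"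
      using C0_infinity_continuous[OF \<phi>] C0_infinity_continuous[OF \<psi>]
        C0_infinity_partial_continuous[OF \<phi> e] C0_infinity_partial_continuous[OF \<psi> e]
      by (auto simp: borel_measurable_continuous_onI)
    have "(LINT x|M. \<phi> x * partial_deriv e \<psi> x) = (LINT x|lborel. \<phi> x * partial_deriv e \<psi> x)"
      using m C0_infinity_outside[OF \<phi>] by (intro integral_lebesgue_on_eq_lborel dom_sets borel_measurable_times) auto
    also have "\<dots> = - (LINT x|lborel. partial_deriv e \<phi> x * \<psi> x)"
      by (rule C0_infinity_integration_by_parts[OF \<phi> \<psi> e])
    also have "(LINT x|lborel. partial_deriv e \<phi> x * \<psi> x) = (LINT x|M. partial_deriv e \<phi> x * \<psi> x)"
      using m C0_infinity_outside[OF \<psi>] by (intro integral_lebesgue_on_eq_lborel[symmetric] dom_sets borel_measurable_times) auto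
    finally show ?thesis
      by (simp add: gradient_inner[OF C0_infinity_differentiable[OF \<phi>]])
  qed
  then show ?thesis
    unfolding has_weak_gradient_def
    by (intro conjI ballI in_Lp_locally_integrable[OF p_simps(3) dom_sets] C0_in_Lp[OF \<phi>]) simp
qed

lemma sobolev_pair_in_Lp_AE:
  assumes U: "sobolev_pair U G" and ae: "AE x in M. u x = U x"
  shows "u \<in> borel_measurable M" "in_Lp M p u"
proof -
  have ae': "AE x in M. U x = u x" using ae by eventually_elim simp
  show m: "u \<in> borel_measurable M"
    by (rule borel_measurable_lebesgue_on_AE[OF dom_sets sobolev_pair_measurable[OF U] ae'])
  show "in_Lp M p u" by (rule in_Lp_cong_AE[OF ae' sobolev_pair_poincare(1)[OF U] m])
qed

lemma sobolev_pair_has_weak_gradient: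
  assumes U: "sobolev_pair U G" and ae: "AE x in M. u x = U x"
  shows "has_weak_gradient \<Omega> u G"
proof -
  note G = sobolev_pair_in_Lp[OF U] and Up = sobolev_pair_poincare(1)[OF U]
  obtain \<phi> where \<phi>: "\<And>k. \<phi> k \<in> C0_infinity \<Omega>" "(\<lambda>k. Lp_pow M p (\<lambda>x. gradient (\<phi> k) x - G x)) \<longlonglongrightarrow> 0"
    by (rule sobolev_pair_approx[OF U]) blast
  have lim: "(\<lambda>k. Lp_pow M p (\<lambda>x. \<phi> k x - U x)) \<longlonglongrightarrow> 0"
  proof (rule tendsto_sandwich[OF _ _ tendsto_const])
    show "eventually (\<lambda>k. Lp_pow M p (\<lambda>x. \<phi> k x - U x) \<le> poincare_const * Lp_pow M p (\<lambda>x. gradient (\<phi> k) x - G x)) sequentially"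
      by (intro always_eventually allI sobolev_pair_poincare(2) sobolev_pair_diff sobolev_pair_C0 \<phi>(1) U)
    show "(\<lambda>k. poincare_const * Lp_pow M p (\<lambda>x. gradient (\<phi> k) x - G x)) \<longlonglongrightarrow> 0"
      using \<phi>(2) by (auto intro!: tendsto_eq_intros)
  qed (simp add: Lp_pow_nonneg)
  have "(LINT x|M. u x * partial_deriv e \<psi> x) = - (LINT x|M. (G x \<bullet> e) * \<psi> x)"
    if \<psi>: "\<psi> \<in> C0_infinity \<Omega>" and e: "e \<in> Basis" for \<psi> e
  proof -
    obtain K where K: "compact K" "K \<subseteq> \<Omega>" "\<And>x. x \<notin> K \<Longrightarrow> \<psi> x = 0" "\<And>x. x \<notin> K \<Longrightarrow> partial_deriv e \<psi> x = 0"
      using C0_infinity_support[OF \<psi>] by metis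
    \<comment> \<open>The inner product with \<open>1\<close> casts the scalar functions in the form
      of the vector valued convergence lemma.\<close>
    have 1: "(\<lambda>k. LINT x|M. (\<phi> k x \<bullet> 1) * partial_deriv e \<psi> x) \<longlonglongrightarrow> (LINT x|M. (U x \<bullet> 1) * partial_deriv e \<psi> x)"
      by (rule integral_times_test_tendsto[OF p_simps(3) dom_sets C0_in_Lp(1)[OF \<phi>(1)] Up lim
            C0_infinity_partial_continuous[OF \<psi> e] K(1,2,4)]) auto
    have 2: "(\<lambda>k. LINT x|M. (gradient (\<phi> k) x \<bullet> e) * \<psi> x) \<longlonglongrightarrow> (LINT x|M. (G x \<bullet> e) * \<psi> x)"
      by (rule integral_times_test_tendsto[OF p_simps(3) dom_sets C0_in_Lp(2)[OF \<phi>(1)] G \<phi>(2)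
            C0_infinity_continuous[OF \<psi>] K(1,2,3)]) (use e in auto)
    have "(LINT x|M. (\<phi> k x \<bullet> 1) * partial_deriv e \<psi> x) = - (LINT x|M. (gradient (\<phi> k) x \<bullet> e) * \<psi> x)" for k
      using C0_has_weak_gradient[OF \<phi>(1)] \<psi> e by (simp add: has_weak_gradient_def)
    then have "(\<lambda>k. LINT x|M. (\<phi> k x \<bullet> 1) * partial_deriv e \<psi> x) \<longlonglongrightarrow> - (LINT x|M. (G x \<bullet> e) * \<psi> x)"
      using tendsto_minus[OF 2] by simp
    with 1 have "(LINT x|M. (U x \<bullet> 1) * partial_deriv e \<psi> x) = - (LINT x|M. (G x \<bullet> e) * \<psi> x)"
      by (rule LIMSEQ_unique)
    moreover have "(LINT x|M. u x * partial_deriv e \<psi> x) = (LINT x|M. (U x \<bullet> 1) * partial_deriv e \<psi> x)"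
    proof (rule integral_cong_AE)
      have m: "partial_deriv e \<psi> \<in> borel_measurable M"
        using C0_infinity_partial_continuous[OF \<psi> e] by (intro borel_measurable_lebesgue_onI borel_measurable_continuous_onI)
      show "(\<lambda>x. u x * partial_deriv e \<psi> x) \<in> borel_measurable M"
        using sobolev_pair_in_Lp_AE(1)[OF U ae] m by (rule borel_measurable_times)
      show "(\<lambda>x. (U x \<bullet> 1) * partial_deriv e \<psi> x) \<in> borel_measurable M"
        using borel_measurable_times[OF sobolev_pair_measurable[OF U] m] by simp
      show "AE x in M. u x * partial_deriv e \<psi> x = (U x \<bullet> 1) * partial_deriv e \<psi> x"
        using ae by eventually_elim simp
    qed
    ultimately show ?thesis by simp
  qed
  then show ?thesis
    unfolding has_weak_gradient_def
    by (intro conjI ballI in_Lp_locally_integrable[OF p_simps(3) dom_sets] G sobolev_pair_in_Lp_AE(2)[OF U ae]) simp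
qed

lemma sobolev_pair_weak_gradient:
  assumes U: "sobolev_pair U G" and ae: "AE x in M. u x = U x"
  shows "AE x in M. weak_gradient \<Omega> u x = G x" "Lp_pow M p (weak_gradient \<Omega> u) = Lp_pow M p G"
proof -
  show 1: "AE x in M. weak_gradient \<Omega> u x = G x"
    by (rule weak_gradient_AE[OF open_dom sobolev_pair_has_weak_gradient[OF U ae]])
  then have 2: "AE x in M. G x = weak_gradient \<Omega> u x" by eventually_elim simp
  note Gm = in_Lp_measurable[OF sobolev_pair_in_Lp[OF U]]
  show "Lp_pow M p (weak_gradient \<Omega> u) = Lp_pow M p G"
    by (rule Lp_pow_cong_AE[OF 1 borel_measurable_lebesgue_on_AE[OF dom_sets Gm 2] Gm])
qed

lemma sobolev_pair_W1p_norm: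
  assumes U: "sobolev_pair U G" and ae: "AE x in M. u x = U x"
  shows "W1p_norm \<Omega> p u = Lp_pow M p U powr (1 / p) + Lp_pow M p G powr (1 / p)"
  unfolding W1p_norm_def Lp_norm_eq sobolev_pair_weak_gradient(2)[OF U ae]
  using Lp_pow_cong_AE[OF ae sobolev_pair_in_Lp_AE(1)[OF U ae] sobolev_pair_measurable[OF U]] by simp

text \<open>By the Poincare bound the gradients alone control the full norm.\<close>

lemma sobolev_pair_W1p_norm_tendsto:
  assumes U: "eventually (\<lambda>i. sobolev_pair (U i) (G i) \<and> (AE x in M. u i x = U i x)) F"
    and lim: "((\<lambda>i. Lp_pow M p (G i)) \<longlongrightarrow> 0) F"
  shows "((\<lambda>i. W1p_norm \<Omega> p (u i)) \<longlongrightarrow> 0) F"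
proof -
  have U0: "((\<lambda>i. Lp_pow M p (U i)) \<longlongrightarrow> 0) F"
  proof (rule tendsto_sandwich[OF _ _ tendsto_const])
    show "eventually (\<lambda>i. Lp_pow M p (U i) \<le> poincare_const * Lp_pow M p (G i)) F"
      using U by eventually_elim (auto intro: sobolev_pair_poincare(2))
    show "((\<lambda>i. poincare_const * Lp_pow M p (G i)) \<longlongrightarrow> 0) F"
      using lim by (auto intro!: tendsto_eq_intros)
  qed (simp add: Lp_pow_nonneg)
  have z: "((\<lambda>i. f i powr (1 / p)) \<longlongrightarrow> 0) F" if "(f \<longlongrightarrow> 0) F" "\<And>i. 0 \<le> f i" for f :: "'b \<Rightarrow> real"
    using tendsto_powr'[OF that(1) tendsto_const[of "1 / p"]] that(2) p_simps by auto
  have "((\<lambda>i. Lp_pow M p (U i) powr (1 / p) + Lp_pow M p (G i) powr (1 / p)) \<longlongrightarrow> 0 + 0) F"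
    by (intro tendsto_add z U0 lim Lp_pow_nonneg)
  then have "((\<lambda>i. Lp_pow M p (U i) powr (1 / p) + Lp_pow M p (G i) powr (1 / p)) \<longlongrightarrow> 0) F" by simp
  then show ?thesis
    by (rule Lim_transform_eventually) (use U in eventually_elim, auto simp: sobolev_pair_W1p_norm)
qed

lemma sobolev_pair_W1p_0:
  assumes U: "sobolev_pair U G" and ae: "AE x in M. u x = U x"
  shows "u \<in> W1p_0 \<Omega> p"
proof -
  have "u \<in> W1p \<Omega> p"
    unfolding W1p_def Lp_space_iff
    using sobolev_pair_in_Lp_AE(2)[OF U ae] sobolev_pair_has_weak_gradient[OF U ae] sobolev_pair_in_Lp[OF U]
    by (auto simp: Lp_space_iff)
  moreover obtain \<phi> where \<phi>: "\<And>k. \<phi> k \<in> C0_infinity \<Omega>" "(\<lambda>k. Lp_pow M p (\<lambda>x. gradient (\<phi> k) x - G x)) \<longlonglongrightarrow> 0"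
    by (rule sobolev_pair_approx[OF U]) blast
  have *: "(\<lambda>k. W1p_norm \<Omega> p (\<lambda>x. \<phi> k x - u x)) \<longlonglongrightarrow> 0"
  proof (rule sobolev_pair_W1p_norm_tendsto[OF always_eventually \<phi>(2)], intro allI conjI)
    show "sobolev_pair (\<lambda>x. \<phi> k x - U x) (\<lambda>x. gradient (\<phi> k) x - G x)" for k
      by (intro sobolev_pair_diff sobolev_pair_C0 \<phi>(1) U)
    show "AE x in M. \<phi> k x - u x = \<phi> k x - U x" for k using ae by eventually_elim simp
  qed
  have "\<exists>\<phi>\<in>C0_infinity \<Omega>. W1p_norm \<Omega> p (\<lambda>x. \<phi> x - u x) < \<epsilon>" if "0 < \<epsilon>" for \<epsilon>
  proof -
    have "eventually (\<lambda>k. W1p_norm \<Omega> p (\<lambda>x. \<phi> k x - u x) < \<epsilon>) sequentially"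
      by (rule order_tendstoD(2)[OF *  that])
    then obtain k where "W1p_norm \<Omega> p (\<lambda>x. \<phi> k x - u x) < \<epsilon>"
      using eventually_happens[of _ sequentially] by fastforce
    then show ?thesis using \<phi>(1) by blast
  qed
  ultimately show ?thesis by (simp add: W1p_0_def)
qed

text \<open>The approximating test functions are Cauchy in energy and so converge to a pair. They
  then have two limits in the \<open>p\<close>-norm, \<open>u\<close> and \<open>U\<close>, which
  must agree almost everywhere.\<close>

lemma W1p_0_sobolev_pair:
  assumes u: "u \<in> W1p_0 \<Omega> p"
  obtains U G where "sobolev_pair U G" "AE x in M. u x = U x"
proof -
  have up: "in_Lp M p u" using u by (auto simp: W1p_0_def W1p_def Lp_space_iff)
  obtain g where g: "in_Lp M p g" "has_weak_gradient \<Omega> u g"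
    using u by (auto simp: W1p_0_def W1p_def Lp_space_iff)
  have "\<exists>\<phi>\<in>C0_infinity \<Omega>. W1p_norm \<Omega> p (\<lambda>x. \<phi> x - u x) < 1 / real (Suc n)" for n
    using u by (simp add: W1p_0_def)
  then obtain \<phi> where \<phi>: "\<And>n. \<phi> n \<in> C0_infinity \<Omega>" "\<And>n. W1p_norm \<Omega> p (\<lambda>x. \<phi> n x - u x) < 1 / real (Suc n)"
    by metis
  have n: "W1p_norm \<Omega> p (\<lambda>x. \<phi> n x - u x) = Lp_pow M p (\<lambda>x. \<phi> n x - u x) powr (1 / p) + Lp_pow M p (\<lambda>x. gradient (\<phi> n) x - g x) powr (1 / p)" for n
  proof -
    have 1: "AE x in M. weak_gradient \<Omega> (\<lambda>x. \<phi> n x - u x) x = gradient (\<phi> n) x - g x"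
      by (rule weak_gradient_AE[OF open_dom has_weak_gradient_diff[OF open_dom C0_has_weak_gradient[OF \<phi>(1)] g(2)]])
    then have 2: "AE x in M. gradient (\<phi> n) x - g x = weak_gradient \<Omega> (\<lambda>x. \<phi> n x - u x) x" by eventually_elim simp
    have m: "(\<lambda>x. gradient (\<phi> n) x - g x) \<in> borel_measurable M"
      using C0_in_Lp(2)[OF \<phi>(1)] g(1) by (intro borel_measurable_diff) (auto simp: in_Lp_def)
    show ?thesis
      unfolding W1p_norm_def Lp_norm_eq Lp_pow_cong_AE[OF 1 borel_measurable_lebesgue_on_AE[OF dom_sets m 2] m] ..
  qed
  have small: "f \<longlonglongrightarrow> 0" if "\<And>n. 0 \<le> f n" "\<And>n. f n powr (1 / p) < 1 / real (Suc n)" for f :: "nat \<Rightarrow> real"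
  proof (rule tendsto_sandwich[OF _ _ tendsto_const])
    have "f n \<le> (1 / real (Suc n)) powr p" for n
    proof -
      have "(f n powr (1 / p)) powr p \<le> (1 / real (Suc n)) powr p"
        using that[of n] p_simps by (intro powr_mono2) auto
      then show ?thesis using that(1)[of n] p_simps by (simp add: powr_powr)
    qed
    then show "eventually (\<lambda>n. f n \<le> (1 / real (Suc n)) powr p) sequentially" by simp
    show "(\<lambda>n. (1 / real (Suc n)) powr p) \<longlonglongrightarrow> 0"
      using tendsto_powr'[OF LIMSEQ_Suc[OF lim_1_over_n] tendsto_const[of p]] p_simps by simp
  qed (simp add: that)
  have c: "Lp_pow M p (\<lambda>x. \<phi> n x - u x) powr (1 / p) < 1 / real (Suc n)"
    "Lp_pow M p (\<lambda>x. gradient (\<phi> n) x - g x) powr (1 / p) < 1 / real (Suc n)" for n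
    using \<phi>(2)[of n, unfolded n] powr_ge_zero[of "Lp_pow M p (\<lambda>x. \<phi> n x - u x)" "1 / p"]
      powr_ge_zero[of "Lp_pow M p (\<lambda>x. gradient (\<phi> n) x - g x)" "1 / p"] by linarith+
  have s1: "(\<lambda>n. Lp_pow M p (\<lambda>x. \<phi> n x - u x)) \<longlonglongrightarrow> 0"
    by (intro small Lp_pow_nonneg c)
  have s2: "(\<lambda>n. Lp_pow M p (\<lambda>x. gradient (\<phi> n) x - g x)) \<longlonglongrightarrow> 0"
    by (intro small Lp_pow_nonneg c)
  have pr: "sobolev_pair (\<phi> n) (gradient (\<phi> n))" for n by (rule sobolev_pair_C0[OF \<phi>(1)])
  have cau: "\<exists>N. \<forall>m\<ge>N. \<forall>n\<ge>N. Lp_pow M p (\<lambda>x. gradient (\<phi> m) x - gradient (\<phi> n) x) < \<epsilon>" if "0 < \<epsilon>" for \<epsilon>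
  proof -
    have "0 < \<epsilon> / (2 powr p * 2)" using that by simp
    from order_tendstoD(2)[OF s2 this] obtain N where
      N: "\<And>n. N \<le> n \<Longrightarrow> Lp_pow M p (\<lambda>x. gradient (\<phi> n) x - g x) < \<epsilon> / (2 powr p * 2)"
      unfolding eventually_sequentially by blast
    have "Lp_pow M p (\<lambda>x. gradient (\<phi> m) x - gradient (\<phi> n) x) < \<epsilon>" if "N \<le> m" "N \<le> n" for m n
    proof -
      have "Lp_pow M p (\<lambda>x. gradient (\<phi> m) x - gradient (\<phi> n) x)
          \<le> 2 powr p * (Lp_pow M p (\<lambda>x. gradient (\<phi> m) x - g x) + Lp_pow M p (\<lambda>x. g x - gradient (\<phi> n) x))"
        by (intro Lp_pow_diff_triangle p_simps C0_in_Lp(2) \<phi>(1) g(1))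
      also have "\<dots> < 2 powr p * (\<epsilon> / (2 powr p * 2) + \<epsilon> / (2 powr p * 2))"
        using N[OF that(1)] N[OF that(2)] Lp_pow_minus_commute[of M p g "gradient (\<phi> n)"]
        by (intro mult_strict_left_mono add_strict_mono) auto
      also have "\<dots> = \<epsilon>" by simp
      finally show ?thesis .
    qed
    then show ?thesis by blast
  qed
  obtain U G where U: "sobolev_pair U G" "(\<lambda>n. Lp_pow M p (\<lambda>x. gradient (\<phi> n) x - G x)) \<longlonglongrightarrow> 0"
    using sobolev_pair_complete[OF pr cau] by blast
  have lim: "(\<lambda>n. Lp_pow M p (\<lambda>x. \<phi> n x - U x)) \<longlonglongrightarrow> 0"
  proof (rule tendsto_sandwich[OF _ _ tendsto_const])
    show "eventually (\<lambda>n. Lp_pow M p (\<lambda>x. \<phi> n x - U x) \<le> poincare_const * Lp_pow M p (\<lambda>x. gradient (\<phi> n) x - G x)) sequentially"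
      by (intro always_eventually allI sobolev_pair_poincare(2) sobolev_pair_diff pr U(1))
    show "(\<lambda>n. poincare_const * Lp_pow M p (\<lambda>x. gradient (\<phi> n) x - G x)) \<longlonglongrightarrow> 0"
      using U(2) by (auto intro!: tendsto_eq_intros)
  qed (simp add: Lp_pow_nonneg)
  have Up: "in_Lp M p U" by (rule sobolev_pair_poincare(1)[OF U(1)])
  have "Lp_pow M p (\<lambda>x. u x - U x) \<le> 0"
  proof (rule LIMSEQ_le_const)
    show "(\<lambda>n. 2 powr p * (Lp_pow M p (\<lambda>x. \<phi> n x - u x) + Lp_pow M p (\<lambda>x. \<phi> n x - U x))) \<longlonglongrightarrow> 0"
      using s1 lim by (auto intro!: tendsto_eq_intros)
    have "Lp_pow M p (\<lambda>x. u x - U x) \<le> 2 powr p * (Lp_pow M p (\<lambda>x. \<phi> n x - u x) + Lp_pow M p (\<lambda>x. \<phi> n x - U x))" for n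
      using Lp_pow_diff_triangle[OF p_simps(2) up C0_in_Lp(1)[OF \<phi>(1)] Up, of n] Lp_pow_minus_commute[of M p u "\<phi> n"] by simp
    then show "\<exists>N. \<forall>n\<ge>N. Lp_pow M p (\<lambda>x. u x - U x) \<le> 2 powr p * (Lp_pow M p (\<lambda>x. \<phi> n x - u x) + Lp_pow M p (\<lambda>x. \<phi> n x - U x))"
      by blast
  qed
  then have "AE x in M. u x - U x = 0"
    using Lp_pow_nonneg[of M p "\<lambda>x. u x - U x"]
    by (intro AE_eq_0_if_Lp_pow_eq_0[of M p] in_Lp_diff p_simps up Up) auto
  then have "AE x in M. u x = U x" by eventually_elim simp
  then show ?thesis using that U(1) by blast
qed

section \<open>Essential suprema and sharp constants\<close>

lemma emeasure_open_subset_pos: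
  assumes "open S" "x \<in> S" "S \<subseteq> \<Omega>"
  shows "0 < emeasure M S"
proof -
  have "emeasure M S = emeasure lborel S"
    using assms open_dom by (subst emeasure_restrict_space) (auto simp: emeasure_completion)
  moreover have "emeasure lborel S \<noteq> 0"
  proof
    assume "emeasure lborel S = 0"
    then have "S \<in> null_sets lebesgue" using assms(1) by (intro null_sets_completionI null_setsI) auto
    then have "negligible S" by (simp add: negligible_iff_null_sets)
    then show False using open_not_negligible assms by blast
  qed
  ultimately show ?thesis by (simp add: zero_less_iff_neq_zero)
qed

text \<open>A larger value would persist on an open set, which has positive measure. The bound
  \<open>B\<close> matters because \<open>Lp_norm\<close> assigns \<open>0\<close> to an infinite
  supremum.\<close>

lemma Lp_norm_infinity_ge:
  assumes f: "continuous_on UNIV f" "\<And>x. \<bar>f x\<bar> \<le> B" and x: "x \<in> \<Omega>"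
  shows "\<bar>f x\<bar> \<le> Lp_norm \<Omega> \<infinity> f"
proof -
  let ?S = "esssup M (\<lambda>x. ennreal (norm (f x)))"
  have m: "f \<in> borel_measurable M" using f by (intro borel_measurable_lebesgue_onI borel_measurable_continuous_onI)
  have "?S \<le> ennreal B" using f m by (intro esssup_I) (auto intro!: ennreal_leI)
  then have "?S \<noteq> top" by (metis ennreal_neq_top neq_top_trans)
  then have fin: "?S = ennreal (Lp_norm \<Omega> \<infinity> f)" by (simp add: Lp_norm_def less_top[symmetric])
  show ?thesis
  proof (rule ccontr)
    assume *: "\<not> \<bar>f x\<bar> \<le> Lp_norm \<Omega> \<infinity> f"
    let ?A = "{y. Lp_norm \<Omega> \<infinity> f < \<bar>f y\<bar>} \<inter> \<Omega>"
    have "open {y. Lp_norm \<Omega> \<infinity> f < \<bar>f y\<bar>}"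
      by (intro open_Collect_less continuous_intros f(1))
    then have "0 < emeasure M ?A" using open_dom * x by (intro emeasure_open_subset_pos[of _ x]) auto
    have "AE y in M. ennreal (norm (f y)) \<le> ?S" by (rule esssup_AE)
    then have ae: "AE y in M. y \<notin> ?A"
    proof eventually_elim
      case (elim y)
      have "0 \<le> Lp_norm \<Omega> \<infinity> f" by (simp add: Lp_norm_def)
      then have "norm (f y) \<le> Lp_norm \<Omega> \<infinity> f" using elim unfolding fin by (rule iffD1[OF ennreal_le_iff])
      then show ?case by simp
    qed
    have "open ?A" using \<open>open {y. Lp_norm \<Omega> \<infinity> f < \<bar>f y\<bar>}\<close> open_dom by (rule open_Int)
    then have "?A \<in> sets M" using dom_sets by (auto simp: sets_restrict_space_iff)
    then have "?A \<in> null_sets M" using ae by (rule iffD2[OF AE_iff_null_sets])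
    then show False using \<open>0 < emeasure M ?A\<close> by (simp add: null_setsD1)
  qed
qed

lemma Lp_norm_infinity_le:
  assumes "f \<in> borel_measurable M" "AE x in M. \<bar>f x\<bar> \<le> B" "0 \<le> B"
  shows "Lp_norm \<Omega> \<infinity> f \<le> B"
proof -
  have "esssup M (\<lambda>x. ennreal (norm (f x))) \<le> ennreal B"
    using assms(1,2) by (intro esssup_I) (auto intro: ennreal_leI elim: eventually_mono)
  then show ?thesis using assms(3) by (simp add: Lp_norm_def enn2real_leI)
qed

lemma sobolev_const_le:
  assumes "\<phi> \<in> C0_infinity \<Omega>" "Lp_norm \<Omega> q \<phi> = 1"
  shows "sobolev_const p q \<Omega> \<le> Lp_pow M p (gradient \<phi>)"
  unfolding sobolev_const_def Lp_pow_def
  by (rule cINF_lower) (use assms in \<open>auto intro!: bdd_belowI2[of _ 0]\<close>)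

text \<open>The function \<open>\<psi>\<close> witnesses that the infimum is over a nonempty set;
  the infimum of an empty set of reals carries no information.\<close>

lemma sobolev_const_greatest:
  assumes "\<psi> \<in> C0_infinity \<Omega>" "Lp_norm \<Omega> q \<psi> = 1"
    and "\<And>\<phi>. \<phi> \<in> C0_infinity \<Omega> \<Longrightarrow> Lp_norm \<Omega> q \<phi> = 1 \<Longrightarrow> c \<le> Lp_pow M p (gradient \<phi>)"
  shows "c \<le> sobolev_const p q \<Omega>"
  unfolding sobolev_const_def
  by (rule cINF_greatest) (use assms in \<open>auto simp: Lp_pow_def\<close>)

lemma Lp_pow_gradient_cmult:
  "\<phi> \<in> C0_infinity \<Omega> \<Longrightarrow> Lp_pow M p (gradient (\<lambda>x. c * \<phi> x)) = \<bar>c\<bar> powr p * Lp_pow M p (gradient \<phi>)"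
  using Lp_pow_scaleR[of M p c "gradient \<phi>"] gradient_cmult[of \<phi> \<Omega> c] by (simp add: Lp_pow_def)

text \<open>The definition made homogeneous by dividing by the norm. A function of zero norm is
  covered, since \<open>0 powr (p / q)\<close> is \<open>0\<close>.\<close>

lemma sobolev_const_finite_le:
  assumes \<phi>: "\<phi> \<in> C0_infinity \<Omega>" and q: "0 < q"
  shows "sobolev_const p (ereal q) \<Omega> * Lp_pow M q \<phi> powr (p / q) \<le> Lp_pow M p (gradient \<phi>)"
proof (cases "Lp_pow M q \<phi> = 0")
  case True
  then show ?thesis by (simp add: Lp_pow_nonneg)
next
  case False
  then have P: "0 < Lp_pow M q \<phi>" using Lp_pow_nonneg[of M q \<phi>] by simp
  define s where "s = Lp_pow M q \<phi> powr (1 / q)"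
  have s: "0 < s" "s powr q = Lp_pow M q \<phi>" "s powr p = Lp_pow M q \<phi> powr (p / q)"
    using P q by (auto simp: s_def powr_powr)
  have "Lp_pow M q (\<lambda>x. (1 / s) * \<phi> x) = 1"
    using Lp_pow_scaleR[of M q "1 / s" \<phi>] s P by (simp add: powr_divide)
  then have "Lp_norm \<Omega> (ereal q) (\<lambda>x. (1 / s) * \<phi> x) = 1" by (simp add: Lp_norm_eq)
  from sobolev_const_le[OF C0_infinity_cmult[OF \<phi>] this]
  have "sobolev_const p (ereal q) \<Omega> \<le> Lp_pow M p (gradient \<phi>) / s powr p"
    unfolding Lp_pow_gradient_cmult[OF \<phi>] using s(1) by (simp add: powr_divide)
  then have "sobolev_const p (ereal q) \<Omega> * s powr p \<le> Lp_pow M p (gradient \<phi>)"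
    using s(1) by (simp add: pos_le_divide_eq)
  then show ?thesis unfolding s(3) .
qed

lemma C0_bounded:
  assumes "\<phi> \<in> C0_infinity \<Omega>"
  obtains B where "\<And>x. \<bar>\<phi> x\<bar> \<le> B"
proof -
  obtain K where "compact K" "\<And>x. x \<notin> K \<Longrightarrow> \<phi> x = 0" using C0_infinity_support[OF assms] by metis
  then show ?thesis using bounded_compact_support[OF C0_infinity_continuous[OF assms]] that by (metis real_norm_def)
qed

text \<open>Homogeneity of the essential supremum is obtained from pointwise bounds for
  \<open>\<phi>\<close> and for its multiple, which continuity makes available.\<close>

lemma Lp_norm_infinity_normalize:
  assumes \<phi>: "\<phi> \<in> C0_infinity \<Omega>" and x: "\<phi> x \<noteq> 0"
  defines "s \<equiv> Lp_norm \<Omega> \<infinity> \<phi>"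
  shows "\<bar>\<phi> x\<bar> \<le> s" "0 < s" "Lp_norm \<Omega> \<infinity> (\<lambda>x. (1 / s) * \<phi> x) = 1"
proof -
  obtain B where B: "\<And>x. \<bar>\<phi> x\<bar> \<le> B" using C0_bounded[OF \<phi>] by blast
  have le: "\<bar>\<phi> y\<bar> \<le> s" if "y \<in> \<Omega>" for y
    unfolding s_def using Lp_norm_infinity_ge[OF C0_infinity_continuous[OF \<phi>] B that] .
  have "x \<in> \<Omega>" using C0_infinity_outside(1)[OF \<phi>] x by blast
  then show xs: "\<bar>\<phi> x\<bar> \<le> s" by (rule le)
  then show s: "0 < s" using x by linarith
  let ?\<psi> = "\<lambda>x. (1 / s) * \<phi> x"
  have \<psi>: "?\<psi> \<in> C0_infinity \<Omega>" by (rule C0_infinity_cmult[OF \<phi>])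
  have m: "\<phi> \<in> borel_measurable M" "?\<psi> \<in> borel_measurable M"
    using C0_in_Lp(1)[OF \<phi>] C0_in_Lp(1)[OF \<psi>] by (auto simp: in_Lp_def)
  have in_dom: "AE y in M. y \<in> \<Omega>" by (intro AE_I2) (simp add: space_restrict_space)
  show "Lp_norm \<Omega> \<infinity> ?\<psi> = 1"
  proof (rule antisym)
    show "Lp_norm \<Omega> \<infinity> ?\<psi> \<le> 1"
    proof (rule Lp_norm_infinity_le[OF m(2)])
      show "AE y in M. \<bar>(1 / s) * \<phi> y\<bar> \<le> 1"
        using in_dom by eventually_elim (use le s in \<open>auto simp: abs_mult\<close>)
    qed simp
    let ?t = "Lp_norm \<Omega> \<infinity> ?\<psi>"
    obtain B' where B': "\<And>x. \<bar>?\<psi> x\<bar> \<le> B'" using C0_bounded[OF \<psi>] by blast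
    have "\<bar>\<phi> y\<bar> \<le> s * ?t" if "y \<in> \<Omega>" for y
      using Lp_norm_infinity_ge[OF C0_infinity_continuous[OF \<psi>] B' that] s
      by (simp add: abs_mult pos_divide_le_eq mult.commute)
    then have "AE y in M. \<bar>\<phi> y\<bar> \<le> s * ?t" using in_dom by (auto elim: eventually_mono)
    then have "s \<le> s * ?t"
      unfolding s_def[unfolded atomize_eq] using s by (intro Lp_norm_infinity_le m(1)) (auto simp: s_def Lp_norm_def)
    then show "1 \<le> ?t" using s by simp
  qed
qed

lemma sobolev_const_nonneg:
  assumes "\<psi> \<in> C0_infinity \<Omega>" "Lp_norm \<Omega> q \<psi> = 1"
  shows "0 \<le> sobolev_const p q \<Omega>"
  by (rule sobolev_const_greatest[OF assms]) (rule Lp_pow_nonneg)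

lemma sobolev_const_infinity_le:
  assumes \<phi>: "\<phi> \<in> C0_infinity \<Omega>"
  shows "sobolev_const p \<infinity> \<Omega> * \<bar>\<phi> x\<bar> powr p \<le> Lp_pow M p (gradient \<phi>)"
proof (cases "\<phi> x = 0")
  case False
  define s where "s = Lp_norm \<Omega> \<infinity> \<phi>"
  note s = Lp_norm_infinity_normalize[OF \<phi> False, folded s_def]
  have "sobolev_const p \<infinity> \<Omega> \<le> Lp_pow M p (gradient \<phi>) / s powr p"
    using sobolev_const_le[OF C0_infinity_cmult[OF \<phi>] s(3)]
    unfolding Lp_pow_gradient_cmult[OF \<phi>] using s by (simp add: powr_divide)
  then have "sobolev_const p \<infinity> \<Omega> * s powr p \<le> Lp_pow M p (gradient \<phi>)"
    using s(2) by (simp add: pos_le_divide_eq)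
  moreover have "sobolev_const p \<infinity> \<Omega> * \<bar>\<phi> x\<bar> powr p \<le> sobolev_const p \<infinity> \<Omega> * s powr p"
    using s(1) p_simps sobolev_const_nonneg[OF C0_infinity_cmult[OF \<phi>] s(3)]
    by (intro mult_left_mono powr_mono2) auto
  ultimately show ?thesis by linarith
qed (simp add: Lp_pow_nonneg)

lemma sobolev_pair_sobolev_const:
  "sobolev_pair U G \<Longrightarrow> sobolev_const p \<infinity> \<Omega> * \<bar>U x\<bar> powr p \<le> Lp_pow M p G"
  using sobolev_pair_pointwise_bound[of "sobolev_const p \<infinity> \<Omega>" x 1 U G] sobolev_const_infinity_le by simp

lemma ex_normalized_infinity:
  assumes "\<Omega> \<noteq> {}"
  obtains \<psi> where "\<psi> \<in> C0_infinity \<Omega>" "Lp_norm \<Omega> \<infinity> \<psi> = 1"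
proof -
  obtain x where "x \<in> \<Omega>" using assms by blast
  then obtain a b where ab: "cbox a b \<subseteq> \<Omega>" "x \<in> box a b" using open_contains_cbox[OF open_dom] by metis
  have \<phi>: "box_bump 1 a b \<in> C0_infinity \<Omega>" using ab(1) by (intro box_bump_C0_infinity) auto
  have "box_bump 1 a b x \<noteq> 0" using box_bump_pos[OF ab(2), of 1] by simp
  from Lp_norm_infinity_normalize(3)[OF \<phi> this] C0_infinity_cmult[OF \<phi>] show ?thesis using that by blast
qed

lemma ex_large_value:
  assumes \<phi>: "\<phi> \<in> C0_infinity \<Omega>" "Lp_norm \<Omega> \<infinity> \<phi> = 1" and c: "0 \<le> c" "c < 1"
  obtains x where "x \<in> \<Omega>" "c < \<bar>\<phi> x\<bar>"
proof (rule ccontr)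
  assume "\<not> thesis"
  then have "\<bar>\<phi> x\<bar> \<le> c" if "x \<in> \<Omega>" for x using that \<open>\<And>x. x \<in> \<Omega> \<Longrightarrow> c < \<bar>\<phi> x\<bar> \<Longrightarrow> thesis\<close> by (meson not_less)
  then have "Lp_norm \<Omega> \<infinity> \<phi> \<le> c"
    using c C0_in_Lp(1)[OF \<phi>(1)] by (intro Lp_norm_infinity_le AE_I2) (auto simp: in_Lp_def space_restrict_space)
  then show False using \<phi>(2) c by simp
qed

text \<open>A normalized function exceeds \<open>1 / 2\<close> in modulus somewhere, and by the sup
  bound this costs a fixed amount of energy.\<close>

lemma sobolev_const_infinity_pos:
  assumes "\<Omega> \<noteq> {}"
  shows "0 < sobolev_const p \<infinity> \<Omega>"
proof -
  obtain \<psi> where \<psi>: "\<psi> \<in> C0_infinity \<Omega>" "Lp_norm \<Omega> \<infinity> \<psi> = 1" using ex_normalized_infinity[OF assms] .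
  have "(1 / 2) powr p / sup_const \<le> sobolev_const p \<infinity> \<Omega>"
  proof (rule sobolev_const_greatest[OF \<psi>])
    fix \<phi> assume \<phi>: "\<phi> \<in> C0_infinity \<Omega>" "Lp_norm \<Omega> \<infinity> \<phi> = 1"
    obtain x where x: "1 / 2 < \<bar>\<phi> x\<bar>" using ex_large_value[OF \<phi>, of "1 / 2"] by auto
    have "(1 / 2) powr p \<le> \<bar>\<phi> x\<bar> powr p" using x p_simps by (intro powr_mono2) auto
    also have "\<dots> \<le> sup_const * Lp_pow M p (gradient \<phi>)" by (rule sup_const(2)[OF \<phi>(1)])
    finally show "(1 / 2) powr p / sup_const \<le> Lp_pow M p (gradient \<phi>)"
      using sup_const(1) by (simp add: pos_divide_le_eq mult.commute)
  qed
  moreover have "0 < (1 / 2) powr p / sup_const" using sup_const(1) by simp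
  ultimately show ?thesis by linarith
qed

text \<open>One almost optimal \<open>\<phi>\<close> for the sup norm competes for every
  \<open>q\<close>: its superlevel set of level \<open>c\<close> contributes at least
  \<open>c powr q * m\<close>, whose root of order \<open>q\<close> tends to
  \<open>c\<close>.\<close>

lemma sobolev_const_limsup:
  assumes "\<Omega> \<noteq> {}" and \<epsilon>: "0 < \<epsilon>"
  shows "eventually (\<lambda>q. sobolev_const p (ereal q) \<Omega> < sobolev_const p \<infinity> \<Omega> + \<epsilon>) at_top"
proof -
  let ?S = "sobolev_const p \<infinity> \<Omega>"
  have "\<exists>\<phi>\<in>C0_infinity \<Omega>. Lp_norm \<Omega> \<infinity> \<phi> = 1 \<and> Lp_pow M p (gradient \<phi>) < ?S + \<epsilon>"
  proof (rule ccontr)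
    assume *: "\<not> ?thesis"
    obtain \<psi> where \<psi>: "\<psi> \<in> C0_infinity \<Omega>" "Lp_norm \<Omega> \<infinity> \<psi> = 1" using ex_normalized_infinity[OF assms(1)] .
    have "?S + \<epsilon> \<le> ?S" by (rule sobolev_const_greatest[OF \<psi>]) (use * in force)
    then show False using \<epsilon> by simp
  qed
  then obtain \<phi> where \<phi>: "\<phi> \<in> C0_infinity \<Omega>" "Lp_norm \<Omega> \<infinity> \<phi> = 1" and E: "Lp_pow M p (gradient \<phi>) < ?S + \<epsilon>"
    by blast
  let ?E = "Lp_pow M p (gradient \<phi>)"
  have pos: "0 < ?S + \<epsilon>" using sobolev_const_infinity_pos[OF assms(1)] \<epsilon> by simp
  \<comment> \<open>The energy lies strictly below \<open>?S + \<epsilon>\<close>, which leaves room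
    for a factor \<open>c powr p\<close> with \<open>c < 1\<close>.\<close>
  have "((\<lambda>c. (?S + \<epsilon>) * c powr p) \<longlongrightarrow> (?S + \<epsilon>) * 1 powr p) (at_left (1::real))"
    by (intro tendsto_intros) auto
  then have "eventually (\<lambda>c. ?E < (?S + \<epsilon>) * c powr p) (at_left 1)"
    using E by (intro order_tendstoD(1)) auto
  moreover have "eventually (\<lambda>c::real. c \<in> {0<..<1}) (at_left 1)" by (rule eventually_at_left_real) simp
  ultimately have "eventually (\<lambda>c. ?E < (?S + \<epsilon>) * c powr p \<and> 0 < c \<and> c < 1) (at_left 1)"
    by eventually_elim auto
  then obtain c where c: "?E < (?S + \<epsilon>) * c powr p" "0 < c" "c < 1"
    using eventually_happens' trivial_limit_at_left_real by blast
  obtain x where x: "x \<in> \<Omega>" "c < \<bar>\<phi> x\<bar>" using ex_large_value[OF \<phi>, of c] c by auto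
  define A where "A = {y. c < \<bar>\<phi> y\<bar>}"
  have "open A" unfolding A_def by (intro open_Collect_less continuous_intros C0_infinity_continuous[OF \<phi>(1)])
  have A\<Omega>: "A \<subseteq> \<Omega>" using C0_infinity_outside(1)[OF \<phi>(1)] c unfolding A_def by force
  have As: "A \<in> sets M" using \<open>open A\<close> A\<Omega> dom_sets by (simp add: sets_restrict_space_iff)
  obtain K where K: "compact K" "\<And>x. x \<notin> K \<Longrightarrow> \<phi> x = 0" using C0_infinity_support[OF \<phi>(1)] by metis
  have "A \<subseteq> K" using K(2) c unfolding A_def by force
  have fin: "emeasure M A < \<infinity>"
  proof -
    have "emeasure M A = emeasure lborel A"
      using \<open>open A\<close> A\<Omega> open_dom by (subst emeasure_restrict_space) (auto simp: emeasure_completion)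
    also have "\<dots> \<le> emeasure lborel K" using \<open>A \<subseteq> K\<close> K(1) by (intro emeasure_mono) (auto simp: compact_imp_closed)
    also have "\<dots> < \<infinity>" using emeasure_compact_finite[OF K(1)] by (simp add: less_top)
    finally show ?thesis .
  qed
  define m where "m = measure M A"
  have m: "0 < m"
    using emeasure_open_subset_pos[OF \<open>open A\<close> _ A\<Omega>, of x] x fin
    by (simp add: A_def[symmetric] m_def measure_def enn2real_positive_iff) (auto simp: A_def)
  have low: "c powr q * m \<le> Lp_pow M q \<phi>" if "0 < q" for q
  proof -
    have "c powr q * m = (LINT y|M. c powr q * indicat_real A y)"
      using As fin Int_absorb2[OF A\<Omega>] by (simp add: m_def)
    also have "\<dots> \<le> Lp_pow M q \<phi>"
      unfolding Lp_pow_def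
    proof (rule integral_mono)
      show "integrable M (\<lambda>y. c powr q * indicat_real A y)" using As fin by auto
      show "integrable M (\<lambda>y. norm (\<phi> y) powr q)"
        using C0_infinity_in_Lp(1)[OF \<phi>(1) that dom_sets] by (simp add: in_Lp_def)
      show "c powr q * indicat_real A y \<le> norm (\<phi> y) powr q" for y
        using c that by (cases "y \<in> A") (auto simp: A_def intro!: powr_mono2)
    qed
    finally show ?thesis .
  qed
  \<comment> \<open>The exponent \<open>p / q\<close> tends to \<open>0\<close>, so the size of
    \<open>m\<close> disappears in the limit; only \<open>m > 0\<close> matters.\<close>
  have "((\<lambda>q. (?S + \<epsilon>) * (c powr p * m powr (p / q))) \<longlongrightarrow> (?S + \<epsilon>) * (c powr p * m powr 0)) at_top"
    using m by (intro tendsto_intros tendsto_divide_0[OF tendsto_const] filterlim_at_top_imp_at_infinity filterlim_ident) auto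
  then have "eventually (\<lambda>q. ?E < (?S + \<epsilon>) * (c powr p * m powr (p / q))) at_top"
    using c m by (intro order_tendstoD(1)) auto
  then show ?thesis using eventually_gt_at_top[of 0]
  proof eventually_elim
    case (elim q)
    show ?case
    proof (rule ccontr)
      assume *: "\<not> ?thesis"
      have "(?S + \<epsilon>) * (c powr p * m powr (p / q)) = (?S + \<epsilon>) * (c powr q * m) powr (p / q)"
        using elim(2) m by (simp add: powr_mult powr_powr)
      also have "\<dots> \<le> sobolev_const p (ereal q) \<Omega> * Lp_pow M q \<phi> powr (p / q)"
        using * pos low[OF elim(2)] elim(2) p_simps m by (intro mult_mono powr_mono2) auto
      also have "\<dots> \<le> ?E" by (rule sobolev_const_finite_le[OF \<phi>(1) elim(2)])
      finally show False using elim(1) by simp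
    qed
  qed
qed

end

section \<open>Steiner symmetry\<close>

lemma hausdorff1_mono: "A \<subseteq> B \<Longrightarrow> hausdorff1 A \<le> hausdorff1 B"
  unfolding hausdorff1_def hausdorff1_delta_def
  by (intro SUP_mono' INF_superset_mono) auto

text \<open>The segment is covered by \<open>n\<close> consecutive pieces of length
  \<open>h \<le> \<delta>\<close> with total length \<open>2 * l\<close>; the remaining members of
  the cover are empty.\<close>

lemma hausdorff1_segment_le:
  fixes e :: "'a::euclidean_space"
  assumes e: "norm e = 1" and l: "0 \<le> l"
  shows "hausdorff1 ((\<lambda>s. x + s *\<^sub>R e) ` {-l<..<l}) \<le> ennreal (2 * l)"
  unfolding hausdorff1_def
proof (rule SUP_least)
  fix \<delta> :: real assume "\<delta> \<in> {0<..}"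
  then have \<delta>: "0 < \<delta>" by simp
  obtain n where n: "2 * l / \<delta> < real n" using reals_Archimedean2 by blast
  then have n0: "0 < real n" using l \<delta> by (meson divide_nonneg_pos le_less_trans mult_nonneg_nonneg zero_le_numeral)
  define h where "h = 2 * l / real n"
  have h: "0 \<le> h" "h \<le> \<delta>" "real n * h = 2 * l"
    using n n0 l \<delta> by (auto simp: h_def field_simps)
  let ?f = "\<lambda>s. x + s *\<^sub>R e"
  define U where "U i = (if i < n then ?f ` {-l + real i * h .. -l + real (Suc i) * h} else {})" for i
  have d: "diameter (U i) \<le> (if i < n then h else 0)" for i
  proof (cases "i < n")
    case True
    have "norm (?f s - ?f t) \<le> h" if "s \<in> {-l + real i * h .. -l + real (Suc i) * h}" "t \<in> {-l + real i * h .. -l + real (Suc i) * h}" for s t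
    proof -
      have "?f s - ?f t = (s - t) *\<^sub>R e" by (simp add: scaleR_diff_left)
      then have "norm (?f s - ?f t) = \<bar>s - t\<bar>" using e by simp
      then show ?thesis using that by (auto simp: algebra_simps)
    qed
    then have "diameter (?f ` {-l + real i * h .. -l + real (Suc i) * h}) \<le> h"
      using h(1) by (intro diameter_le) blast+
    then show ?thesis using True by (simp add: U_def)
  qed (simp add: U_def)
  have b: "bounded (U i)" for i
    unfolding U_def by (auto intro!: compact_imp_bounded compact_continuous_image continuous_intros)
  have cover: "?f ` {-l<..<l} \<subseteq> (\<Union>i. U i)"
  proof
    fix y assume "y \<in> ?f ` {-l<..<l}"
    then obtain s where "y = ?f s" "s \<in> {-l<..<l}" by (rule imageE)
    then have s: "y = ?f s" "-l < s" "s < l" by auto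
    then have h0: "0 < h" using n0 by (simp add: h_def)
    define i where "i = nat \<lfloor>(s + l) / h\<rfloor>"
    have i: "real i \<le> (s + l) / h" "(s + l) / h < real i + 1"
      using s h0 by (auto simp: i_def)
    have "(s + l) / h < real n" using s h0 h(3) by (simp add: pos_divide_less_eq)
    then have "i < n" using i(1) by linarith
    moreover have "s \<in> {-l + real i * h .. -l + real (Suc i) * h}"
      using i h0 by (auto simp: pos_le_divide_eq pos_divide_less_eq algebra_simps)
    then have "?f s \<in> ?f ` {-l + real i * h .. -l + real (Suc i) * h}" by (rule imageI)
    ultimately have "y \<in> U i" unfolding s(1) U_def by (simp only: if_True)
    then show "y \<in> (\<Union>i. U i)" by blast
  qed
  have "hausdorff1_delta \<delta> (?f ` {-l<..<l}) \<le> (\<Sum>i. ennreal (diameter (U i)))"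
    unfolding hausdorff1_delta_def
  proof (rule INF_lower, intro CollectI conjI cover allI b)
    show "diameter (U i) \<le> \<delta>" for i using d[of i] h \<delta> by (auto split: if_splits)
  qed
  also have "\<dots> = (\<Sum>i<n. ennreal (diameter (U i)))"
    by (rule suminf_finite) (auto simp: U_def)
  also have "\<dots> \<le> (\<Sum>i<n. ennreal h)"
    using d by (intro sum_mono ennreal_leI) (metis lessThan_iff)
  also have "\<dots> = ennreal (2 * l)"
  proof -
    have "ennreal (2 * l) = ennreal (real n) * ennreal h" unfolding h(3)[symmetric] using h(1) by (intro ennreal_mult) auto
    then show ?thesis by (simp add: ennreal_of_nat_eq_real_of_nat)
  qed
  finally show "hausdorff1_delta \<delta> (?f ` {-l<..<l}) \<le> ennreal (2 * l)" .
qed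

text \<open>A cover is pulled back to the real line, where subadditivity of Lebesgue measure gives
  the bound. The scale \<open>1\<close> will do, because \<open>hausdorff1\<close> is a supremum
  over all scales.\<close>

lemma hausdorff1_segment_ge:
  fixes e :: "'a::euclidean_space"
  assumes e: "norm e = 1" and l: "0 \<le> l"
  shows "ennreal (2 * l) \<le> hausdorff1 ((\<lambda>s. x + s *\<^sub>R e) ` {-l..l})"
proof -
  let ?f = "\<lambda>s. x + s *\<^sub>R e"
  have "ennreal (2 * l) \<le> hausdorff1_delta 1 (?f ` {-l..l})"
    unfolding hausdorff1_delta_def
  proof (rule INF_greatest)
    fix U :: "nat \<Rightarrow> 'a set"
    assume "U \<in> {U. ?f ` {-l..l} \<subseteq> (\<Union>i. U i) \<and> (\<forall>i. bounded (U i) \<and> diameter (U i) \<le> 1)}"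
    then have U: "?f ` {-l..l} \<subseteq> (\<Union>i. U i)" "\<And>i. bounded (U i)" by auto
    define V where "V i = {s. ?f s \<in> U i}" for i
    \<comment> \<open>The sets \<open>V i\<close> may fail to be measurable; their interval hulls
      are, and have length at most the diameter of \<open>U i\<close>.\<close>
    define J where "J i = (if V i = {} then {} else {Inf (V i)..Sup (V i)})" for i
    have st: "\<bar>s - t\<bar> \<le> diameter (U i)" if "s \<in> V i" "t \<in> V i" for s t i
      using diameter_bounded_bound[OF U(2)[of i], of "?f s" "?f t"] that e
      by (simp add: V_def dist_norm flip: scaleR_diff_left)
    have bdd: "bdd_above (V i)" "bdd_below (V i)" for i
    proof -
      show "bdd_above (V i)"
      proof (cases "V i = {}")
        case False
        then obtain t where "t \<in> V i" by blast
        then show ?thesis using st[of _ i t] by (intro bdd_aboveI[of _ "t + diameter (U i)"]) (smt (verit))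
      qed simp
      show "bdd_below (V i)"
      proof (cases "V i = {}")
        case False
        then obtain t where "t \<in> V i" by blast
        then show ?thesis using st[of _ i t] by (intro bdd_belowI[of _ "t - diameter (U i)"]) (smt (verit))
      qed simp
    qed
    have J: "emeasure lborel (J i) \<le> ennreal (diameter (U i))" for i
    proof (cases "V i = {}")
      case False
      have "Sup (V i) - diameter (U i) \<le> Inf (V i)"
      proof (rule cInf_greatest[OF False])
        fix t assume t: "t \<in> V i"
        have "Sup (V i) \<le> t + diameter (U i)"
          using st[OF _ t] by (intro cSup_least[OF False]) (smt (verit))
        then show "Sup (V i) - diameter (U i) \<le> t" by simp
      qed
      moreover obtain t where "t \<in> V i" using False by blast
      then have "Inf (V i) \<le> Sup (V i)" using bdd[of i] by (meson cInf_lower cSup_upper order_trans)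
      ultimately show ?thesis using False by (auto simp: J_def intro!: ennreal_leI)
    qed (simp add: J_def)
    have "{-l..l} \<subseteq> (\<Union>i. J i)"
    proof
      fix s assume "s \<in> {-l..l}"
      then obtain i where "s \<in> V i" using U(1) by (fastforce simp: V_def)
      then have "s \<in> J i" using bdd[of i] by (auto simp: J_def cInf_lower cSup_upper)
      then show "s \<in> (\<Union>i. J i)" by blast
    qed
    then have "emeasure lborel {-l..l} \<le> emeasure lborel (\<Union>i. J i)"
      by (intro emeasure_mono) (auto simp: J_def)
    also have "\<dots> \<le> (\<Sum>i. emeasure lborel (J i))"
      by (intro emeasure_subadditive_countably) (auto simp: J_def)
    also have "\<dots> \<le> (\<Sum>i. ennreal (diameter (U i)))"
      by (intro suminf_le J) auto
    finally show "ennreal (2 * l) \<le> (\<Sum>i. ennreal (diameter (U i)))" using l by simp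
  qed
  also have "\<dots> \<le> hausdorff1 (?f ` {-l..l})"
    unfolding hausdorff1_def by (rule SUP_upper) simp
  finally show ?thesis .
qed

lemma orth_proj_line:
  assumes "norm e = 1"
  shows "orth_proj e y + (y \<bullet> e) *\<^sub>R e = y" "orth_proj e y \<bullet> e = 0"
    "x \<bullet> e = 0 \<Longrightarrow> orth_proj e (x + t *\<^sub>R e) = x" "x \<bullet> e = 0 \<Longrightarrow> (x + t *\<^sub>R e) \<bullet> e = t"
  using assms by (auto simp: orth_proj_def inner_diff_left inner_add_left norm_eq_1)

section \<open>Symmetrization along lines\<close>

lemma steiner_set_iff:
  assumes e: "norm e = 1"
  shows "y \<in> steiner_set e E \<longleftrightarrow> orth_proj e y \<in> orth_proj e ` E \<and>
    ennreal \<bar>y \<bullet> e\<bar> < hausdorff1 (line_section e E (orth_proj e y)) / 2"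
proof
  assume "y \<in> steiner_set e E"
  then obtain x t where x: "y = x + t *\<^sub>R e" "x \<in> orth_proj e ` E" "ennreal \<bar>t\<bar> < hausdorff1 (line_section e E x) / 2"
    by (auto simp: steiner_set_def)
  then have "x \<bullet> e = 0" using orth_proj_line(2)[OF e] by auto
  then show "orth_proj e y \<in> orth_proj e ` E \<and> ennreal \<bar>y \<bullet> e\<bar> < hausdorff1 (line_section e E (orth_proj e y)) / 2"
    using x orth_proj_line(3,4)[OF e] by simp
next
  assume "orth_proj e y \<in> orth_proj e ` E \<and> ennreal \<bar>y \<bullet> e\<bar> < hausdorff1 (line_section e E (orth_proj e y)) / 2"
  then show "y \<in> steiner_set e E"
    unfolding steiner_set_def using orth_proj_line(1)[OF e, of y, symmetric] by blast
qed

text \<open>The everywhere form of Steiner symmetry. Because equal moduli are allowed, it includes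
  evenness in each coordinate besides monotonicity in the modulus.\<close>

definition steiner_monotone :: "('a::euclidean_space \<Rightarrow> real) \<Rightarrow> bool" where
  "steiner_monotone U \<longleftrightarrow> (\<forall>e\<in>Basis. \<forall>y z. orth_proj e y = orth_proj e z \<longrightarrow> \<bar>z \<bullet> e\<bar> \<le> \<bar>y \<bullet> e\<bar> \<longrightarrow> U y \<le> U z)"

lemma steiner_monotoneD:
  "steiner_monotone U \<Longrightarrow> e \<in> Basis \<Longrightarrow> orth_proj e y = orth_proj e z \<Longrightarrow> \<bar>z \<bullet> e\<bar> \<le> \<bar>y \<bullet> e\<bar> \<Longrightarrow> U y \<le> U z"
  by (auto simp: steiner_monotone_def)

text \<open>On a line parallel to \<open>e\<close>, membership in a symmetrized set depends only on
  the modulus of the coordinate, whatever \<open>u\<close> may be. Hence even an almost everywhere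
  identity with a symmetrization carries pointwise information.\<close>

lemma steiner_fun_mono:
  assumes e: "norm e = 1" and "orth_proj e y = orth_proj e z" "\<bar>z \<bullet> e\<bar> \<le> \<bar>y \<bullet> e\<bar>"
  shows "steiner_fun e u y \<le> steiner_fun e u z"
proof -
  have "z \<in> steiner_set e E" if "y \<in> steiner_set e E" for E
    using that assms(2,3) unfolding steiner_set_iff[OF e]
    by (metis ennreal_leI order_le_less_trans)
  then show ?thesis
    unfolding steiner_fun_def
    by (intro nn_integral_mono mult_right_mono) (auto simp: indicator_def)
qed

text \<open>Each section is a centred interval, and its measure is compared with a closed segment
  inside it, for \<open>y\<close> in \<open>E\<close>, or with an open segment around it, for
  \<open>y\<close> outside.\<close>

lemma steiner_set_fixed:
  fixes e :: "'a::euclidean_space"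
  assumes e: "norm e = 1" and E: "open E"
    and mono: "\<And>y z. y \<in> E \<Longrightarrow> orth_proj e y = orth_proj e z \<Longrightarrow> \<bar>z \<bullet> e\<bar> \<le> \<bar>y \<bullet> e\<bar> \<Longrightarrow> z \<in> E"
  shows "steiner_set e E = E"
proof -
  have sec: "line_section e E (orth_proj e y) = (\<lambda>s. orth_proj e y + s *\<^sub>R e) ` {s. orth_proj e y + s *\<^sub>R e \<in> E}" for y
    by (auto simp: line_section_def)
  have ord: "orth_proj e (orth_proj e y + s *\<^sub>R e) = orth_proj e y" "(orth_proj e y + s *\<^sub>R e) \<bullet> e = s" for y s
    using orth_proj_line(3,4)[OF e orth_proj_line(2)[OF e]] by auto
  show ?thesis
  proof (intro set_eqI iffI)
    fix y assume y: "y \<in> E"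
    have "open ((\<lambda>s. orth_proj e y + s *\<^sub>R e) -` E)" by (intro open_vimage E continuous_intros)
    then have "open {s. orth_proj e y + s *\<^sub>R e \<in> E}" by (simp add: vimage_def)
    moreover have "\<bar>y \<bullet> e\<bar> \<in> {s. orth_proj e y + s *\<^sub>R e \<in> E}"
      using mono[OF y, of "orth_proj e y + \<bar>y \<bullet> e\<bar> *\<^sub>R e"] by (simp add: ord)
    ultimately obtain d where d: "0 < d" "ball \<bar>y \<bullet> e\<bar> d \<subseteq> {s. orth_proj e y + s *\<^sub>R e \<in> E}"
      using openE by blast
    \<comment> \<open>Openness of \<open>E\<close> lets the section reach beyond \<open>y\<close>,
      which yields the strict inequality in the definition of the symmetrized set.\<close>
    define l where "l = \<bar>y \<bullet> e\<bar> + d / 2"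
    have l: "\<bar>y \<bullet> e\<bar> < l" "0 \<le> l" using d by (auto simp: l_def)
    have "l \<in> ball \<bar>y \<bullet> e\<bar> d" using d by (auto simp: l_def dist_real_def)
    then have lE: "orth_proj e y + l *\<^sub>R e \<in> E" using d by blast
    have "(\<lambda>s. orth_proj e y + s *\<^sub>R e) ` {-l..l} \<subseteq> line_section e E (orth_proj e y)"
      unfolding sec
    proof (rule image_mono, rule subsetI, rule CollectI)
      fix s assume "s \<in> {-l..l}"
      then show "orth_proj e y + s *\<^sub>R e \<in> E"
        using l by (intro mono[OF lE]) (auto simp: ord)
    qed
    then have "ennreal (2 * l) \<le> hausdorff1 (line_section e E (orth_proj e y))"
      using hausdorff1_segment_ge[OF e l(2)] hausdorff1_mono order_trans by blast
    then have "ennreal (2 * l) / 2 \<le> hausdorff1 (line_section e E (orth_proj e y)) / 2"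
      by (rule divide_right_mono_ennreal)
    moreover have "ennreal (2 * l) / 2 = ennreal l"
      using l by (simp add: ennreal_divide_numeral)
    moreover have "ennreal \<bar>y \<bullet> e\<bar> < ennreal l" using l by (simp add: ennreal_lessI)
    ultimately show "y \<in> steiner_set e E" unfolding steiner_set_iff[OF e] using y by auto
  next
    fix y assume y: "y \<in> steiner_set e E"
    show "y \<in> E"
    proof (rule ccontr)
      assume ny: "y \<notin> E"
      have "line_section e E (orth_proj e y) \<subseteq> (\<lambda>s. orth_proj e y + s *\<^sub>R e) ` {-\<bar>y \<bullet> e\<bar><..<\<bar>y \<bullet> e\<bar>}"
        unfolding sec
      proof (rule image_mono, rule subsetI)
        fix s assume "s \<in> {s. orth_proj e y + s *\<^sub>R e \<in> E}"
        then have "\<not> \<bar>y \<bullet> e\<bar> \<le> \<bar>s\<bar>"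
          using ny mono[of "orth_proj e y + s *\<^sub>R e" y] by (auto simp: ord)
        then show "s \<in> {-\<bar>y \<bullet> e\<bar><..<\<bar>y \<bullet> e\<bar>}" by auto
      qed
      then have "hausdorff1 (line_section e E (orth_proj e y)) \<le> ennreal (2 * \<bar>y \<bullet> e\<bar>)"
        by (rule order_trans[OF hausdorff1_mono hausdorff1_segment_le[OF e abs_ge_zero]])
      then have "hausdorff1 (line_section e E (orth_proj e y)) / 2 \<le> ennreal (2 * \<bar>y \<bullet> e\<bar>) / 2"
        by (rule divide_right_mono_ennreal)
      also have "\<dots> = ennreal \<bar>y \<bullet> e\<bar>" by (simp add: ennreal_divide_numeral)
      finally show False using y unfolding steiner_set_iff[OF e] by auto
    qed
  qed
qed

text \<open>Layer cake formula: every superlevel set is fixed, so the integral over the levels is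
  the length of \<open>{0<..<U y}\<close>.\<close>

lemma steiner_fun_fixed:
  fixes U :: "'a::euclidean_space \<Rightarrow> real"
  assumes e: "e \<in> Basis" and U: "continuous_on UNIV U" "\<And>x. 0 \<le> U x" "steiner_monotone U"
  shows "steiner_fun e U y = ennreal (U y)"
proof -
  have "steiner_set e {x. t < U x} = {x. t < U x}" for t
  proof (rule steiner_set_fixed)
    show "open {x. t < U x}" by (intro open_Collect_less continuous_intros U(1))
    show "z \<in> {x. t < U x}" if "y \<in> {x. t < U x}" "orth_proj e y = orth_proj e z" "\<bar>z \<bullet> e\<bar> \<le> \<bar>y \<bullet> e\<bar>" for y z
      using that steiner_monotoneD[OF U(3) e that(2,3)] by auto
  qed (use e in simp)
  then have "steiner_fun e U y = (\<integral>\<^sup>+t. indicator {0<..<U y} t \<partial>lborel)"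
    unfolding steiner_fun_def by (intro nn_integral_cong) (auto simp: indicator_def)
  then show ?thesis using U(2)[of y] by simp
qed

text \<open>The coordinates of \<open>x\<close> are replaced by those of \<open>z\<close> one at a
  time, each replacement being a move along a single axis.\<close>

lemma steiner_monotone_coordinatewise:
  fixes U :: "'a::euclidean_space \<Rightarrow> real"
  assumes U: "steiner_monotone U" and le: "\<And>e. e \<in> Basis \<Longrightarrow> \<bar>z \<bullet> e\<bar> \<le> \<bar>x \<bullet> e\<bar>"
  shows "U x \<le> U z"
proof -
  have "U x \<le> U (x - (\<Sum>e\<in>A. ((x - z) \<bullet> e) *\<^sub>R e))" if "finite A" "A \<subseteq> Basis" for A
    using that
  proof (induction A rule: finite_induct)
    case (insert e A)
    let ?y = "x - (\<Sum>e\<in>A. ((x - z) \<bullet> e) *\<^sub>R e)"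
    have e: "e \<in> Basis" "norm e = 1" using insert by auto
    have "(\<Sum>e\<in>A. ((x - z) \<bullet> e) *\<^sub>R e) \<bullet> e = (\<Sum>b\<in>A. ((x - z) \<bullet> b) * (b \<bullet> e))"
      by (simp add: inner_sum_left)
    also have "\<dots> = 0" using insert by (intro sum.neutral ballI) (metis inner_not_same_Basis insertI1 insertI2 mult_zero_right subset_iff)
    finally have ye: "?y \<bullet> e = x \<bullet> e" by (simp add: inner_diff_left)
    have "U ?y \<le> U (?y - ((x - z) \<bullet> e) *\<^sub>R e)"
    proof (rule steiner_monotoneD[OF U e(1)])
      show "orth_proj e ?y = orth_proj e (?y - ((x - z) \<bullet> e) *\<^sub>R e)"
        using e(1) by (simp add: orth_proj_def inner_diff_left scaleR_diff_left)
      show "\<bar>(?y - ((x - z) \<bullet> e) *\<^sub>R e) \<bullet> e\<bar> \<le> \<bar>?y \<bullet> e\<bar>"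
        unfolding inner_diff_left[of ?y] ye using le[OF e(1)] e(1) by (simp add: inner_diff_left)
    qed
    moreover have "x - (\<Sum>e\<in>insert e A. ((x - z) \<bullet> e) *\<^sub>R e) = ?y - ((x - z) \<bullet> e) *\<^sub>R e"
      unfolding sum.insert[OF insert.hyps] by (simp only: diff_diff_eq add.commute)
    moreover have "U x \<le> U ?y" using insert by blast
    ultimately show ?case by (simp only:)
  qed simp
  from this[OF finite_Basis order_refl] show ?thesis by (simp add: euclidean_representation)
qed

text \<open>Treating the set as a function makes the facts about monotone functions apply to
  \<open>\<Omega>\<close> itself.\<close>

lemma steiner_monotone_indicator:
  assumes "steiner_symmetric_set \<Omega>"
  shows "steiner_monotone (indicator \<Omega>)"
  unfolding steiner_monotone_def
proof (intro ballI allI impI)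
  fix e y z :: 'a assume e: "e \<in> Basis" and p: "orth_proj e y = orth_proj e z" and le: "\<bar>z \<bullet> e\<bar> \<le> \<bar>y \<bullet> e\<bar>"
  have "z \<in> \<Omega>" if y: "y \<in> \<Omega>"
  proof (cases "y \<bullet> e = 0")
    case True
    then have "z \<bullet> e = y \<bullet> e" using le by simp
    then have "z = y" using p by (simp add: orth_proj_def)
    then show ?thesis using y by simp
  next
    case False
    let ?r = "y - (2 * (y \<bullet> e)) *\<^sub>R e"
    have r: "?r \<in> \<Omega>" using assms e y unfolding steiner_symmetric_set_def by blast
    let ?C = "\<Omega> \<inter> range (\<lambda>t::real. y + t *\<^sub>R e)"
    have C: "convex ?C" using assms e unfolding steiner_symmetric_set_def by blast
    have 1: "y \<in> ?C" using y by (auto intro!: image_eqI[of _ _ 0])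
    have 2: "?r \<in> ?C" using r by (auto intro!: image_eqI[of _ _ "- (2 * (y \<bullet> e))"])
    \<comment> \<open>These parameters make \<open>z\<close> the convex combination of
      \<open>y\<close> and its reflection with weights \<open>1 - t\<close> and
      \<open>t\<close>.\<close>
    define q where "q = (z \<bullet> e) / (y \<bullet> e)"
    define t where "t = (1 - q) / 2"
    have "\<bar>q\<bar> \<le> 1" using le False by (simp add: q_def divide_le_eq_1)
    then have t: "0 \<le> t" "t \<le> 1" by (auto simp: t_def)
    have "(1 - t) *\<^sub>R y + t *\<^sub>R ?r \<in> ?C" using t by (intro convexD[OF C 1 2]) auto
    moreover have "(1 - t) *\<^sub>R y + t *\<^sub>R ?r = z"
    proof -
      have "(1 - t) *\<^sub>R y + t *\<^sub>R ?r = y - (2 * t * (y \<bullet> e)) *\<^sub>R e" by (simp add: algebra_simps)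
      also have "2 * t * (y \<bullet> e) = y \<bullet> e - z \<bullet> e" using False by (simp add: t_def q_def field_simps)
      also have "y - (y \<bullet> e - z \<bullet> e) *\<^sub>R e = z" using p by (simp add: orth_proj_def algebra_simps)
      finally show ?thesis .
    qed
    ultimately show ?thesis by simp
  qed
  then show "indicat_real \<Omega> y \<le> indicat_real \<Omega> z" by (auto simp: indicator_def)
qed

section \<open>From almost everywhere to everywhere\<close>

lemma continuous_le_if_AE_le:
  fixes f g :: "'a::euclidean_space \<Rightarrow> real"
  assumes W: "open W" and c: "continuous_on W f" "continuous_on W g"
    and ae: "AE x in lebesgue. x \<in> W \<longrightarrow> f x \<le> g x" and x: "x \<in> W"
  shows "f x \<le> g x"
proof (rule ccontr)
  assume n: "\<not> f x \<le> g x"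
  have "continuous_on W (\<lambda>x. f x - g x)" using c by (intro continuous_intros)
  then have o: "open ((\<lambda>x. f x - g x) -` {0<..} \<inter> W)"
    using W by (simp add: continuous_on_open_vimage)
  let ?A = "(\<lambda>x. f x - g x) -` {0<..} \<inter> W"
  have "AE x in lebesgue. x \<notin> ?A" using ae by eventually_elim auto
  then have "?A \<in> null_sets lebesgue" using o by (subst AE_iff_null_sets) auto
  then have "negligible ?A" by (simp add: negligible_iff_null_sets)
  moreover have "x \<in> ?A" using n x by simp
  ultimately show False using open_not_negligible[OF o] by blast
qed

text \<open>The new exceptional set lies in the image of the old one under the left inverse
  \<open>S\<close>, and differentiable maps send null sets to null sets.\<close>

lemma AE_lebesgue_affine:
  fixes T :: "'a::euclidean_space \<Rightarrow> 'a"
  assumes ae: "AE x in lebesgue. P x" and inv: "\<And>x. S (T x) = x" and S: "S differentiable_on UNIV"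
  shows "AE x in lebesgue. P (T x)"
proof -
  obtain N where N: "N \<in> null_sets lebesgue" "\<And>x. x \<notin> N \<Longrightarrow> P x"
    using ae unfolding completion.AE_iff_null_sets by auto
  have "negligible (S ` N)"
    using N(1) S by (intro negligible_differentiable_image_negligible)
      (auto simp: negligible_iff_null_sets intro: differentiable_on_subset)
  then have "S ` N \<in> null_sets lebesgue" by (simp add: negligible_iff_null_sets)
  moreover have "{x. \<not> P (T x)} \<subseteq> S ` N" using N(2) inv by (metis (mono_tags, lifting) imageI mem_Collect_eq subsetI)
  ultimately show ?thesis by (auto intro: AE_I')
qed

text \<open>Pointwise the symmetrization is always even and nonincreasing along \<open>e\<close>, so the continuous
  representative inherits these properties from an almost everywhere identity: move a whole
  neighbourhood of a point by a translation or by the reflection.\<close>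

lemma steiner_monotone_if_AE:
  fixes U :: "'a::euclidean_space \<Rightarrow> real"
  assumes \<Omega>: "open \<Omega>" "steiner_symmetric_set \<Omega>"
    and U: "continuous_on UNIV U" "\<And>x. x \<notin> \<Omega> \<Longrightarrow> U x = 0" and nonneg: "\<And>x. 0 \<le> U x"
    and st: "\<And>e. e \<in> Basis \<Longrightarrow> AE x in lebesgue_on \<Omega>. ennreal (U x) = steiner_fun e v x"
  shows "steiner_monotone U"
  unfolding steiner_monotone_def
proof (intro ballI allI impI)
  fix e y z :: 'a assume e: "e \<in> Basis" and p: "orth_proj e y = orth_proj e z" and le: "\<bar>z \<bullet> e\<bar> \<le> \<bar>y \<bullet> e\<bar>"
  have ne: "norm e = 1" "e \<bullet> e = 1" using e by auto
  have AE: "AE x in lebesgue. x \<in> \<Omega> \<longrightarrow> ennreal (U x) = steiner_fun e v x"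
    using st[OF e] \<Omega>(1) by (simp add: AE_restrict_space_iff)
  \<comment> \<open>Common core of reflection and translation: on \<open>W\<close> the map
    \<open>T\<close> stays in the domain and does not increase the modulus of the coordinate, so the
    inequality holds almost everywhere there and, by continuity, at \<open>y\<close>.\<close>
  have move: "U y \<le> U (T y)"
    if W: "open W" "y \<in> W" "W \<subseteq> \<Omega>" "\<And>w. w \<in> W \<Longrightarrow> T w \<in> \<Omega>"
      and T: "\<And>w. w \<in> W \<Longrightarrow> orth_proj e (T w) = orth_proj e w \<and> \<bar>T w \<bullet> e\<bar> \<le> \<bar>w \<bullet> e\<bar>"
      and inv: "\<And>x. S (T x) = x" and S: "S differentiable_on UNIV" and Tc: "continuous_on UNIV T" for W T S
  proof (rule continuous_le_if_AE_le[OF W(1) _ _ _ W(2)])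
    show "continuous_on W U" using U(1) continuous_on_subset by blast
    show "continuous_on W (\<lambda>w. U (T w))"
      by (rule continuous_on_compose2[OF U(1)]) (use Tc continuous_on_subset in auto)
    have "AE x in lebesgue. T x \<in> \<Omega> \<longrightarrow> ennreal (U (T x)) = steiner_fun e v (T x)"
      by (rule AE_lebesgue_affine[OF AE inv S])
    then show "AE x in lebesgue. x \<in> W \<longrightarrow> U x \<le> U (T x)"
      using AE
    proof eventually_elim
      case (elim x)
      show ?case
      proof
        assume x: "x \<in> W"
        have "ennreal (U x) = steiner_fun e v x" "ennreal (U (T x)) = steiner_fun e v (T x)"
          using elim x W by blast+
        moreover have "steiner_fun e v x \<le> steiner_fun e v (T x)"
          using T[OF x] by (intro steiner_fun_mono ne) auto
        ultimately have "ennreal (U x) \<le> ennreal (U (T x))" by simp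
        then show "U x \<le> U (T x)" using nonneg by simp
      qed
    qed
  qed
  show "U y \<le> U z"
  proof (cases "y \<in> \<Omega>")
    case False
    then show ?thesis using U(2) nonneg by simp
  next
    case True
    have z: "z \<in> \<Omega>" using steiner_monotoneD[OF steiner_monotone_indicator[OF \<Omega>(2)] e p le] True
      by (cases "z \<in> \<Omega>") auto
    \<comment> \<open>Equal moduli leave only the identity and the reflection. A strict inequality
      persists near \<open>y\<close> under the translation, which is why the set \<open>?W\<close>
      below is open.\<close>
    consider "z \<bullet> e = y \<bullet> e" | "z \<bullet> e = - (y \<bullet> e)" | "\<bar>z \<bullet> e\<bar> < \<bar>y \<bullet> e\<bar>" using le by linarith
    then show ?thesis
    proof cases
      case 1
      then have "z = y" using p by (simp add: orth_proj_def)
      then show ?thesis by simp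
    next
      case 2
      let ?T = "\<lambda>w. w - (2 * (w \<bullet> e)) *\<^sub>R e"
      have "z = orth_proj e y + (z \<bullet> e) *\<^sub>R e" unfolding p by (simp add: orth_proj_def)
      moreover have "(2 * (y \<bullet> e)) *\<^sub>R e = (y \<bullet> e) *\<^sub>R e + (y \<bullet> e) *\<^sub>R e"
        unfolding mult_2 by (rule scaleR_add_left)
      ultimately have z2: "z = ?T y" unfolding 2 orth_proj_def by (metis add_uminus_conv_diff diff_diff_eq scaleR_minus_left)
      show ?thesis unfolding z2
      proof (rule move[OF \<Omega>(1) True order_refl])
        show "?T w \<in> \<Omega>" if "w \<in> \<Omega>" for w using \<Omega>(2) e that unfolding steiner_symmetric_set_def by blast
        show "orth_proj e (?T w) = orth_proj e w \<and> \<bar>?T w \<bullet> e\<bar> \<le> \<bar>w \<bullet> e\<bar>" for w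
        proof -
          have "?T w \<bullet> e = - (w \<bullet> e)" using ne by (simp add: inner_diff_left)
          moreover have "(2 * (w \<bullet> e)) *\<^sub>R e = (w \<bullet> e) *\<^sub>R e + (w \<bullet> e) *\<^sub>R e"
            unfolding mult_2 by (rule scaleR_add_left)
          ultimately show ?thesis by (simp add: orth_proj_def)
        qed
        show "?T (?T x) = x" for x using ne by (simp add: inner_diff_left algebra_simps)
        show "?T differentiable_on UNIV"
          by (auto simp: differentiable_on_def intro!: derivative_intros)
        show "continuous_on UNIV ?T" by (intro continuous_intros)
      qed
    next
      case 3
      define h where "h = z \<bullet> e - y \<bullet> e"
      let ?T = "\<lambda>w. w + h *\<^sub>R e"
      have z3: "z = ?T y" using p by (simp add: orth_proj_def h_def algebra_simps)
      let ?W = "\<Omega> \<inter> (?T -` \<Omega> \<inter> {w. \<bar>?T w \<bullet> e\<bar> < \<bar>w \<bullet> e\<bar>})"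
      show ?thesis unfolding z3
      proof (rule move[of ?W])
        show "open ?W"
          using \<Omega>(1) by (intro open_Int open_vimage open_Collect_less continuous_intros)
        show "y \<in> ?W" using True z 3 unfolding z3 by auto
        show "orth_proj e (?T w) = orth_proj e w \<and> \<bar>?T w \<bullet> e\<bar> \<le> \<bar>w \<bullet> e\<bar>" if "w \<in> ?W" for w
          using ne that by (auto simp: orth_proj_def inner_add_left algebra_simps)
        show "?T x - h *\<^sub>R e = x" for x by simp
        show "(\<lambda>x. x - h *\<^sub>R e) differentiable_on UNIV"
          by (auto simp: differentiable_on_def intro!: derivative_intros)
        show "continuous_on UNIV ?T" by (intro continuous_intros)
      qed auto
    qed
  qed
qed

section \<open>The limit of the extremals\<close>

context sobolev_domain
begin

lemma steiner_representative:
  assumes sym: "steiner_symmetric_set \<Omega>" and V: "sobolev_pair V H" and ae: "AE x in M. v x = V x"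
    and st: "steiner_symmetric_fun \<Omega> p v"
  shows "0 \<le> V x" "steiner_monotone V"
proof -
  have Vc: "continuous_on UNIV V" and Vz: "\<And>x. x \<notin> \<Omega> \<Longrightarrow> V x = 0"
    using sobolev_pair_continuous[OF V] sobolev_pair_outside[OF V] by auto
  have "AE x in M. 0 \<le> v x" using st by (simp add: steiner_symmetric_fun_def)
  then have "AE x in M. 0 \<le> V x" using ae by eventually_elim simp
  then have "AE x in lebesgue. x \<in> \<Omega> \<longrightarrow> 0 \<le> V x" using open_dom by (simp add: AE_restrict_space_iff)
  then have nn: "0 \<le> V x" for x
    using continuous_le_if_AE_le[OF open_dom continuous_on_const continuous_on_subset[OF Vc subset_UNIV], of 0 x] Vz[of x]
    by (cases "x \<in> \<Omega>") auto
  then show "0 \<le> V x" .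
  show "steiner_monotone V"
  proof (rule steiner_monotone_if_AE[OF open_dom sym Vc Vz nn])
    fix e :: 'a assume "e \<in> Basis"
    then have "AE x in M. ennreal (v x) = steiner_fun e (\<lambda>y. if y \<in> \<Omega> then v y else 0) x"
      using st by (simp add: steiner_symmetric_fun_def)
    then show "AE x in M. ennreal (V x) = steiner_fun e (\<lambda>y. if y \<in> \<Omega> then v y else 0) x"
      using ae by eventually_elim simp
  qed
qed

lemma steiner_monotone_le_origin: "steiner_monotone V \<Longrightarrow> V x \<le> V 0"
  using steiner_monotone_coordinatewise[of V 0 x] by simp

text \<open>The converse passage: a monotone continuous function is fixed by every symmetrization,
  at every point.\<close>

lemma steiner_symmetric_funI:
  assumes V: "sobolev_pair V H" and nn: "\<And>x. 0 \<le> V x" and mono: "steiner_monotone V"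
  shows "steiner_symmetric_fun \<Omega> p V"
proof -
  have "(\<lambda>y. if y \<in> \<Omega> then V y else 0) = V" using sobolev_pair_outside[OF V] by auto
  then show ?thesis
    using sobolev_pair_poincare(1)[OF V] nn steiner_fun_fixed[OF _ sobolev_pair_continuous[OF V] nn mono]
    by (simp add: steiner_symmetric_fun_def Lp_space_iff)
qed

text \<open>Among pairs with value \<open>1\<close> at the origin the energy is at least \<open>\<lambda>\<^sub>p\<^sub>,\<^sub>\<infinity>\<close>; the midpoint of two
  almost minimizers is an admissible competitor, so uniform convexity makes them close.\<close>

lemma almost_minimizers_close:
  assumes "\<Omega> \<noteq> {}" and \<epsilon>: "0 < \<epsilon>"
  obtains \<delta> where "0 < \<delta>" "\<delta> < 1"
    "\<And>V H V' H'. sobolev_pair V H \<Longrightarrow> sobolev_pair V' H' \<Longrightarrow>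
      Lp_pow M p H \<le> sobolev_const p \<infinity> \<Omega> + \<delta> \<Longrightarrow> Lp_pow M p H' \<le> sobolev_const p \<infinity> \<Omega> + \<delta> \<Longrightarrow>
      1 - \<delta> \<le> V 0 \<Longrightarrow> 1 - \<delta> \<le> V' 0 \<Longrightarrow> Lp_pow M p (\<lambda>x. H x - H' x) < \<epsilon>"
proof -
  define S where "S = sobolev_const p \<infinity> \<Omega>"
  have S: "0 < S" unfolding S_def by (rule sobolev_const_infinity_pos[OF assms(1)])
  \<comment> \<open>With \<open>\<delta> < 1\<close> both energies are below \<open>S + 1\<close>,
    so the first term of the convexity estimate is at most \<open>\<epsilon> / 2\<close>.\<close>
  define \<epsilon>' where "\<epsilon>' = \<epsilon> / (4 * (S + 1))"
  have \<epsilon>': "0 < \<epsilon>'" "\<epsilon>' * (2 * (S + 1)) = \<epsilon> / 2" using \<epsilon> S by (auto simp: \<epsilon>'_def field_simps)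
  obtain C where C: "0 \<le> C"
    "\<And>f g :: 'a \<Rightarrow> 'a. in_Lp M p f \<Longrightarrow> in_Lp M p g \<Longrightarrow>
       Lp_pow M p (\<lambda>x. f x - g x) \<le> \<epsilon>' * (Lp_pow M p f + Lp_pow M p g)
         + C * ((Lp_pow M p f + Lp_pow M p g) / 2 - Lp_pow M p (\<lambda>x. (1/2) *\<^sub>R (f x + g x)))"
    by (rule Lp_pow_uniformly_convex[OF p_gt_1 \<epsilon>'(1), where 'b='a and M = M]) (rule that)
  \<comment> \<open>At \<open>\<delta> = 0\<close> the bound for the midpoint deficit vanishes; by
    continuity it stays below \<open>\<epsilon> / 2\<close> for small
    \<open>\<delta>\<close>.\<close>
  have "((\<lambda>\<delta>. C * ((S + \<delta>) - S * (1 - \<delta>) powr p)) \<longlongrightarrow> C * ((S + 0) - S * (1 - 0) powr p)) (at_right 0)"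
    by (intro tendsto_intros) auto
  then have "eventually (\<lambda>\<delta>. C * ((S + \<delta>) - S * (1 - \<delta>) powr p) < \<epsilon> / 2) (at_right 0)"
    using \<epsilon> by (intro order_tendstoD(2)) auto
  moreover have "eventually (\<lambda>\<delta>::real. \<delta> \<in> {0<..<1}) (at_right 0)" by (rule eventually_at_right_real) simp
  ultimately have "eventually (\<lambda>\<delta>. C * ((S + \<delta>) - S * (1 - \<delta>) powr p) < \<epsilon> / 2 \<and> 0 < \<delta> \<and> \<delta> < 1) (at_right 0)"
    by eventually_elim auto
  then obtain \<delta> where \<delta>: "C * ((S + \<delta>) - S * (1 - \<delta>) powr p) < \<epsilon> / 2" "0 < \<delta>" "\<delta> < 1"
    using eventually_happens' trivial_limit_at_right_real by blast
  have "Lp_pow M p (\<lambda>x. H x - H' x) < \<epsilon>"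
    if V: "sobolev_pair V H" "sobolev_pair V' H'" and le: "Lp_pow M p H \<le> S + \<delta>" "Lp_pow M p H' \<le> S + \<delta>"
      and ge: "1 - \<delta> \<le> V 0" "1 - \<delta> \<le> V' 0" for V H V' H'
  proof -
    have mid: "sobolev_pair (\<lambda>x. (1/2) * V x + (1/2) * V' x) (\<lambda>x. (1/2) *\<^sub>R H x + (1/2) *\<^sub>R H' x)"
      by (rule sobolev_pair_lincomb[OF V])
    have "S * (1 - \<delta>) powr p \<le> S * \<bar>(1/2) * V 0 + (1/2) * V' 0\<bar> powr p"
      using ge \<delta> p_simps S by (intro mult_left_mono powr_mono2) auto
    also have "\<dots> \<le> Lp_pow M p (\<lambda>x. (1/2) *\<^sub>R H x + (1/2) *\<^sub>R H' x)"
      unfolding S_def by (rule sobolev_pair_sobolev_const[OF mid])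
    also have "\<dots> = Lp_pow M p (\<lambda>x. (1/2) *\<^sub>R (H x + H' x))" by (simp add: scaleR_add_right)
    finally have low: "S * (1 - \<delta>) powr p \<le> Lp_pow M p (\<lambda>x. (1/2) *\<^sub>R (H x + H' x))" .
    have gap: "(Lp_pow M p H + Lp_pow M p H') / 2 - Lp_pow M p (\<lambda>x. (1/2) *\<^sub>R (H x + H' x)) \<le> (S + \<delta>) - S * (1 - \<delta>) powr p"
    proof -
      have "(a + b) / 2 - m \<le> s - x" if "x \<le> m" "a \<le> s" "b \<le> s" for a b m s x :: real
        using that diff_mono[of "(a + b) / 2" s x m] by simp
      from this[OF low le] show ?thesis .
    qed
    have "Lp_pow M p (\<lambda>x. H x - H' x) \<le> \<epsilon>' * (Lp_pow M p H + Lp_pow M p H')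
        + C * ((Lp_pow M p H + Lp_pow M p H') / 2 - Lp_pow M p (\<lambda>x. (1/2) *\<^sub>R (H x + H' x)))"
      by (intro C(2) sobolev_pair_in_Lp[OF V(1)] sobolev_pair_in_Lp[OF V(2)])
    also have "\<dots> \<le> \<epsilon>' * (2 * (S + 1)) + C * ((S + \<delta>) - S * (1 - \<delta>) powr p)"
      using gap le \<delta> \<epsilon>' C(1) by (intro add_mono mult_left_mono) auto
    also have "\<dots> < \<epsilon>" using \<delta>(1) \<epsilon>'(2) by simp
    finally show ?thesis .
  qed
  then show ?thesis using that[OF \<delta>(2,3)] unfolding S_def by blast
qed

lemma sobolev_pair_eqI:
  assumes "sobolev_pair V H" "sobolev_pair W G" "\<And>\<epsilon>. 0 < \<epsilon> \<Longrightarrow> Lp_pow M p (\<lambda>x. H x - G x) < \<epsilon>"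
  shows "V x = W x"
proof -
  have "Lp_pow M p (\<lambda>x. H x - G x) \<le> 0" using assms(3) by (meson less_le_not_le not_le)
  then have "\<bar>V x - W x\<bar> powr p \<le> 0"
    using sobolev_pair_sup[OF sobolev_pair_diff[OF assms(1,2)], of x] Lp_pow_nonneg[of M p "\<lambda>x. H x - G x"] by simp
  then show ?thesis by simp
qed

text \<open>Hoelder's inequality against \<open>V powr (q - 1)\<close>, whose conjugate norm is
  \<open>1\<close>, followed by the Sobolev inequality for \<open>\<phi>\<close>. The first comes
  from Young's inequality after division by the norm \<open>m\<close>.\<close>

lemma integral_duality_bound:
  assumes f: "\<phi> \<in> C0_infinity \<Omega>" and q: "p < q" and V: "in_Lp M q V" "\<And>x. 0 \<le> V x" "Lp_pow M q V = 1"
    and i: "integrable M (\<lambda>x. \<phi> x * V x powr (q - 1))" and S: "0 \<le> sobolev_const p (ereal q) \<Omega>"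
  shows "sobolev_const p (ereal q) \<Omega> powr (1 / p) * (LINT x|M. \<phi> x * V x powr (q - 1)) \<le> Lp_pow M p (gradient \<phi>) powr (1 / p)"
proof (cases "Lp_pow M q \<phi> = 0")
  case True
  have q1: "1 < q" using q p_gt_1 by simp
  have "in_Lp M q \<phi>" using q1 by (intro C0_infinity_in_Lp(1)[OF f _ dom_sets]) simp
  from AE_eq_0_if_Lp_pow_eq_0[OF this True] have "AE x in M. \<phi> x * V x powr (q - 1) = 0" by eventually_elim simp
  then have "(LINT x|M. \<phi> x * V x powr (q - 1)) = 0" by (rule integral_eq_zero_AE)
  then show ?thesis by simp
next
  case False
  have q1: "1 < q" using q p_gt_1 by simp
  have \<phi>q: "in_Lp M q \<phi>" using q1 by (intro C0_infinity_in_Lp(1)[OF f _ dom_sets]) simp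
  have P: "0 < Lp_pow M q \<phi>" using False Lp_pow_nonneg[of M q \<phi>] by simp
  define m where "m = Lp_pow M q \<phi> powr (1 / q)"
  have m: "0 < m" "m powr q = Lp_pow M q \<phi>" "m powr p = Lp_pow M q \<phi> powr (p / q)"
    using P q1 by (auto simp: m_def powr_powr)
  have "(LINT x|M. \<phi> x * V x powr (q - 1)) / m = (LINT x|M. (\<phi> x * V x powr (q - 1)) / m)" by simp
  also have "\<dots> \<le> (LINT x|M. (1 / q / m powr q) * norm (\<phi> x) powr q + (1 - 1 / q) * norm (V x) powr q)"
  proof (rule integral_mono)
    show "integrable M (\<lambda>x. (\<phi> x * V x powr (q - 1)) / m)" using i by simp
    show "integrable M (\<lambda>x. (1 / q / m powr q) * norm (\<phi> x) powr q + (1 - 1 / q) * norm (V x) powr q)"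
      using \<phi>q V(1) by (intro Bochner_Integration.integrable_add integrable_mult_right) (auto simp: in_Lp_def)
    fix x
    have "(\<phi> x * V x powr (q - 1)) / m \<le> (\<bar>\<phi> x\<bar> / m) * V x powr (q - 1)"
      using m by (auto intro!: divide_right_mono mult_right_mono)
    also have "\<dots> \<le> (\<bar>\<phi> x\<bar> / m) powr q / q + (1 - 1 / q) * V x powr q"
      using q1 m V(2) by (intro young_powr) auto
    also have "\<dots> = (1 / q / m powr q) * norm (\<phi> x) powr q + (1 - 1 / q) * norm (V x) powr q"
      using m V(2)[of x] by (simp add: powr_divide)
    finally show "(\<phi> x * V x powr (q - 1)) / m \<le> (1 / q / m powr q) * norm (\<phi> x) powr q + (1 - 1 / q) * norm (V x) powr q" .
  qed
  also have "\<dots> = (1 / q / m powr q) * Lp_pow M q \<phi> + (1 - 1 / q) * Lp_pow M q V"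
    using \<phi>q V(1) by (simp add: in_Lp_def Lp_pow_def)
  also have "\<dots> = 1" using P V(3) m(2) by simp
  finally have le: "(LINT x|M. \<phi> x * V x powr (q - 1)) \<le> m" using m(1) by simp
  have "sobolev_const p (ereal q) \<Omega> powr (1 / p) * m = (sobolev_const p (ereal q) \<Omega> * m powr p) powr (1 / p)"
    using S m(1) p_simps by (simp add: powr_mult powr_powr)
  also have "\<dots> \<le> Lp_pow M p (gradient \<phi>) powr (1 / p)"
    unfolding m(3) using sobolev_const_finite_le[OF f, of q] S q1 p_simps by (intro powr_mono2) auto
  finally show ?thesis
    using mult_left_mono[OF le powr_ge_zero[of "sobolev_const p (ereal q) \<Omega>" "1 / p"]] by linarith
qed

end

text \<open>The families \<open>U\<close> and \<open>G\<close> fix the continuous representatives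
  and their gradients once and for all, so that values at the origin make sense.\<close>

locale extremal_family = sobolev_domain \<Omega> p L for \<Omega> :: "'a::euclidean_space set" and p L +
  fixes u U :: "real \<Rightarrow> 'a \<Rightarrow> real" and G :: "real \<Rightarrow> 'a \<Rightarrow> 'a"
  assumes sym: "steiner_symmetric_set \<Omega>"
    and pair: "\<And>q. p < q \<Longrightarrow> sobolev_pair (U q) (G q)"
    and rep: "\<And>q. p < q \<Longrightarrow> AE x in M. u q x = U q x"
    and steiner: "\<And>q. p < q \<Longrightarrow> steiner_symmetric_fun \<Omega> p (u q)"
    and normalized: "\<And>q. p < q \<Longrightarrow> Lp_norm \<Omega> (ereal q) (u q) = 1"
    and minimal: "\<And>q. p < q \<Longrightarrow> sobolev_const p (ereal q) \<Omega> = (LINT x|M. norm (weak_gradient \<Omega> (u q) x) powr p)"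
begin

abbreviation "S q \<equiv> sobolev_const p (ereal q) \<Omega>"
abbreviation "S_inf \<equiv> sobolev_const p \<infinity> \<Omega>"

lemma U_nonneg: "p < q \<Longrightarrow> 0 \<le> U q x" and U_mono: "p < q \<Longrightarrow> steiner_monotone (U q)"
  using steiner_representative[OF sym pair rep steiner] by auto

lemma U_le: "p < q \<Longrightarrow> U q x \<le> U q 0"
  by (rule steiner_monotone_le_origin[OF U_mono])

lemma S_eq: "p < q \<Longrightarrow> S q = Lp_pow M p (G q)"
  unfolding minimal Lp_pow_def[symmetric] by (rule sobolev_pair_weak_gradient(2)[OF pair rep])

lemma Lp_pow_U: assumes "p < q" shows "Lp_pow M q (U q) = 1"
proof -
  have "Lp_pow M q (u q) powr (1 / q) = 1" using normalized[OF assms] by (simp add: Lp_norm_eq)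
  moreover have "0 < q" using assms p_simps by simp
  ultimately have "Lp_pow M q (u q) = 1"
    by (metis Lp_pow_nonneg divide_eq_0_iff order_less_irrefl powr_eq_one_iff_gen powr_0 zero_neq_one less_le)
  moreover have "Lp_pow M q (u q) = Lp_pow M q (U q)"
    by (rule Lp_pow_cong_AE[OF rep[OF assms] sobolev_pair_in_Lp_AE(1)[OF pair[OF assms] rep[OF assms]]
        sobolev_pair_measurable[OF pair[OF assms]]])
  ultimately show ?thesis by simp
qed

text \<open>Integrability is hidden in the normalization: the integral of a function that is not
  integrable is \<open>0\<close> by convention, not \<open>1\<close>.\<close>

lemma U_in_Lq: assumes "p < q" shows "in_Lp M q (U q)"
proof -
  have "integrable M (\<lambda>x. norm (U q x) powr q)"
    using Lp_pow_U[OF assms] not_integrable_integral_eq unfolding Lp_pow_def by fastforce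
  then show ?thesis using sobolev_pair_measurable[OF pair[OF assms]] by (simp add: in_Lp_def)
qed

lemma dom_nonempty: "\<Omega> \<noteq> {}"
proof
  assume "\<Omega> = {}"
  then have "Lp_pow M (p + 1) (U (p + 1)) = 0" by (simp add: Lp_pow_def)
  then show False using Lp_pow_U[of "p + 1"] by simp
qed

lemma S_inf_pos: "0 < S_inf"
  by (rule sobolev_const_infinity_pos[OF dom_nonempty])

lemma S_inf_le: "p < q \<Longrightarrow> S_inf * U q 0 powr p \<le> S q"
  using sobolev_pair_sobolev_const[OF pair, of q 0] U_nonneg[of q 0] by (simp add: S_eq)

text \<open>The maximum sits at the origin, so the surplus power \<open>r - p\<close> is pulled out
  as a power of \<open>U q 0\<close> and only a \<open>p\<close>-th power remains.\<close>

lemma U_powr_split: "p < q \<Longrightarrow> p \<le> r \<Longrightarrow> U q x powr r \<le> U q 0 powr (r - p) * norm (U q x) powr p"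
  using powr_mono2[of "r - p" "U q x" "U q 0"] U_le[of q x] U_nonneg[of q x]
  by (simp add: mult_right_mono flip: powr_diff) (metis diff_add_cancel mult_right_mono powr_add powr_ge_zero)

text \<open>With the Poincare bound the normalization turns into a lower bound for the power
  \<open>q - p\<close> of the maximum.\<close>

lemma one_le_U0: assumes q: "p < q" shows "1 \<le> U q 0 powr (q - p) * (poincare_const * S q)"
proof -
  have "1 = (LINT x|M. norm (U q x) powr q)" using Lp_pow_U[OF q] by (simp add: Lp_pow_def)
  also have "\<dots> \<le> (LINT x|M. U q 0 powr (q - p) * norm (U q x) powr p)"
  proof (rule integral_mono)
    show "integrable M (\<lambda>x. norm (U q x) powr q)" using U_in_Lq[OF q] by (simp add: in_Lp_def)
    show "integrable M (\<lambda>x. U q 0 powr (q - p) * norm (U q x) powr p)"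
      using sobolev_pair_poincare(1)[OF pair[OF q]] by (auto simp: in_Lp_def)
    show "norm (U q x) powr q \<le> U q 0 powr (q - p) * norm (U q x) powr p" for x
      using U_powr_split[OF q, of q x] U_nonneg[OF q, of x] q by simp
  qed
  also have "\<dots> = U q 0 powr (q - p) * Lp_pow M p (U q)" by (simp add: Lp_pow_def)
  also have "\<dots> \<le> U q 0 powr (q - p) * (poincare_const * S q)"
    using sobolev_pair_poincare(2)[OF pair[OF q]] S_eq[OF q] by (intro mult_left_mono) auto
  finally show ?thesis .
qed

text \<open>If the maximum were at most \<open>c < 1\<close>, its power \<open>q - p\<close> would
  tend to \<open>0\<close> while the energies stay bounded, against the normalization.\<close>

lemma U0_liminf:
  assumes c: "c < 1"
  shows "eventually (\<lambda>q. c < U q 0) at_top"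
proof (cases "0 < c")
  case False
  have "0 < U q 0" if "p < q" for q
    using one_le_U0[OF that] U_nonneg[OF that, of 0] by (cases "U q 0 = 0") auto
  then show ?thesis using False by (intro eventually_mono[OF eventually_gt_at_top[of p]]) (force intro: le_less_trans)
next
  case True
  \<comment> \<open>Eventually \<open>S q < S_inf + 1\<close>, so this bound no longer depends on
    \<open>q\<close>.\<close>
  define K where "K = poincare_const * (S_inf + 1)"
  have K: "0 < K" using poincare_const_pos S_inf_pos by (simp add: K_def)
  have "((\<lambda>q. exp (ln c * (q - p)) * K) \<longlongrightarrow> 0 * K) at_top"
  proof (intro tendsto_mult tendsto_const filterlim_compose[OF exp_at_bot])
    have "LIM q at_top. q - p :> at_top" using filterlim_tendsto_add_at_top[OF tendsto_const[of "- p"] filterlim_ident] by simp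
    then show "LIM q at_top. ln c * (q - p) :> at_bot"
      using True c by (intro filterlim_tendsto_neg_mult_at_bot[OF tendsto_const]) auto
  qed
  then have "eventually (\<lambda>q. exp (ln c * (q - p)) * K < 1) at_top"
    by (intro order_tendstoD(2)) auto
  then show ?thesis using eventually_gt_at_top[of p] sobolev_const_limsup[OF dom_nonempty zero_less_one]
  proof eventually_elim
    case (elim q)
    show ?case
    proof (rule ccontr)
      assume *: "\<not> c < U q 0"
      have "1 \<le> U q 0 powr (q - p) * (poincare_const * S q)" by (rule one_le_U0[OF elim(2)])
      also have "\<dots> \<le> c powr (q - p) * K"
        unfolding K_def using * elim U_nonneg[of q 0] poincare_const_pos S_eq[of q] Lp_pow_nonneg[of M p "G q"] True
        by (intro mult_mono powr_mono2) auto
      also have "\<dots> = exp (ln c * (q - p)) * K" using True by (simp add: powr_def mult.commute)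
      finally show False using elim(1) by simp
    qed
  qed
qed

lemma S_tendsto: "(S \<longlongrightarrow> S_inf) at_top"
proof (rule order_tendstoI)
  fix a assume a: "a < S_inf"
  have "((\<lambda>c. S_inf * c powr p) \<longlongrightarrow> S_inf * 1 powr p) (at_left (1::real))"
    by (intro tendsto_intros) auto
  then have "eventually (\<lambda>c. a < S_inf * c powr p) (at_left 1)"
    using a by (intro order_tendstoD(1)) auto
  moreover have "eventually (\<lambda>c::real. c \<in> {0<..<1}) (at_left 1)" by (rule eventually_at_left_real) simp
  ultimately have "eventually (\<lambda>c. a < S_inf * c powr p \<and> 0 < c \<and> c < 1) (at_left 1)"
    by eventually_elim auto
  then obtain c where c: "a < S_inf * c powr p" "0 < c" "c < 1"
    using eventually_happens' trivial_limit_at_left_real by blast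
  show "eventually (\<lambda>q. a < S q) at_top"
    using U0_liminf[OF c(3)] eventually_gt_at_top[of p]
  proof eventually_elim
    case (elim q)
    have "a < S_inf * c powr p" by (rule c(1))
    also have "\<dots> \<le> S_inf * U q 0 powr p"
      using elim c p_simps S_inf_pos by (intro mult_left_mono powr_mono2) auto
    also have "\<dots> \<le> S q" by (rule S_inf_le[OF elim(2)])
    finally show ?case .
  qed
next
  fix a assume "S_inf < a"
  then show "eventually (\<lambda>q. S q < a) at_top"
    using sobolev_const_limsup[OF dom_nonempty, of "a - S_inf"] by simp
qed

text \<open>The lower limit is known; values staying above \<open>1\<close> would violate
  \<open>S_inf * U q 0 powr p \<le> S q\<close>, whose right side tends to
  \<open>S_inf\<close>.\<close>

lemma U0_tendsto: "((\<lambda>q. U q 0) \<longlongrightarrow> 1) at_top"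
proof (rule order_tendstoI)
  show "eventually (\<lambda>q. a < U q 0) at_top" if "a < 1" for a using U0_liminf[OF that] .
  fix a :: real assume a: "1 < a"
  have "1 powr p < a powr p" using a p_simps by (intro powr_less_mono2) auto
  then have "S_inf < S_inf * a powr p" using S_inf_pos by simp
  from order_tendstoD(2)[OF S_tendsto this] show "eventually (\<lambda>q. U q 0 < a) at_top"
    using eventually_gt_at_top[of p]
  proof eventually_elim
    case (elim q)
    then have "S_inf * U q 0 powr p < S_inf * a powr p" using S_inf_le[of q] by linarith
    then have "U q 0 powr p < a powr p" using S_inf_pos by simp
    then show ?case using a p_simps powr_mono2[of p a "U q 0"] by (meson less_le_not_le less_trans not_le order_less_imp_le zero_less_one)
  qed
qed

lemma eventually_almost_minimizer:
  assumes "0 < \<delta>"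
  shows "eventually (\<lambda>q. p < q \<and> sobolev_pair (U q) (G q) \<and> Lp_pow M p (G q) \<le> S_inf + \<delta> \<and> 1 - \<delta> \<le> U q 0) at_top"
proof -
  have "eventually (\<lambda>q. S q < S_inf + \<delta>) at_top" using assms by (intro order_tendstoD(2)[OF S_tendsto]) auto
  moreover have "eventually (\<lambda>q. 1 - \<delta> < U q 0) at_top" using assms by (intro order_tendstoD(1)[OF U0_tendsto]) auto
  ultimately show ?thesis using eventually_gt_at_top[of p]
    by eventually_elim (use S_eq pair in auto)
qed

section \<open>The limit function and its uniqueness\<close>

lemma ex_limit:
  obtains W H where "sobolev_pair W H" "W 0 = 1" "Lp_pow M p H = S_inf" "\<And>x. 0 \<le> W x" "steiner_monotone W"
proof -
  \<comment> \<open>A sequence of exponents suffices to produce the limit; the shift by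
    \<open>1\<close> keeps all of them above \<open>p\<close>.\<close>
  define r where "r n = p + 1 + real n" for n :: nat
  have r: "p < r n" for n by (simp add: r_def)
  have rl: "filterlim r at_top sequentially"
    unfolding r_def by (rule filterlim_tendsto_add_at_top[OF tendsto_const filterlim_real_sequentially])
  have cau: "\<exists>N. \<forall>m\<ge>N. \<forall>n\<ge>N. Lp_pow M p (\<lambda>x. G (r m) x - G (r n) x) < \<epsilon>" if e: "0 < \<epsilon>" for \<epsilon>
  proof -
    obtain \<delta> where \<delta>: "0 < \<delta>" "\<delta> < 1" "\<And>V H V' H'. sobolev_pair V H \<Longrightarrow> sobolev_pair V' H' \<Longrightarrow>
      Lp_pow M p H \<le> S_inf + \<delta> \<Longrightarrow> Lp_pow M p H' \<le> S_inf + \<delta> \<Longrightarrow>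
      1 - \<delta> \<le> V 0 \<Longrightarrow> 1 - \<delta> \<le> V' 0 \<Longrightarrow> Lp_pow M p (\<lambda>x. H x - H' x) < \<epsilon>"
      by (rule almost_minimizers_close[OF dom_nonempty e]) (rule that)
    have "eventually (\<lambda>n. Lp_pow M p (G (r n)) \<le> S_inf + \<delta> \<and> 1 - \<delta> \<le> U (r n) 0) sequentially"
      using filterlim_iff[THEN iffD1, OF rl, rule_format, OF eventually_almost_minimizer[OF \<delta>(1)]]
      by eventually_elim simp
    then obtain N where N: "\<And>n. N \<le> n \<Longrightarrow> Lp_pow M p (G (r n)) \<le> S_inf + \<delta> \<and> 1 - \<delta> \<le> U (r n) 0"
      unfolding eventually_sequentially by blast
    then show ?thesis using \<delta>(3)[OF pair[OF r] pair[OF r]] by blast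
  qed
  obtain W H where W: "sobolev_pair W H" "(\<lambda>n. Lp_pow M p (\<lambda>x. G (r n) x - H x)) \<longlonglongrightarrow> 0"
    using sobolev_pair_complete[OF pair[OF r] cau] by blast
  have ul: "uniform_limit UNIV (\<lambda>n. U (r n)) W sequentially"
    using sobolev_pair_uniform_limit[OF _ W] pair[OF r] by simp
  have pt: "(\<lambda>n. U (r n) x) \<longlonglongrightarrow> W x" for x
    using tendsto_uniform_limitI[OF ul, of x] by simp
  have "(\<lambda>n. Lp_pow M p (G (r n))) \<longlonglongrightarrow> Lp_pow M p H"
    using W sobolev_pair_in_Lp[OF pair[OF r]] sobolev_pair_in_Lp[OF W(1)] p_simps by (intro Lp_pow_tendsto) auto
  moreover have "(\<lambda>n. Lp_pow M p (G (r n))) \<longlonglongrightarrow> S_inf"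
    using filterlim_compose[OF S_tendsto rl] S_eq[OF r] by simp
  ultimately have "Lp_pow M p H = S_inf" by (rule LIMSEQ_unique)
  moreover have "W 0 = 1"
    using LIMSEQ_unique[OF pt filterlim_compose[OF U0_tendsto rl]] .
  moreover have "0 \<le> W x" for x
    by (rule LIMSEQ_le_const[OF pt]) (use U_nonneg[OF r] in auto)
  moreover have "steiner_monotone W"
    unfolding steiner_monotone_def
  proof (intro ballI allI impI)
    fix e y z :: 'a assume a: "e \<in> Basis" "orth_proj e y = orth_proj e z" "\<bar>z \<bullet> e\<bar> \<le> \<bar>y \<bullet> e\<bar>"
    show "W y \<le> W z"
      by (rule LIMSEQ_le[OF pt pt]) (use steiner_monotoneD[OF U_mono[OF r] a] in auto)
  qed
  ultimately show ?thesis using that W(1) by blast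
qed

text \<open>An exact minimizer is an almost minimizer for every \<open>\<delta>\<close> and can be
  compared with each \<open>U q\<close> directly; so the whole family converges, not only a
  sequence.\<close>

lemma G_tendsto:
  assumes W: "sobolev_pair W H" "W 0 = 1" "Lp_pow M p H = S_inf"
  shows "((\<lambda>q. Lp_pow M p (\<lambda>x. G q x - H x)) \<longlongrightarrow> 0) at_top"
proof (rule order_tendstoI)
  show "eventually (\<lambda>q. a < Lp_pow M p (\<lambda>x. G q x - H x)) at_top" if "a < 0" for a
    using that Lp_pow_nonneg less_le_trans by (intro always_eventually allI) blast
  fix \<epsilon> :: real assume e: "0 < \<epsilon>"
  obtain \<delta> where \<delta>: "0 < \<delta>" "\<delta> < 1" "\<And>V H V' H'. sobolev_pair V H \<Longrightarrow> sobolev_pair V' H' \<Longrightarrow>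
    Lp_pow M p H \<le> S_inf + \<delta> \<Longrightarrow> Lp_pow M p H' \<le> S_inf + \<delta> \<Longrightarrow>
    1 - \<delta> \<le> V 0 \<Longrightarrow> 1 - \<delta> \<le> V' 0 \<Longrightarrow> Lp_pow M p (\<lambda>x. H x - H' x) < \<epsilon>"
    by (rule almost_minimizers_close[OF dom_nonempty e]) (rule that)
  show "eventually (\<lambda>q. Lp_pow M p (\<lambda>x. G q x - H x) < \<epsilon>) at_top"
    using eventually_almost_minimizer[OF \<delta>(1)]
    by eventually_elim (rule \<delta>(3)[OF _ W(1)], use W \<delta>(1) in auto)
qed

text \<open>Only \<open>1 \<le> V 0\<close> is asked of the competitor: for an extremal, the value
  at the origin is known merely to bound the essential supremum \<open>1\<close> from above.\<close>

lemma limit_unique: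
  assumes W: "sobolev_pair W H" "W 0 = 1" "Lp_pow M p H = S_inf"
    and V: "sobolev_pair V K" "1 \<le> V 0" "Lp_pow M p K = S_inf"
  shows "V x = W x"
proof (rule sobolev_pair_eqI[OF V(1) W(1)])
  fix \<epsilon> :: real assume e: "0 < \<epsilon>"
  obtain \<delta> where \<delta>: "0 < \<delta>" "\<delta> < 1" "\<And>V H V' H'. sobolev_pair V H \<Longrightarrow> sobolev_pair V' H' \<Longrightarrow>
    Lp_pow M p H \<le> S_inf + \<delta> \<Longrightarrow> Lp_pow M p H' \<le> S_inf + \<delta> \<Longrightarrow>
    1 - \<delta> \<le> V 0 \<Longrightarrow> 1 - \<delta> \<le> V' 0 \<Longrightarrow> Lp_pow M p (\<lambda>x. H x - H' x) < \<epsilon>"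
    by (rule almost_minimizers_close[OF dom_nonempty e]) (rule that)
  show "Lp_pow M p (\<lambda>x. K x - H x) < \<epsilon>"
    by (rule \<delta>(3)[OF V(1) W(1)]) (use V W \<delta>(1) in auto)
qed

lemma limit_is_extremal:
  assumes W: "sobolev_pair W H" "W 0 = 1" "Lp_pow M p H = S_inf" "\<And>x. 0 \<le> W x" "steiner_monotone W"
  shows "is_extremal p \<infinity> \<Omega> W"
proof -
  have le: "\<bar>W x\<bar> \<le> 1" for x using steiner_monotone_le_origin[OF W(5), of x] W(2,4) by simp
  have "0 \<in> \<Omega>" using sobolev_pair_outside[OF W(1), of 0] W(2) by fastforce
  from Lp_norm_infinity_ge[OF sobolev_pair_continuous[OF W(1)] le this] have "1 \<le> Lp_norm \<Omega> \<infinity> W" using W(2) by simp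
  moreover have "Lp_norm \<Omega> \<infinity> W \<le> 1"
    using le by (intro Lp_norm_infinity_le sobolev_pair_measurable[OF W(1)]) auto
  ultimately show ?thesis
    using sobolev_pair_W1p_0[OF W(1), of W] sobolev_pair_weak_gradient(2)[OF W(1), of W] W(3)
    by (simp add: is_extremal_def Lp_pow_def)
qed

text \<open>Symmetry puts the maximum of the representative at the origin, so the norm
  \<open>1\<close> forces a value of at least \<open>1\<close> there, and uniqueness of the
  minimizer applies.\<close>

lemma extremal_eq_limit:
  assumes W: "sobolev_pair W H" "W 0 = 1" "Lp_pow M p H = S_inf"
    and v: "is_extremal p \<infinity> \<Omega> v" "steiner_symmetric_fun \<Omega> p v"
  shows "AE x in M. v x = W x"
proof -
  obtain V K where V: "sobolev_pair V K" "AE x in M. v x = V x"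
    using W1p_0_sobolev_pair[of v] v(1) unfolding is_extremal_def by metis
  have K: "Lp_pow M p K = S_inf"
    using sobolev_pair_weak_gradient(2)[OF V] v(1) by (simp add: is_extremal_def Lp_pow_def)
  note nn = steiner_representative(1)[OF sym V v(2)] and mono = steiner_representative(2)[OF sym V v(2)]
  have "AE x in M. \<bar>v x\<bar> \<le> V 0"
    using V(2) by eventually_elim (use nn steiner_monotone_le_origin[OF mono] in auto)
  then have "1 \<le> V 0"
    using Lp_norm_infinity_le[OF sobolev_pair_in_Lp_AE(1)[OF V], of "V 0"] v(1) nn by (simp add: is_extremal_def)
  from limit_unique[OF W V(1) this K] V(2) show ?thesis by (auto elim: eventually_mono)
qed

lemma W1p_norm_limit:
  assumes W: "sobolev_pair W H" "W 0 = 1" "Lp_pow M p H = S_inf"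
  shows "((\<lambda>q. W1p_norm \<Omega> p (\<lambda>x. u q x - W x)) \<longlongrightarrow> 0) at_top"
proof (rule sobolev_pair_W1p_norm_tendsto[OF _ G_tendsto[OF W]])
  show "eventually (\<lambda>q. sobolev_pair (\<lambda>x. U q x - W x) (\<lambda>x. G q x - H x) \<and> (AE x in M. u q x - W x = U q x - W x)) at_top"
    using eventually_gt_at_top[of p]
    by eventually_elim (use pair rep W(1) in \<open>auto intro: sobolev_pair_diff elim!: eventually_mono\<close>)
qed

text \<open>The exponent \<open>q - 1\<close> has to be at least \<open>p\<close> for the power to
  be dominated by the \<open>p\<close>-th power; hence the hypothesis \<open>p + 1 \<le> q\<close>,
  harmless in the limit.\<close>

lemma U_power_integrable:
  assumes q: "p + 1 \<le> q"
  shows "integrable M (\<lambda>x. U q x powr (q - 1))"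
proof (rule Bochner_Integration.integrable_bound)
  have pq: "p < q" using q by simp
  show "integrable M (\<lambda>x. U q 0 powr (q - 1 - p) * norm (U q x) powr p)"
    using sobolev_pair_poincare(1)[OF pair[OF pq]] by (auto simp: in_Lp_def)
  show "(\<lambda>x. U q x powr (q - 1)) \<in> borel_measurable M"
    using sobolev_pair_measurable[OF pair[OF pq]] by measurable
  show "AE x in M. norm (U q x powr (q - 1)) \<le> norm (U q 0 powr (q - 1 - p) * norm (U q x) powr p)"
    using U_powr_split[OF pq, of "q - 1"] q by (intro AE_I2) auto
qed

text \<open>Extension from test functions to all pairs: the test functions converge uniformly, while
  \<open>U q powr (q - 1)\<close> has a finite integral.\<close>

lemma duality_bound:
  assumes q: "p + 1 \<le> q" and V: "sobolev_pair V K"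
  shows "integrable M (\<lambda>x. V x * U q x powr (q - 1))"
    and "S q powr (1 / p) * (LINT x|M. V x * U q x powr (q - 1)) \<le> Lp_pow M p K powr (1 / p)"
proof -
  have pq: "p < q" using q by simp
  note Ui = U_power_integrable[OF q]
  have int: "integrable M (\<lambda>x. Z x * U q x powr (q - 1))"
    if "Z \<in> borel_measurable M" "\<And>x. \<bar>Z x\<bar> \<le> B" for Z :: "'a \<Rightarrow> real" and B
  proof (rule Bochner_Integration.integrable_bound)
    show "integrable M (\<lambda>x. B * U q x powr (q - 1))" using Ui by simp
    show "(\<lambda>x. Z x * U q x powr (q - 1)) \<in> borel_measurable M"
      using that(1) borel_measurable_integrable[OF Ui] by (rule borel_measurable_times)
    show "AE x in M. norm (Z x * U q x powr (q - 1)) \<le> norm (B * U q x powr (q - 1))"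
      using that(2) by (intro AE_I2) (auto simp: abs_mult intro!: mult_right_mono order_trans[OF _ abs_ge_self])
  qed
  have Vb: "\<bar>V x\<bar> \<le> (sup_const * Lp_pow M p K) powr (1 / p)" for x
  proof -
    have "(\<bar>V x\<bar> powr p) powr (1 / p) \<le> (sup_const * Lp_pow M p K) powr (1 / p)"
      using sobolev_pair_sup[OF V, of x] p_simps by (intro powr_mono2) auto
    then show ?thesis using p_simps by (simp add: powr_powr)
  qed
  show Vi: "integrable M (\<lambda>x. V x * U q x powr (q - 1))"
    by (rule int[OF sobolev_pair_measurable[OF V] Vb])
  obtain \<phi> where \<phi>: "\<And>k. \<phi> k \<in> C0_infinity \<Omega>" "uniform_limit UNIV \<phi> V sequentially"
      "(\<lambda>k. Lp_pow M p (gradient (\<phi> k))) \<longlonglongrightarrow> Lp_pow M p K"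
    by (rule sobolev_pair_approx[OF V]) (rule that)
  have \<phi>i: "integrable M (\<lambda>x. \<phi> k x * U q x powr (q - 1))" for k
  proof -
    obtain B where "\<And>x. \<bar>\<phi> k x\<bar> \<le> B" using C0_bounded[OF \<phi>(1)] by blast
    then show ?thesis using int[OF in_Lp_measurable[OF C0_in_Lp(1)[OF \<phi>(1)]]] by blast
  qed
  define J where "J = (LINT x|M. U q x powr (q - 1))"
  have J: "0 \<le> J" by (simp add: J_def)
  have lim: "(\<lambda>k. LINT x|M. \<phi> k x * U q x powr (q - 1)) \<longlonglongrightarrow> (LINT x|M. V x * U q x powr (q - 1))"
  proof (rule LIMSEQ_I)
    fix \<epsilon> :: real assume e: "0 < \<epsilon>"
    then have "0 < \<epsilon> / (J + 1)" using J by simp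
    from uniform_limitD[OF \<phi>(2) this] obtain N where N: "\<And>k x. N \<le> k \<Longrightarrow> \<bar>\<phi> k x - V x\<bar> < \<epsilon> / (J + 1)"
      unfolding eventually_sequentially dist_real_def by auto
    have "norm ((LINT x|M. \<phi> k x * U q x powr (q - 1)) - (LINT x|M. V x * U q x powr (q - 1))) < \<epsilon>" if k: "N \<le> k" for k
    proof -
      have "norm ((LINT x|M. \<phi> k x * U q x powr (q - 1)) - (LINT x|M. V x * U q x powr (q - 1)))
          = norm (LINT x|M. (\<phi> k x - V x) * U q x powr (q - 1))"
        using \<phi>i Vi by (simp add: left_diff_distrib)
      also have "\<dots> \<le> (LINT x|M. \<epsilon> / (J + 1) * U q x powr (q - 1))"
      proof (rule order_trans[OF integral_norm_bound], rule integral_mono)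
        show "integrable M (\<lambda>x. norm ((\<phi> k x - V x) * U q x powr (q - 1)))"
          using Bochner_Integration.integrable_diff[OF \<phi>i[of k] Vi]
          by (intro integrable_norm) (simp add: left_diff_distrib)
        show "integrable M (\<lambda>x. \<epsilon> / (J + 1) * U q x powr (q - 1))" using Ui by (rule integrable_mult_right)
        show "norm ((\<phi> k x - V x) * U q x powr (q - 1)) \<le> \<epsilon> / (J + 1) * U q x powr (q - 1)" for x
          using N[OF k, of x] by (simp add: abs_mult mult_right_mono less_imp_le del: times_divide_eq_left)
      qed
      also have "\<dots> = \<epsilon> / (J + 1) * J" by (simp add: J_def)
      also have "\<dots> < \<epsilon>" using J e by (simp add: pos_divide_less_eq algebra_simps)
      finally show ?thesis .
    qed
    then show "\<exists>N. \<forall>k\<ge>N. norm ((LINT x|M. \<phi> k x * U q x powr (q - 1)) - (LINT x|M. V x * U q x powr (q - 1))) < \<epsilon>" by blast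
  qed
  show "S q powr (1 / p) * (LINT x|M. V x * U q x powr (q - 1)) \<le> Lp_pow M p K powr (1 / p)"
  proof (rule LIMSEQ_le)
    show "(\<lambda>k. S q powr (1 / p) * (LINT x|M. \<phi> k x * U q x powr (q - 1))) \<longlonglongrightarrow> S q powr (1 / p) * (LINT x|M. V x * U q x powr (q - 1))"
      by (intro tendsto_intros lim)
    show "(\<lambda>k. Lp_pow M p (gradient (\<phi> k)) powr (1 / p)) \<longlonglongrightarrow> Lp_pow M p K powr (1 / p)"
      using p_simps by (intro tendsto_powr' \<phi>(3) tendsto_const) (auto simp: Lp_pow_nonneg)
    have "0 \<le> S q" using S_eq[OF pq] Lp_pow_nonneg[of M p "G q"] by simp
    then have "S q powr (1 / p) * (LINT x|M. \<phi> k x * U q x powr (q - 1)) \<le> Lp_pow M p (gradient (\<phi> k)) powr (1 / p)" for k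
      by (rule integral_duality_bound[OF \<phi>(1) pq U_in_Lq[OF pq] U_nonneg[OF pq] Lp_pow_U[OF pq] \<phi>i])
    then show "\<exists>N. \<forall>k\<ge>N. S q powr (1 / p) * (LINT x|M. \<phi> k x * U q x powr (q - 1)) \<le> Lp_pow M p (gradient (\<phi> k)) powr (1 / p)"
      by blast
  qed
qed

text \<open>Duality at \<open>U q + s \<phi>\<close>: the pairing of \<open>U q\<close> with its own
  power is \<open>1\<close> by normalization, so the left side is affine in
  \<open>s\<close>.\<close>

lemma duality_bound_perturbed:
  assumes q: "p + 1 \<le> q" and \<phi>: "\<phi> \<in> C0_infinity \<Omega>"
  shows "S q powr (1 / p) * (1 + s * (LINT x|M. \<phi> x * U q x powr (q - 1)))
    \<le> Lp_pow M p (\<lambda>x. G q x + s *\<^sub>R gradient \<phi> x) powr (1 / p)"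
proof -
  have pq: "p < q" using q by simp
  have "sobolev_pair (\<lambda>x. 1 * U q x + s * \<phi> x) (\<lambda>x. 1 *\<^sub>R G q x + s *\<^sub>R gradient \<phi> x)"
    by (rule sobolev_pair_lincomb[OF pair[OF pq] sobolev_pair_C0[OF \<phi>]])
  from duality_bound(2)[OF q this]
  have 1: "S q powr (1 / p) * (LINT x|M. (U q x + s * \<phi> x) * U q x powr (q - 1)) \<le> Lp_pow M p (\<lambda>x. G q x + s *\<^sub>R gradient \<phi> x) powr (1 / p)"
    by simp
  have "(LINT x|M. U q x * U q x powr (q - 1)) = Lp_pow M q (U q)"
    unfolding Lp_pow_def using U_nonneg[OF pq]
    by (intro Bochner_Integration.integral_cong) (auto simp: powr_mult_base)
  then have "(LINT x|M. (U q x + s * \<phi> x) * U q x powr (q - 1)) = 1 + s * (LINT x|M. \<phi> x * U q x powr (q - 1))"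
    using duality_bound(1)[OF q pair[OF pq]] duality_bound(1)[OF q sobolev_pair_C0[OF \<phi>]] Lp_pow_U[OF pq]
    by (simp add: distrib_right mult.assoc)
  with 1 show ?thesis by simp
qed

text \<open>The norm \<open>N s\<close> of \<open>\<nabla>u\<^sub>\<infinity> + s \<nabla>\<phi>\<close> lies above its value \<open>a\<close> at \<open>s = 0\<close> by at least \<open>a s \<phi>(0)\<close>,
  since \<open>u\<^sub>\<infinity>\<close> is a minimizer.  Its second difference is \<open>o(s)\<close>, so this lower bound is its
  linearization, and the duality bounds with \<open>\<plusminus>s\<close> squeeze the moments of \<open>u\<^sub>q\<^sup>q\<^sup>-\<^sup>1\<close>.\<close>

lemma moments_tendsto:
  assumes W: "sobolev_pair W H" "W 0 = 1" "Lp_pow M p H = S_inf" and \<phi>: "\<phi> \<in> C0_infinity \<Omega>"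
  shows "((\<lambda>q. S q * (LINT x|M. \<phi> x * U q x powr (q - 1))) \<longlongrightarrow> S_inf * \<phi> 0) at_top"
proof -
  define I where "I q = (LINT x|M. \<phi> x * U q x powr (q - 1))" for q
  define N where "N s = Lp_pow M p (\<lambda>x. H x + s *\<^sub>R gradient \<phi> x) powr (1 / p)" for s
  define a where "a = S_inf powr (1 / p)"
  have a: "0 < a" "a powr p = S_inf" "a powr (p - 1) = S_inf powr (1 - 1 / p)"
    using S_inf_pos p_simps by (auto simp: a_def powr_powr field_simps)
  have Hp: "in_Lp M p H" by (rule sobolev_pair_in_Lp[OF W(1)])
  note gp = C0_in_Lp(2)[OF \<phi>]
  have N_ge: "a * (1 + s * \<phi> 0) \<le> N s" for s
  proof -
    have "sobolev_pair (\<lambda>x. 1 * W x + s * \<phi> x) (\<lambda>x. 1 *\<^sub>R H x + s *\<^sub>R gradient \<phi> x)"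
      by (rule sobolev_pair_lincomb[OF W(1) sobolev_pair_C0[OF \<phi>]])
    from sobolev_pair_sobolev_const[OF this, of 0]
    have "(S_inf * \<bar>1 + s * \<phi> 0\<bar> powr p) powr (1 / p) \<le> N s"
      unfolding N_def using S_inf_pos W(2) p_simps by (intro powr_mono2) auto
    moreover have "(S_inf * \<bar>1 + s * \<phi> 0\<bar> powr p) powr (1 / p) = a * \<bar>1 + s * \<phi> 0\<bar>"
      using p_simps by (simp add: powr_mult powr_powr a_def)
    moreover have "a * (1 + s * \<phi> 0) \<le> a * \<bar>1 + s * \<phi> 0\<bar>" using a(1) by (intro mult_left_mono) auto
    ultimately show ?thesis by linarith
  qed
  have Nq: "((\<lambda>q. Lp_pow M p (\<lambda>x. G q x + s *\<^sub>R gradient \<phi> x) powr (1 / p)) \<longlongrightarrow> N s) at_top" for s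
  proof -
    have "((\<lambda>q. Lp_pow M p (\<lambda>x. G q x + s *\<^sub>R gradient \<phi> x)) \<longlongrightarrow> Lp_pow M p (\<lambda>x. H x + s *\<^sub>R gradient \<phi> x)) at_top"
    proof (rule Lp_pow_tendsto[OF p_simps(3)])
      show "eventually (\<lambda>q. in_Lp M p (\<lambda>x. G q x + s *\<^sub>R gradient \<phi> x)) at_top"
        using eventually_gt_at_top[of p]
        by eventually_elim (intro in_Lp_add in_Lp_scaleR p_simps gp sobolev_pair_in_Lp[OF pair])
      show "in_Lp M p (\<lambda>x. H x + s *\<^sub>R gradient \<phi> x)" by (intro in_Lp_add in_Lp_scaleR p_simps gp Hp)
      show "((\<lambda>q. Lp_pow M p (\<lambda>x. G q x + s *\<^sub>R gradient \<phi> x - (H x + s *\<^sub>R gradient \<phi> x))) \<longlongrightarrow> 0) at_top"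
        using G_tendsto[OF W] by simp
    qed
    then show ?thesis unfolding N_def using p_simps by (intro tendsto_powr' tendsto_const) (auto simp: Lp_pow_nonneg)
  qed
  have Sp: "((\<lambda>q. S q powr (1 / p)) \<longlongrightarrow> a) at_top"
    unfolding a_def using S_inf_pos by (intro tendsto_powr S_tendsto tendsto_const) auto
  \<comment> \<open>Young's inequality in its role as tangent inequality bounds the increment of the
    norm \<open>N\<close> by that of its power, so the second difference of \<open>N\<close>
    inherits the estimate known for the power.\<close>
  have tangent: "p * a powr (p - 1) * (N s - a) \<le> Lp_pow M p (\<lambda>x. H x + s *\<^sub>R gradient \<phi> x) - S_inf" for s
  proof -
    have Np: "N s powr p = Lp_pow M p (\<lambda>x. H x + s *\<^sub>R gradient \<phi> x)"
      using p_simps by (simp add: N_def powr_powr Lp_pow_nonneg)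
    have "N s * a powr (p - 1) \<le> N s powr p / p + (1 - 1 / p) * a powr p"
      using p_gt_1 a by (intro young_powr) (auto simp: N_def)
    then have "p * (N s * a powr (p - 1)) \<le> p * (N s powr p / p + (1 - 1 / p) * a powr p)"
      using p_simps by (intro mult_left_mono) auto
    also have "\<dots> = N s powr p + (p - 1) * a powr p" using p_simps by (simp add: field_simps)
    finally have "p * (N s * a powr (p - 1)) \<le> N s powr p + (p - 1) * a powr p" .
    moreover have "a powr (p - 1) * a = a powr p" using a(1) powr_mult_base[of a "p - 1"] by (simp add: mult.commute)
    ultimately show ?thesis unfolding Np[symmetric] a(2)[symmetric] by (simp add: algebra_simps)
  qed
  define h where "h n = 1 / real (Suc n)" for n
  have h: "0 < h n" for n by (simp add: h_def)
  have small: "eventually (\<lambda>n. (N (h n) + N (- h n) - 2 * a) / h n < \<epsilon>) sequentially" if e: "0 < \<epsilon>" for \<epsilon>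
  proof -
    let ?d = "\<lambda>n. real (Suc n) * (Lp_pow M p (\<lambda>x. H x + (1 / real (Suc n)) *\<^sub>R gradient \<phi> x)
     + Lp_pow M p (\<lambda>x. H x - (1 / real (Suc n)) *\<^sub>R gradient \<phi> x) - 2 * Lp_pow M p H)"
    have c: "0 < p * a powr (p - 1)" using p_simps(1) a(1) by simp
    have "?d \<longlonglongrightarrow> 0" by (rule Lp_pow_second_difference[OF p_gt_1 Hp gp])
    then have "eventually (\<lambda>n. ?d n < p * a powr (p - 1) * \<epsilon>) sequentially"
      using c e by (intro order_tendstoD(2)) auto
    then show ?thesis
    proof eventually_elim
      case (elim n)
      have "p * a powr (p - 1) * (N (h n) + N (- h n) - 2 * a)
          \<le> Lp_pow M p (\<lambda>x. H x + h n *\<^sub>R gradient \<phi> x) + Lp_pow M p (\<lambda>x. H x - h n *\<^sub>R gradient \<phi> x) - 2 * Lp_pow M p H"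
        using tangent[of "h n"] tangent[of "- h n"] by (simp add: W(3) algebra_simps)
      then have "real (Suc n) * (p * a powr (p - 1) * (N (h n) + N (- h n) - 2 * a)) \<le> ?d n"
        unfolding h_def by (rule mult_left_mono) simp
      moreover have "p * a powr (p - 1) * ((N (h n) + N (- h n) - 2 * a) / h n)
          = real (Suc n) * (p * a powr (p - 1) * (N (h n) + N (- h n) - 2 * a))"
        by (simp add: h_def)
      ultimately have "p * a powr (p - 1) * ((N (h n) + N (- h n) - 2 * a) / h n) < p * a powr (p - 1) * \<epsilon>"
        using elim by linarith
      then show ?case using c by (simp only: mult_less_cancel_left_pos)
    qed
  qed
  have bound: "eventually (\<lambda>q. S q powr (1 / p) * (s * I q) < N s - a + \<eta>) at_top" if "0 < \<eta>" for s \<eta>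
  proof -
    have "((\<lambda>q. Lp_pow M p (\<lambda>x. G q x + s *\<^sub>R gradient \<phi> x) powr (1 / p) - S q powr (1 / p)) \<longlongrightarrow> N s - a) at_top"
      by (intro tendsto_intros Nq Sp)
    then have "eventually (\<lambda>q. Lp_pow M p (\<lambda>x. G q x + s *\<^sub>R gradient \<phi> x) powr (1 / p) - S q powr (1 / p) < N s - a + \<eta>) at_top"
      using that by (intro order_tendstoD(2)) auto
    then show ?thesis using eventually_ge_at_top[of "p + 1"]
    proof eventually_elim
      case (elim q)
      then show ?case using duality_bound_perturbed[OF elim(2) \<phi>, of s] by (simp add: I_def distrib_left)
    qed
  qed
  have lim: "((\<lambda>q. S q powr (1 / p) * I q) \<longlongrightarrow> a * \<phi> 0) at_top"
  proof (rule tendstoI)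
    fix \<epsilon> :: real assume e: "0 < \<epsilon>"
    \<comment> \<open>The step \<open>s = h n\<close> is fixed before \<open>q\<close> tends to
      infinity, because the convergence in \<open>q\<close> is known for each \<open>s\<close>
      separately.\<close>
    obtain n where n: "(N (h n) + N (- h n) - 2 * a) / h n < \<epsilon> / 2"
      using small[of "\<epsilon> / 2"] e eventually_happens[of _ sequentially] by fastforce
    define s where "s = h n"
    have s: "0 < s" "N s + N (- s) - 2 * a < s * (\<epsilon> / 2)"
      using n h[of n] by (auto simp: s_def pos_divide_less_eq mult.commute)
    \<comment> \<open>The lower bound at \<open>- s\<close> together with the small second
      difference gives the upper bound at \<open>s\<close>, and vice versa.\<close>
    have up: "N s - a < s * (a * \<phi> 0 + \<epsilon> / 2)" "N (- s) - a < s * (\<epsilon> / 2 - a * \<phi> 0)"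
      using N_ge[of s] N_ge[of "- s"] s by (auto simp: algebra_simps)
    have \<eta>: "0 < s * (\<epsilon> / 2)" using s e by simp
    show "eventually (\<lambda>q. dist (S q powr (1 / p) * I q) (a * \<phi> 0) < \<epsilon>) at_top"
      using bound[OF \<eta>, of s] bound[OF \<eta>, of "- s"]
    proof eventually_elim
      case (elim q)
      have "s * (S q powr (1 / p) * I q) < s * (a * \<phi> 0 + \<epsilon>)"
        using elim(1) up(1) by (simp add: algebra_simps)
      moreover have "s * (a * \<phi> 0 - \<epsilon>) < s * (S q powr (1 / p) * I q)"
        using elim(2) up(2) by (simp add: algebra_simps)
      ultimately show ?case using s(1) by (simp add: dist_real_def abs_less_iff)
    qed
  qed
  \<comment> \<open>Duality produces the constant with exponent \<open>1 / p\<close>; the missing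
    power \<open>1 - 1 / p\<close> converges on its own.\<close>
  have "((\<lambda>q. S q powr (1 - 1 / p) * (S q powr (1 / p) * I q)) \<longlongrightarrow> S_inf powr (1 - 1 / p) * (a * \<phi> 0)) at_top"
    using S_inf_pos by (intro tendsto_mult[OF _ lim] tendsto_powr S_tendsto tendsto_const) auto
  moreover have "S_inf powr (1 - 1 / p) * (a * \<phi> 0) = S_inf * \<phi> 0"
    using S_inf_pos by (simp add: a_def mult.assoc[symmetric] flip: powr_add)
  moreover have "eventually (\<lambda>q. S q powr (1 - 1 / p) * (S q powr (1 / p) * I q) = S q * I q) at_top"
    using order_tendstoD(1)[OF S_tendsto S_inf_pos]
    by eventually_elim (simp add: mult.assoc[symmetric] flip: powr_add)
  ultimately show ?thesis unfolding I_def using Lim_transform_eventually by fastforce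
qed

lemma distributions_tendsto:
  assumes W: "sobolev_pair W H" "W 0 = 1" "Lp_pow M p H = S_inf"
  shows "tendsto_distributions \<Omega> (\<lambda>q. distribution_of \<Omega> (\<lambda>x. S q * u q x powr (q - 1)))
    (\<lambda>\<phi>. S_inf * dirac 0 \<phi>) at_top"
  unfolding tendsto_distributions_def
proof
  fix \<phi> assume \<phi>: "\<phi> \<in> C0_infinity \<Omega>"
  have "eventually (\<lambda>q. S q * (LINT x|M. \<phi> x * U q x powr (q - 1)) = distribution_of \<Omega> (\<lambda>x. S q * u q x powr (q - 1)) \<phi>) at_top"
    using eventually_gt_at_top[of p]
  proof eventually_elim
    case (elim q)
    note [measurable] = sobolev_pair_measurable[OF pair[OF elim]] sobolev_pair_in_Lp_AE(1)[OF pair[OF elim] rep[OF elim]]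
      in_Lp_measurable[OF C0_in_Lp(1)[OF \<phi>]]
    have "distribution_of \<Omega> (\<lambda>x. S q * u q x powr (q - 1)) \<phi> = (LINT x|M. S q * (\<phi> x * U q x powr (q - 1)))"
      unfolding distribution_of_def
    proof (rule integral_cong_AE)
      show "AE x in M. S q * u q x powr (q - 1) * \<phi> x = S q * (\<phi> x * U q x powr (q - 1))"
        using rep[OF elim] by eventually_elim simp
    qed measurable
    then show ?case by simp
  qed
  from Lim_transform_eventually[OF moments_tendsto[OF W \<phi>] this]
  show "((\<lambda>q. distribution_of \<Omega> (\<lambda>x. S q * u q x powr (q - 1)) \<phi>) \<longlongrightarrow> S_inf * dirac 0 \<phi>) at_top"
    by (simp add: dirac_def)
qed

end

text \<open>Given one exterior point \<open>z\<close>, monotonicity of the indicator excludes every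
  point whose coordinates all have at least the modulus of those of \<open>z\<close>. The summand
  \<open>1\<close> in the choice of \<open>L\<close> makes it positive even for
  \<open>z = 0\<close>.\<close>

lemma steiner_symmetric_far_corner:
  fixes \<Omega> :: "'a::euclidean_space set"
  assumes "steiner_symmetric_set \<Omega>" "\<Omega> \<noteq> UNIV"
  obtains L where "0 < L" "\<And>x. \<forall>e\<in>Basis. L \<le> \<bar>x \<bullet> e\<bar> \<Longrightarrow> x \<notin> \<Omega>"
proof -
  obtain z where z: "z \<notin> \<Omega>" using assms(2) by blast
  show ?thesis
  proof (rule that[of "norm z + 1"])
    fix x :: 'a assume x: "\<forall>e\<in>Basis. norm z + 1 \<le> \<bar>x \<bullet> e\<bar>"
    have "\<bar>z \<bullet> e\<bar> \<le> \<bar>x \<bullet> e\<bar>" if "e \<in> Basis" for e using Basis_le_norm[OF that, of z] x that by force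
    from steiner_monotone_coordinatewise[OF steiner_monotone_indicator[OF assms(1)] this] z
    show "x \<notin> \<Omega>" by (auto simp: indicator_def)
  qed (simp add: add_nonneg_pos)
qed

theorem theorem5p2:
  fixes \<Omega> :: "(real ^ 'n) set" and p :: real and u :: "real \<Rightarrow> real ^ 'n \<Rightarrow> real"
  assumes "real CARD('n) < p"
    and "open \<Omega>" and "steiner_symmetric_set \<Omega>" and "\<Omega> \<noteq> UNIV"
    and "\<And>q. p < q \<Longrightarrow> u q \<in> W1p_0 \<Omega> p"
    and "\<And>q. p < q \<Longrightarrow> steiner_symmetric_fun \<Omega> p (u q)"
    and "\<And>q. p < q \<Longrightarrow> Lp_norm \<Omega> (ereal q) (u q) = 1"
    and "\<And>q. p < q \<Longrightarrow> sobolev_const p (ereal q) \<Omega> =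
           (LINT x|lebesgue_on \<Omega>. norm (weak_gradient \<Omega> (u q) x) powr p)"
  shows "\<exists>u_inf \<in> W1p_0 \<Omega> p.
           steiner_symmetric_fun \<Omega> p u_inf \<and>
           ((\<lambda>q. W1p_norm \<Omega> p (\<lambda>x. u q x - u_inf x)) \<longlongrightarrow> 0) at_top \<and>
           is_extremal p \<infinity> \<Omega> u_inf \<and>
           (\<forall>v. is_extremal p \<infinity> \<Omega> v \<and> steiner_symmetric_fun \<Omega> p v \<longrightarrow>
                (AE x in lebesgue_on \<Omega>. v x = u_inf x)) \<and>
           tendsto_distributions \<Omega>
             (\<lambda>q. distribution_of \<Omega> (\<lambda>x. sobolev_const p (ereal q) \<Omega> * u q x powr (q - 1)))
             (\<lambda>\<phi>. sobolev_const p \<infinity> \<Omega> * dirac 0 \<phi>)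
             at_top"
proof -
  obtain L where L: "0 < L" "\<And>x. \<forall>e\<in>Basis. L \<le> \<bar>x \<bullet> e\<bar> \<Longrightarrow> x \<notin> \<Omega>"
    using steiner_symmetric_far_corner[OF assms(3,4)] by metis
  interpret sobolev_domain \<Omega> p L
    by unfold_locales (use assms(1,2) L in auto)
  have "\<exists>U G. sobolev_pair U G \<and> (AE x in lebesgue_on \<Omega>. u q x = U x)" if "p < q" for q
    using W1p_0_sobolev_pair[OF assms(5)[OF that]] by metis
  \<comment> \<open>Representatives are chosen for all \<open>q > p\<close> at once, as the locale
    takes them as families.\<close>
  then obtain U G where UG: "\<And>q. p < q \<Longrightarrow> sobolev_pair (U q) (G q) \<and> (AE x in lebesgue_on \<Omega>. u q x = U q x)"
    by metis
  interpret extremal_family \<Omega> p L u U G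
    by unfold_locales (use UG assms(3,6-8) in auto)
  obtain W H where W: "sobolev_pair W H" "W 0 = 1" "Lp_pow (lebesgue_on \<Omega>) p H = sobolev_const p \<infinity> \<Omega>"
      "\<And>x. 0 \<le> W x" "steiner_monotone W"
    by (rule ex_limit) (rule that)
  show ?thesis
    using sobolev_pair_W1p_0[OF W(1), of W] steiner_symmetric_funI[OF W(1,4,5)] W1p_norm_limit[OF W(1-3)]
      limit_is_extremal[OF W] extremal_eq_limit[OF W(1-3)] distributions_tendsto[OF W(1-3)]
    by (intro bexI[of _ W]) auto
qed

end
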